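(* Let $W$ be a positive random variable and consider, for each $n$, either the Chung-Lu model or the erased Norros-Reittu model on $n$ vertices with weight distribution that of $W$ (one fixed choice of model for all $n$). Let $\mathcal{C}_n$ be its cycle-counting point process, and let $\mathcal{C}_{\min}^{(n)}$, $\mathcal{C}_{\max}^{(n)}$ be the lengths of its shortest and longest cycle. Let $\eta$ be a Poisson point process on $\mathbb{N}_{\geq 3}$ with intensity measure given by $\lambda(\{k\})=\lambda_k$, and let $\mathcal{S},\mathcal{L}$ be as defined in the context. Then, for each of the two models: 1. If $\mathbf{E}[W^2]<\infty$, then $\mathcal{C}_n\overset{d}{\longrightarrow}\eta$ as $n\to\infty$. 2. If $\mathbf{E}[W^4]<\infty$, then for all $N\in\mathbb{N}$ there exists a constant $C>0$ such that for all $A\subseteq\{3,4,\dots,N\}$ and $n\geq 3$, $d_{TV}(\mathcal{C}_n(A),\eta(A))\leq\frac{C}{n}$. 3. If $\mathbf{E}[W^2]<\mathbf{E}[W]$ and $a>0$, then there exists a constant $C>0$ such that for all $n\geq 3$, $\mathbf{P}(\mathcal{C}_n(\{\lfloor a\log(n)\rfloor+1,\dots,n\})>0)\leq Cn^{a\log(p)}$ for $p=\frac{2\mathbf{E}[W^2]}{\mathbf{E}[W^2]+\mathbf{E}[W]}$. 4. If $\mathbf{E}[W^4]<\infty$ and $\mathbf{E}[W^2]<\mathbf{E}[W]$, then there exists a constant $C>0$ such that for all $n\geq 3$ and $A\subseteq\mathbb{N}_{\geq 3}$, $d_{TV}(\mathcal{C}_n(A),\eta(A))\leq\frac{C\log(n)^3}{n}$.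 5. If $\mathbf{E}[W^4]<\infty$ and $\mathbf{E}[W^2]<\mathbf{E}[W]$, then there exists a constant $C>0$ such that for all $n\geq 3$, $d_{Kol}(\mathcal{C}_{\min}^{(n)},\mathcal{S})\leq\frac{C\log(n)^3}{n}$, and there exists a constant $C>0$ such that for all $n\ge 3$, $d_{Kol}(\mathcal{C}_{\max}^{(n)},\mathcal{L})\leq\frac{C\log(n)^3}{n}$.
   Context: Models: for $n\in\mathbb{N}$ the vertex set is $[n]=\{1,\dots,n\}$, the vertices carry i.i.d. weights $W_1,\dots,W_n$ distributed as $W$, and $L_n=\sum_{i=1}^n W_i$. Conditionally on the weights, any two distinct vertices $i,j\in[n]$ are joined by an edge independently, with probability $\min(1,W_iW_j/L_n)$ in the Chung-Lu model and with probability $1-\exp(-W_iW_j/L_n)$ in the erased Norros-Reittu model. $\mathbb{N}_{\geq 3}=\{3,4,\dots\}$. For a set $A$ of positive integers, $\mathcal{C}_n(A)$ is the number of cycles (as subgraphs, each counted once irrespective of starting vertex and orientation) in the graph whose length lies in $A$; all cycles have length at least $3$. If the graph contains no cycle, $\mathcal{C}_{\max}^{(n)}=\mathcal{C}_{\min}^{(n)}=0$. For $k\in\mathbb{N}$, $\lambda_k=\frac{1}{2k}\left(\frac{\mathbf{E}[W^2]}{\mathbf{E}[W]}\right)^k$. $\overset{d}{\longrightarrow}$ denotes convergence in distribution with respect to the vague topology on the set of counting measures on $\mathbb{N}_{\ge 3}$, equivalently convergence of the finite-dimensional distributions of $(\mathcal{C}_n(\{k\}))_{k\geq 3}$ to those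 of $(\eta(\{k\}))_{k\ge3}$. When $\mathbf{E}[W^2]<\mathbf{E}[W]$, the $\{0,3,4,\dots\}$-valued random variables $\mathcal{S},\mathcal{L}$ have laws given by $\mathbf{P}(\mathcal{S}=0)=\mathbf{P}(\mathcal{L}=0)=\exp(-\sum_{k=3}^\infty\lambda_k)$ and, for all integers $t\geq 3$, $\mathbf{P}(3\leq\mathcal{S}\leq t)=1-\exp(-\sum_{k=3}^t\lambda_k)$ and $\mathbf{P}(\mathcal{L}\leq t)=\exp(-\sum_{k=t+1}^\infty\lambda_k)$. For $\mathbb{N}_0$-valued $X,Y$, $d_{TV}(X,Y)=\sup_{B\subseteq\mathbb{N}_0}|\mathbf{P}(X\in B)-\mathbf{P}(Y\in B)|$; for real random variables, $d_{Kol}(X,Y)=\sup_{t\in\mathbb{R}}|\mathbf{P}(X\leq t)-\mathbf{P}(Y\leq t)|$. *)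

theory Defs
  imports "HOL-Probability.Probability"
begin

section \<open>The random graph models\<close>

datatype graph_model = Chung_Lu | Norros_Reittu

text \<open>\<open>Norros_Reittu\<close> is the erased version, without multiple edges and loops.\<close>

definition edge_prob :: "graph_model \<Rightarrow> nat \<Rightarrow> (nat \<Rightarrow> real) \<Rightarrow> nat \<Rightarrow> nat \<Rightarrow> real" where
  "edge_prob model n w i j =
     (let L = (\<Sum>k = 1..n. w k) in
      case model of
        Chung_Lu \<Rightarrow> min 1 (w i * w j / L)
      | Norros_Reittu \<Rightarrow> 1 - exp (- (w i * w j / L)))"

definition vertex_pairs :: "nat \<Rightarrow> (nat \<times> nat) set" where
  "vertex_pairs n = {(i, j). 1 \<le> i \<and> i < j \<and> j \<le> n}"

text \<open>
  A graph on the vertex set \<open>{1..n}\<close> is represented by its set of edges, an edge being a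
  two-element set of vertices.
\<close>

definition graph_of :: "nat \<Rightarrow> (nat \<times> nat \<Rightarrow> bool) \<Rightarrow> nat set set" where
  "graph_of n f = {{i, j} | i j. (i, j) \<in> vertex_pairs n \<and> f (i, j)}"

definition graph_given_weights :: "graph_model \<Rightarrow> nat \<Rightarrow> (nat \<Rightarrow> real) \<Rightarrow> nat set set pmf" where
  "graph_given_weights model n w =
     map_pmf (graph_of n)
       (Pi_pmf (vertex_pairs n) False (\<lambda>(i, j). bernoulli_pmf (edge_prob model n w i j)))"

text \<open>
  The law of the random graph: sample i.i.d. weights with law \<open>\<mu>\<close> first, and then the edges
  independently given the weights.
\<close>

definition random_graph :: "graph_model \<Rightarrow> real measure \<Rightarrow> nat \<Rightarrow> nat set set measure" where
  "random_graph model \<mu> n =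
     (\<Pi>\<^sub>M i\<in>{1..n}. \<mu>) \<bind> (\<lambda>w. measure_pmf (graph_given_weights model n w))"

lemma finite_vertex_pairs: "finite (vertex_pairs n)"
  by (rule finite_subset[of _ "{1..n} \<times> {1..n}"]) (auto simp: vertex_pairs_def)

lemma graph_given_weights_measurable:
  assumes "sets \<mu> = sets borel"
  shows "(\<lambda>w. measure_pmf (graph_given_weights model n w))
    \<in> measurable (\<Pi>\<^sub>M i\<in>{1..n}. \<mu>) (subprob_algebra (count_space UNIV))"
proof (rule measurable_subprob_algebra)
  let ?N = "\<Pi>\<^sub>M i\<in>{1..n}. \<mu>"
  let ?V = "vertex_pairs n"
  have comp: "(\<lambda>w. w i) \<in> borel_measurable ?N" if "i \<in> {1..n}" for i
    using measurable_component_singleton[OF that, of "\<lambda>_. \<mu>"] measurable_cong_sets[OF refl assms]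
    by blast
  have p: "(\<lambda>w. edge_prob model n w i j) \<in> borel_measurable ?N"
    if "(i, j) \<in> ?V" for i j
  proof -
    have [measurable]: "(\<lambda>w. w i) \<in> borel_measurable ?N" "(\<lambda>w. w j) \<in> borel_measurable ?N"
      using that by (intro comp; simp add: vertex_pairs_def)+
    have [measurable]: "(\<lambda>w. \<Sum>k = 1..n. w k) \<in> borel_measurable ?N"
      by (intro borel_measurable_sum comp)
    have "(\<lambda>w. min 1 (w i * w j / (\<Sum>k = 1..n. w k))) \<in> borel_measurable ?N"
      and "(\<lambda>w. 1 - exp (- (w i * w j / (\<Sum>k = 1..n. w k)))) \<in> borel_measurable ?N"
      by measurable
    then show ?thesis
      by (cases model) (simp_all add: edge_prob_def Let_def)
  qed
  fix A :: "nat set set set"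
  define F where "F = PiE_dflt ?V False (\<lambda>_. UNIV :: bool set)"
  have finF: "finite F"
    unfolding F_def by (rule finite_PiE_dflt) (auto simp: finite_vertex_pairs)
  let ?q = "\<lambda>w (i, j). bernoulli_pmf (edge_prob model n w i j)"
  have eq: "emeasure (measure_pmf (graph_given_weights model n w)) A
    = (\<Sum>f\<in>F \<inter> graph_of n -` A. \<Prod>x\<in>?V. ennreal (pmf (?q w x) (f x)))" for w
  proof -
    have "set_pmf (Pi_pmf ?V False (?q w)) \<subseteq> F"
      using set_Pi_pmf_subset'[OF finite_vertex_pairs, of n False "?q w"]
      by (auto simp: F_def PiE_dflt_def)
    hence "emeasure (measure_pmf (graph_given_weights model n w)) A
      = emeasure (measure_pmf (Pi_pmf ?V False (?q w))) (F \<inter> graph_of n -` A)"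
      unfolding graph_given_weights_def
      by (auto simp: AE_measure_pmf_iff intro!: emeasure_eq_AE)
    also have "\<dots> = (\<Sum>f\<in>F \<inter> graph_of n -` A. ennreal (pmf (Pi_pmf ?V False (?q w)) f))"
      using finF by (simp add: emeasure_measure_pmf_finite)
    also have "\<dots> = (\<Sum>f\<in>F \<inter> graph_of n -` A. \<Prod>x\<in>?V. ennreal (pmf (?q w x) (f x)))"
      by (intro sum.cong refl)
         (auto simp: F_def PiE_dflt_def pmf_Pi finite_vertex_pairs prod_ennreal
           split: prod.splits intro!: prod.cong)
    finally show ?thesis .
  qed
  have bern: "pmf (bernoulli_pmf q) b = (if b then min 1 (max 0 q) else 1 - min 1 (max 0 q))" for q b
    by (simp add: bernoulli_pmf.rep_eq)
  show "(\<lambda>w. emeasure (measure_pmf (graph_given_weights model n w)) A) \<in> borel_measurable ?N"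
    unfolding eq
  proof (intro borel_measurable_sum borel_measurable_prod_ennreal)
    fix f x assume x: "x \<in> ?V"
    obtain i j where ij: "x = (i, j)" by (cases x)
    note [measurable] = p[OF x[unfolded ij]]
    have "(\<lambda>w. ennreal (min 1 (max 0 (edge_prob model n w i j)))) \<in> borel_measurable ?N"
      and "(\<lambda>w. ennreal (1 - min 1 (max 0 (edge_prob model n w i j)))) \<in> borel_measurable ?N"
      by measurable
    then show "(\<lambda>w. ennreal (pmf (?q w x) (f x))) \<in> borel_measurable ?N"
      by (cases "f x") (simp_all add: bern ij)
  qed
qed (auto simp: measure_pmf.subprob_space_axioms)

lemma random_graph_prob_space:
  assumes "prob_space \<mu>" "sets \<mu> = sets borel"
  shows "prob_space (random_graph model \<mu> n)"
proof -
  interpret prob_space "\<Pi>\<^sub>M i\<in>{1..n}. \<mu>"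
    by (intro prob_space_PiM assms)
  show ?thesis unfolding random_graph_def
    by (rule prob_space_bind[OF _ graph_given_weights_measurable[OF assms(2)]])
       (simp add: measure_pmf.prob_space_axioms)
qed

lemma sets_random_graph:
  assumes "prob_space \<mu>" "sets \<mu> = sets borel"
  shows "sets (random_graph model \<mu> n) = UNIV"
proof -
  interpret prob_space "\<Pi>\<^sub>M i\<in>{1..n}. \<mu>"
    by (intro prob_space_PiM assms)
  show ?thesis unfolding random_graph_def
    using not_empty by (subst sets_bind[of _ _ "count_space UNIV"]) simp_all
qed

section \<open>Cycles\<close>

definition cycle_edges :: "'v list \<Rightarrow> 'v set set" where
  "cycle_edges vs = {{vs ! i, vs ! (Suc i mod length vs)} | i. i < length vs}"

text \<open>
  A cycle has no isolated vertices, so as a subgraph it is determined by its set of edges,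
  and its length is the number of edges.
\<close>

definition cycles :: "'v set set \<Rightarrow> 'v set set set" where
  "cycles E = {cycle_edges vs | vs. distinct vs \<and> 3 \<le> length vs \<and> cycle_edges vs \<subseteq> E}"

definition cycle_count :: "'v set set \<Rightarrow> nat set \<Rightarrow> nat" where
  "cycle_count E A = card {C \<in> cycles E. card C \<in> A}"

text \<open>The same counts as a counting measure on \<open>{3..}\<close>.\<close>

definition cycle_process :: "'v set set \<Rightarrow> nat measure" where
  "cycle_process E = distr (count_space (cycles E)) (count_space {3..}) card"

definition shortest_cycle :: "'v set set \<Rightarrow> nat" where
  "shortest_cycle E = (if cycles E = {} then 0 else Min (card ` cycles E))"

definition longest_cycle :: "'v set set \<Rightarrow> nat" where
  "longest_cycle E = (if cycles E = {} then 0 else Max (card ` cycles E))"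

lemma card_cycle_edges:
  assumes "distinct vs" "3 \<le> length vs"
  shows "card (cycle_edges vs) = length vs"
proof -
  let ?k = "length vs"
  have "inj_on (\<lambda>i. {vs ! i, vs ! (Suc i mod ?k)}) {..<?k}"
  proof (rule inj_onI)
    fix i j assume i: "i \<in> {..<?k}" and j: "j \<in> {..<?k}"
      and eq: "{vs ! i, vs ! (Suc i mod ?k)} = {vs ! j, vs ! (Suc j mod ?k)}"
    have lt: "Suc i mod ?k < ?k" "Suc j mod ?k < ?k"
      using assms(2) by (auto intro!: mod_less_divisor)
    have "i = j \<or> (i = Suc j mod ?k \<and> j = Suc i mod ?k)"
      using eq i j lt nth_eq_iff_index_eq[OF assms(1)] by (auto simp: doubleton_eq_iff)
    then show "i = j"
      using assms(2) i j by (auto simp: mod_Suc split: if_splits)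
  qed
  moreover have "cycle_edges vs = (\<lambda>i. {vs ! i, vs ! (Suc i mod ?k)}) ` {..<?k}"
    by (auto simp: cycle_edges_def)
  ultimately show ?thesis by (simp add: card_image)
qed

lemma card_ge_3_cycles: "C \<in> cycles E \<Longrightarrow> 3 \<le> card C"
  by (auto simp: cycles_def card_cycle_edges)

lemma emeasure_cycle_process:
  assumes "finite E" "A \<subseteq> {3..}"
  shows "emeasure (cycle_process E) A = of_nat (cycle_count E A)"
proof -
  have "finite (cycles E)"
    by (rule finite_subset[of _ "Pow E"]) (auto simp: cycles_def assms)
  moreover have "card -` A \<inter> cycles E = {C \<in> cycles E. card C \<in> A}"
    by auto
  ultimately show ?thesis
    using assms(2) unfolding cycle_process_def cycle_count_def
    by (subst emeasure_distr) (auto simp: card_ge_3_cycles emeasure_count_space)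
qed

section \<open>Counting measures, the vague topology and Poisson processes\<close>

text \<open>Finite mass at every point is local finiteness, as \<open>{3..}\<close> is discrete.\<close>

definition counting_measures :: "nat measure set" where
  "counting_measures =
     {\<nu>. sets \<nu> = Pow {3..} \<and> (\<forall>k\<ge>3. \<exists>m::nat. emeasure \<nu> {k} = of_nat m)}"

text \<open>
  The coarsest topology that makes \<open>\<nu> \<mapsto> \<integral>f d\<nu>\<close> continuous for every continuous \<open>f\<close> with
  compact support; on \<open>{3..}\<close> these are the functions with finite support.
\<close>

definition vague_topology :: "nat measure topology" where
  "vague_topology = topology_generated_by
     {{\<nu> \<in> counting_measures. (\<integral>k. f k \<partial>\<nu>) \<in> U} | (f :: nat \<Rightarrow> real) U.
        finite {k. 3 \<le> k \<and> f k \<noteq> 0} \<and> open U}"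

definition converges_in_distribution ::
  "'s topology \<Rightarrow> (nat \<Rightarrow> 'a measure) \<Rightarrow> (nat \<Rightarrow> 'a \<Rightarrow> 's) \<Rightarrow> 'b measure \<Rightarrow> ('b \<Rightarrow> 's) \<Rightarrow> bool" where
  "converges_in_distribution T P X Q Y \<longleftrightarrow>
     (\<forall>F. continuous_map T euclideanreal F \<and> bounded (F ` topspace T) \<longrightarrow>
        (\<lambda>n. \<integral>\<omega>. F (X n \<omega>) \<partial>P n) \<longlonglongrightarrow> (\<integral>\<omega>. F (Y \<omega>) \<partial>Q))"

definition poisson_point_process :: "'b measure \<Rightarrow> ('b \<Rightarrow> nat measure) \<Rightarrow> nat measure \<Rightarrow> bool" where
  "poisson_point_process Q \<eta> \<Lambda> \<longleftrightarrow>
     prob_space Q \<and>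
     (\<forall>\<omega>\<in>space Q. \<eta> \<omega> \<in> counting_measures) \<and>
     (\<forall>A\<subseteq>{3..}. (\<lambda>\<omega>. emeasure (\<eta> \<omega>) A) \<in> borel_measurable Q) \<and>
     (\<forall>A\<subseteq>{3..}. emeasure \<Lambda> A < \<infinity> \<longrightarrow>
        (\<forall>j::nat. measure Q {\<omega> \<in> space Q. emeasure (\<eta> \<omega>) A = of_nat j}
           = exp (- measure \<Lambda> A) * measure \<Lambda> A ^ j / fact j)) \<and>
     (\<forall>A\<subseteq>{3..}. emeasure \<Lambda> A = \<infinity> \<longrightarrow> (AE \<omega> in Q. emeasure (\<eta> \<omega>) A = \<infinity>)) \<and>
     (\<forall>\<A>. finite \<A> \<and> \<A> \<subseteq> Pow {3..} \<and> disjoint \<A> \<longrightarrow>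
        prob_space.indep_vars Q (\<lambda>_. borel) (\<lambda>A \<omega>. emeasure (\<eta> \<omega>) A) \<A>)"

definition cycle_rate :: "'a measure \<Rightarrow> ('a \<Rightarrow> real) \<Rightarrow> nat \<Rightarrow> real" where
  "cycle_rate M W k = 1 / (2 * real k) * ((\<integral>x. W x ^ 2 \<partial>M) / (\<integral>x. W x \<partial>M)) ^ k"

definition cycle_intensity :: "'a measure \<Rightarrow> ('a \<Rightarrow> real) \<Rightarrow> nat measure" where
  "cycle_intensity M W = point_measure {3..} (\<lambda>k. ennreal (cycle_rate M W k))"

section \<open>The limit laws of the shortest and the longest cycle\<close>

definition has_shortest_law :: "'b measure \<Rightarrow> ('b \<Rightarrow> nat) \<Rightarrow> (nat \<Rightarrow> real) \<Rightarrow> bool" where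
  "has_shortest_law R S lam \<longleftrightarrow>
     prob_space R \<and> S \<in> measurable R (count_space UNIV) \<and>
     (\<forall>x\<in>space R. S x = 0 \<or> 3 \<le> S x) \<and>
     measure R {x \<in> space R. S x = 0} = exp (- (\<Sum>\<^sub>\<infinity>k\<in>{3..}. lam k)) \<and>
     (\<forall>t\<ge>3. measure R {x \<in> space R. 3 \<le> S x \<and> S x \<le> t} = 1 - exp (- (\<Sum>k = 3..t. lam k)))"

definition has_longest_law :: "'b measure \<Rightarrow> ('b \<Rightarrow> nat) \<Rightarrow> (nat \<Rightarrow> real) \<Rightarrow> bool" where
  "has_longest_law R L lam \<longleftrightarrow>
     prob_space R \<and> L \<in> measurable R (count_space UNIV) \<and>
     (\<forall>x\<in>space R. L x = 0 \<or> 3 \<le> L x) \<and>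
     measure R {x \<in> space R. L x = 0} = exp (- (\<Sum>\<^sub>\<infinity>k\<in>{3..}. lam k)) \<and>
     (\<forall>t\<ge>3. measure R {x \<in> space R. L x \<le> t} = exp (- (\<Sum>\<^sub>\<infinity>k\<in>{t + 1..}. lam k)))"

section \<open>Distances between distributions\<close>

text \<open>
  The values of a counting measure are extended nonnegative reals, and the supremum ranges over
  the sets of natural numbers embedded there.
\<close>

definition d_TV :: "'a measure \<Rightarrow> ('a \<Rightarrow> ennreal) \<Rightarrow> 'b measure \<Rightarrow> ('b \<Rightarrow> ennreal) \<Rightarrow> real" where
  "d_TV P X Q Y =
     (SUP B :: nat set. \<bar>measure P {x \<in> space P. X x \<in> of_nat ` B}
                        - measure Q {y \<in> space Q. Y y \<in> of_nat ` B}\<bar>)"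

definition d_Kol :: "'a measure \<Rightarrow> ('a \<Rightarrow> real) \<Rightarrow> 'b measure \<Rightarrow> ('b \<Rightarrow> real) \<Rightarrow> real" where
  "d_Kol P X Q Y =
     (SUP t :: real. \<bar>measure P {x \<in> space P. X x \<le> t} - measure Q {y \<in> space Q. Y y \<le> t}\<bar>)"

end

theory Submission
  imports Defs
begin

text \<open>
  Fix the weights, let \<open>L = \<Sum>i. w i\<close>, \<open>R = (\<Sum>i. w i ^ 2) / L\<close> and \<open>eps = (\<Sum>i. w i ^ 4) / L ^ 2\<close>.
  Conditioning on a cycle \<open>C\<close> amounts to adding its edges, and this creates cycles other than \<open>C\<close>
  only if the graph contains an excursion: a path between two distinct vertices of \<open>C\<close> with interior
  outside \<open>C\<close>. The expected number of pairs of a cycle and an excursion, and the deviation of the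
  mean number of cycles of length \<open>k\<close> from \<open>R ^ k / (2 * k)\<close>, are both at most a constant times
  \<open>eps\<close>, so Stein's equation gives a conditional Poisson approximation with error \<open>O(eps)\<close> whose
  only random parameter is \<open>R\<close>. Since bounded solutions of Stein's equation suffice, their
  differences are never needed.

  With finite fourth moments \<open>eps\<close> has mean \<open>O(1/n)\<close>. The fluctuation of \<open>R\<close> around
  \<open>r = E[W^2] / E[W]\<close> is only \<open>O(n^(-1/2))\<close>, but its linear part has mean zero and its square is
  \<open>O(1/n)\<close>. In the subcritical case all sums over cycle lengths are dominated by convergent
  geometric-type series, so no truncation of the length is necessary. With finite second moments
  a weak law of large numbers makes \<open>R - r\<close> and \<open>eps\<close> negligible. Long cycles are
  treated by a first moment bound on the event \<open>L \<ge> n * (E[W] + E[W^2]) / 2\<close>, whose complement is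
  exponentially unlikely because the weights are positive.
\<close>

section \<open>Stein's equation for the Poisson distribution\<close>

text \<open>Why \<open>eps\<close> controls every error: the weight of a cycle is the product of
  \<open>w x ^ 2 / L\<close> over its vertices, so the sum over all lists of length \<open>k\<close>
  is \<open>R ^ k\<close>. An excursion from \<open>u\<close> to \<open>v\<close> contributes
  \<open>w u * w v / L\<close> and a power of \<open>R\<close>; by Cauchy-Schwarz the sum over
  \<open>u\<close> and \<open>v\<close> costs one further factor \<open>w x ^ 2 / L\<close> at a
  vertex of the cycle, which turns a factor \<open>R\<close> into \<open>eps\<close>. A repeated
  vertex, or an edge probability below its weight, produces the same square. The joint law of
  several counts is obtained one length at a time. Stein's equation for one length is tested
  together with the indicator of prescribed counts of other lengths; an added cycle without
  excursion leaves this indicator unchanged, so it factors out in the limit. Bounded vaguely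
  continuous functions are then reached from below, through infima over cylinder sets, for the
  function and its negative.\<close>

definition poisson_mean :: "real \<Rightarrow> (nat \<Rightarrow> real) \<Rightarrow> real" where
  "poisson_mean l h = (\<Sum>j. exp (- l) * (l ^ j / fact j) * h j)"

lemma sums_exp_real: "(\<lambda>j. l ^ j / fact j) sums exp (l::real)"
  using exp_converges[of l] by (simp add: scaleR_conv_of_real divide_inverse mult.commute)

lemma summable_poisson_mean:
  fixes h :: "nat \<Rightarrow> real"
  assumes "0 \<le> l" "\<And>j. \<bar>h j\<bar> \<le> b"
  shows "summable (\<lambda>j. (l ^ j / fact j) * h j)"
proof (rule summable_comparison_test[where g = "\<lambda>j. b * (l ^ j / fact j)"])
  show "\<exists>N. \<forall>n\<ge>N. norm (l ^ n / fact n * h n) \<le> b * (l ^ n / fact n)"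
    using assms by (auto simp: abs_mult abs_divide mult.commute intro!: mult_right_mono divide_right_mono exI[of _ 0])
  show "summable (\<lambda>n. b * (l ^ n / fact n))"
    by (intro summable_mult sums_summable[OF sums_exp_real])
qed

lemma poisson_mean_eq:
  assumes "0 \<le> l" "\<And>j. \<bar>h j\<bar> \<le> b"
  shows "poisson_mean l h = exp (- l) * (\<Sum>j. (l ^ j / fact j) * h j)"
  unfolding poisson_mean_def using suminf_mult[OF summable_poisson_mean[OF assms], of "exp (-l)"]
  by (simp add: mult.assoc)

lemma poisson_mean_const: "poisson_mean l (\<lambda>_. c) = c"
proof -
  have "(\<lambda>j. exp (- l) * (l ^ j / fact j) * c) sums (exp (-l) * exp l * c)"
    by (intro sums_mult sums_mult2 sums_exp_real)
  thus ?thesis unfolding poisson_mean_def by (simp add: sums_iff exp_minus)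
qed

lemma poisson_mean_le:
  assumes "0 \<le> l" "\<And>j. \<bar>h j\<bar> \<le> b"
  shows "\<bar>poisson_mean l h\<bar> \<le> b"
proof -
  note s = summable_poisson_mean[OF assms(1)]
  have s1: "summable (\<lambda>j. exp (- l) * (l ^ j / fact j) * h j)"
    using summable_mult[OF s[OF assms(2)], of "exp (-l)"] by (simp add: mult.assoc)
  have s2: "summable (\<lambda>j. exp (- l) * (l ^ j / fact j) * c)" for c
    using summable_mult[OF s[of "\<lambda>_. c" "\<bar>c\<bar>"], of "exp (-l)"] by (simp add: mult.assoc)
  have hb: "h j \<le> b" "- b \<le> h j" for j using assms(2)[of j] by auto
  have "poisson_mean l h \<le> poisson_mean l (\<lambda>_. b)"
    unfolding poisson_mean_def using assms(1)
    by (intro suminf_le s1 s2) (auto intro!: mult_left_mono divide_right_mono hb)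
  moreover have "poisson_mean l (\<lambda>_. - b) \<le> poisson_mean l h"
    unfolding poisson_mean_def using assms(1)
    by (intro suminf_le s1 s2 mult_left_mono hb) auto
  ultimately show ?thesis unfolding poisson_mean_const by auto
qed

lemma frac_le_cross:
  fixes a b c x :: real
  assumes "a * b \<le> c" "0 < a" "0 < b" "0 \<le> x"
  shows "a * x / c \<le> x / b"
proof -
  have "0 < c" using assms(1-3) mult_pos_pos[of a b] by linarith
  thus ?thesis using mult_right_mono[OF assms(1,4)] assms(3) by (simp add: field_simps)
qed

text \<open>The recursion is solved from infinity: \<open>g (Suc i)\<close> is minus the tail series
  of the centred \<open>h\<close>, with coefficients
  \<open>fact i * l ^ m / fact (i + 1 + m)\<close>. No division by \<open>l\<close> occurs, so
  \<open>l = 0\<close> is allowed, and \<open>fact i * fact m \<le> fact (i + 1 + m)\<close> gives a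
  bound by the exponential series.\<close>

lemma stein_poisson_solution:
  fixes h :: "nat \<Rightarrow> real"
  assumes l: "0 \<le> l" and h: "\<And>j. \<bar>h j\<bar> \<le> 1"
  obtains g :: "nat \<Rightarrow> real" where "\<And>j. \<bar>g j\<bar> \<le> 2 * exp l"
    and "\<And>j. l * g (Suc j) - real j * g j = h j - poisson_mean l h"
proof -
  define e where "e j = h j - poisson_mean l h" for j
  have e2: "\<bar>e j\<bar> \<le> 2" for j
    using poisson_mean_le[OF l, of h 1, OF h] h[of j] unfolding e_def by linarith
  define a where "a j m = fact j * l ^ m / fact (j + 1 + m) * e (j + 1 + m)" for j m
  have ab: "\<bar>a j m\<bar> \<le> 2 * (l ^ m / fact m)" for j m
  proof -
    have "fact j * fact m \<le> (fact (j + 1 + m) :: real)"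
    proof -
      have "fact j * fact m dvd (fact (j + m) :: nat)" by (rule fact_fact_dvd_fact)
      hence "fact j * fact m \<le> (fact (j + m) :: nat)" by (rule dvd_imp_le) simp
      also have "\<dots> \<le> fact (j + 1 + m)" by (rule fact_mono) simp
      finally have "real (fact j * fact m) \<le> real (fact (j + 1 + m))" by (simp only: of_nat_le_iff)
      thus ?thesis by (simp only: of_nat_mult of_nat_fact)
    qed
    hence "fact j * l ^ m / fact (j + 1 + m) \<le> l ^ m / fact m"
      using l by (intro frac_le_cross) auto
    hence "(fact j * l ^ m / fact (j + 1 + m)) * \<bar>e (j + 1 + m)\<bar> \<le> (l ^ m / fact m) * 2"
      using l e2 by (intro mult_mono) auto
    thus ?thesis using l unfolding a_def by (simp add: abs_mult abs_divide mult.commute)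
  qed
  have se: "summable (\<lambda>m. 2 * (l ^ m / fact m))"
    by (intro summable_mult sums_summable[OF sums_exp_real])
  have sa: "summable (a j)" for j
    by (rule summable_comparison_test[OF _ se]) (use ab in auto)
  \<comment> \<open>The value at 0 is free, since the equation multiplies it by
    \<open>j = 0\<close>.\<close>
  define g where "g j = (case j of 0 \<Rightarrow> 0 | Suc i \<Rightarrow> - suminf (a i))" for j
  have gb: "\<bar>g j\<bar> \<le> 2 * exp l" for j
  proof (cases j)
    case (Suc i)
    have "\<bar>suminf (a i)\<bar> \<le> (\<Sum>m. \<bar>a i m\<bar>)"
      using ab by (intro summable_rabs summable_comparison_test[OF _ se]) auto
    also have "\<dots> \<le> (\<Sum>m. 2 * (l ^ m / fact m))"
      using ab by (intro suminf_le se summable_comparison_test[OF _ se]) auto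
    also have "\<dots> = 2 * exp l"
      using sums_mult[OF sums_exp_real, of 2 l] by (simp add: sums_iff)
    finally show ?thesis using Suc by (simp add: g_def)
  qed (simp add: g_def)
  have "l * g (Suc j) - real j * g j = e j" for j
  proof (cases j)
    case 0
    have s: "summable (\<lambda>j. l ^ j / fact j * e j)"
      using e2 by (rule summable_poisson_mean[OF l])
    have "(\<Sum>j. l ^ j / fact j * e j) =
        (\<Sum>j. l ^ j / fact j * h j) - (\<Sum>j. l ^ j / fact j * poisson_mean l h)"
      unfolding e_def right_diff_distrib
      by (intro suminf_diff[symmetric] summable_poisson_mean[OF l, of _ 1]
           summable_poisson_mean[OF l, of _ "\<bar>poisson_mean l h\<bar>"]) (use h in auto)
    also have "(\<Sum>j. l ^ j / fact j * poisson_mean l h) = exp l * poisson_mean l h"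
      using sums_mult2[OF sums_exp_real[of l]] by (simp add: sums_iff)
    also have "\<dots> = (\<Sum>j. l ^ j / fact j * h j)"
      unfolding poisson_mean_eq[OF l, of h 1, OF h] by (simp add: exp_minus)
    \<comment> \<open>Centring makes the Poisson mean of \<open>e\<close> vanish; this solvability
      condition is exactly the equation at \<open>j = 0\<close>.\<close>
    finally have z: "(\<Sum>j. l ^ j / fact j * e j) = 0" by simp
    have "l * suminf (a 0) = (\<Sum>m. l * a 0 m)" by (simp add: suminf_mult[OF sa])
    also have "\<dots> = (\<Sum>m. l ^ Suc m / fact (Suc m) * e (Suc m))"
      by (simp add: a_def algebra_simps)
    also have "\<dots> = - e 0"
      using suminf_split_head[OF s] z by simp
    finally show ?thesis using 0 by (simp add: g_def)
  next
    case (Suc i)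
    have "l * a (Suc i) m = real (Suc i) * a i (Suc m)" for m
      by (simp add: a_def field_simps)
    hence "l * suminf (a (Suc i)) = (\<Sum>m. real (Suc i) * a i (Suc m))"
      using suminf_mult[OF sa, of l "Suc i"] by simp
    also have "\<dots> = real (Suc i) * (\<Sum>m. a i (Suc m))"
      by (rule suminf_mult) (use sa[of i] in \<open>simp add: summable_Suc_iff\<close>)
    also have "\<dots> = real (Suc i) * (suminf (a i) - a i 0)"
      using suminf_split_head[OF sa[of i]] by simp
    also have "\<dots> = real (Suc i) * suminf (a i) - e (Suc i)"
      by (simp add: a_def right_diff_distrib del: of_nat_Suc)
    finally show ?thesis using Suc by (simp add: g_def algebra_simps)
  qed
  thus ?thesis using that[of g] gb by (simp add: e_def)
qed

text \<open>The mean is \<open>exp (- x)\<close> times an everywhere convergent power series in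
  \<open>x\<close>. Continuity carries the approximation from truncated sets of lengths to infinite
  ones.\<close>

lemma isCont_poisson_mean:
  fixes h :: "nat \<Rightarrow> real"
  assumes h: "\<And>j. \<bar>h j\<bar> \<le> 1" and a: "\<And>n. 0 \<le> a n" "a \<longlonglongrightarrow> l"
  shows "(\<lambda>n. poisson_mean (a n) h) \<longlonglongrightarrow> poisson_mean l h"
proof -
  have l: "0 \<le> l" using a by (intro LIMSEQ_le_const[OF a(2)]) auto
  define c where "c j = h j / fact j" for j
  have sc: "summable (\<lambda>j. c j * x ^ j)" for x
  proof (rule summable_comparison_test)
    show "\<exists>N. \<forall>n\<ge>N. norm (c n * x ^ n) \<le> \<bar>x\<bar> ^ n / fact n"
      using h by (auto simp: c_def abs_mult abs_divide power_abs intro!: divide_right_mono mult_left_le_one_le)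
    show "summable (\<lambda>n. \<bar>x\<bar> ^ n / fact n)" by (rule sums_summable[OF sums_exp_real])
  qed
  have "isCont (\<lambda>x. \<Sum>j. c j * x ^ j) l" by (rule isCont_powser_converges_everywhere[OF sc])
  hence "isCont (\<lambda>x. exp (-x) * (\<Sum>j. c j * x ^ j)) l" by (intro continuous_intros)
  from isCont_tendsto_compose[OF this a(2)]
  have "(\<lambda>n. exp (-(a n)) * (\<Sum>j. c j * (a n) ^ j)) \<longlonglongrightarrow> exp (-l) * (\<Sum>j. c j * l ^ j)" .
  moreover have "poisson_mean x h = exp (-x) * (\<Sum>j. c j * x ^ j)" if "0 \<le> x" for x
    unfolding poisson_mean_eq[OF that h] c_def by (simp add: mult.commute)
  ultimately show ?thesis using a(1) l by simp
qed

section \<open>Cycles and excursions\<close>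

fun path_edges :: "'v list \<Rightarrow> 'v set set" where
  "path_edges (x # y # zs) = insert {x, y} (path_edges (y # zs))"
| "path_edges _ = {}"

lemma path_edges_conv_nth: "path_edges xs = {{xs ! i, xs ! Suc i} | i. Suc i < length xs}"
proof (induction xs rule: path_edges.induct)
  case (1 x y zs)
  have "{{(x # y # zs) ! i, (x # y # zs) ! Suc i} | i. Suc i < length (x # y # zs)} =
     insert {x, y} {{(y # zs) ! i, (y # zs) ! Suc i} | i. Suc i < length (y # zs)}" (is "?A = ?B")
  proof
    show "?A \<subseteq> ?B"
    proof
      fix e assume "e \<in> ?A"
      then obtain i where i: "Suc i < length (x # y # zs)" "e = {(x # y # zs) ! i, (x # y # zs) ! Suc i}"
        by auto
      show "e \<in> ?B"
      proof (cases i)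
        case (Suc j) thus ?thesis using i by auto
      qed (use i in auto)
    qed
    have "{(y # zs) ! i, (y # zs) ! Suc i} \<in> ?A" if "Suc i < length (y # zs)" for i
      using that by (auto intro!: exI[of _ "Suc i"])
    moreover have "{x, y} \<in> ?A" by (auto intro!: exI[of _ 0])
    ultimately show "?B \<subseteq> ?A" by blast
  qed
  with 1 show ?case by simp
qed auto

lemma path_edges_append: "path_edges (xs @ v # ys) = path_edges (xs @ [v]) \<union> path_edges (v # ys)"
proof (induction xs)
  case (Cons x xs)
  thus ?case by (cases xs) auto
qed simp

lemma path_edges_snoc: "ys \<noteq> [] \<Longrightarrow> path_edges (ys @ [x]) = insert {last ys, x} (path_edges ys)"
  using path_edges_append[of "butlast ys" "last ys" "[x]"]
  by (metis append.assoc append_Cons append_Nil append_butlast_last_id insert_is_Un path_edges.simps(1)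
      path_edges.simps(3) sup_commute)

lemma path_edges_rev: "path_edges (rev xs) = path_edges xs"
proof (induction xs)
  case (Cons x xs)
  show ?case
  proof (cases xs)
    case (Cons y ys)
    have "path_edges (rev (x # xs)) = insert {last (rev xs), x} (path_edges (rev xs))"
      using Cons by (simp add: path_edges_snoc del: append_assoc)
    thus ?thesis using Cons.IH Cons by (simp add: insert_commute)
  qed simp
qed simp

lemma Union_path_edges: "2 \<le> length xs \<Longrightarrow> \<Union>(path_edges xs) = set xs"
proof (induction xs rule: path_edges.induct)
  case (1 x y zs)
  thus ?case by (cases zs) auto
qed auto

lemma cycle_edges_conv_path:
  assumes "xs \<noteq> []"
  shows "cycle_edges xs = insert {last xs, hd xs} (path_edges xs)"
proof -
  let ?k = "length xs"
  have k: "0 < ?k" using assms by simp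
  have *: "{xs ! i, xs ! (Suc i mod ?k)} = (if Suc i < ?k then {xs ! i, xs ! Suc i} else {last xs, hd xs})"
    if "i < ?k" for i
  proof (cases "Suc i < ?k")
    case False
    hence "Suc i = ?k" using that by simp
    hence "i = ?k - 1" by simp
    thus ?thesis using False assms by (simp add: last_conv_nth hd_conv_nth)
  qed simp
  have "cycle_edges xs = (\<lambda>i. {xs ! i, xs ! (Suc i mod ?k)}) ` {..<?k}"
    by (auto simp: cycle_edges_def)
  also have "\<dots> = (\<lambda>i. if Suc i < ?k then {xs ! i, xs ! Suc i} else {last xs, hd xs}) ` {..<?k}"
    using * by (intro image_cong) auto
  also have "\<dots> = insert {last xs, hd xs} {{xs ! i, xs ! Suc i} | i. Suc i < ?k}"
  proof -
    have "{last xs, hd xs} \<in> (\<lambda>i. if Suc i < ?k then {xs ! i, xs ! Suc i} else {last xs, hd xs}) ` {..<?k}"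
      using k by (intro image_eqI[of _ _ "?k - 1"]) auto
    thus ?thesis by (auto simp: image_iff split: if_splits)
  qed
  finally show ?thesis by (simp add: path_edges_conv_nth)
qed

lemma cycle_edges_rotate1: "cycle_edges (rotate1 xs) = cycle_edges xs"
proof (cases xs)
  case (Cons x ys)
  thus ?thesis
  proof (cases ys)
    case (Cons y zs)
    show ?thesis unfolding \<open>xs = x # ys\<close> Cons rotate1.simps
      by (subst cycle_edges_conv_path, simp, subst path_edges_snoc)
         (auto simp: cycle_edges_conv_path)
  qed simp
qed simp

lemma cycle_edges_rotate: "cycle_edges (rotate i xs) = cycle_edges xs"
  by (induction i) (simp_all add: cycle_edges_rotate1)

lemma cycle_edges_rev: "cycle_edges (rev xs) = cycle_edges xs"
  by (cases "xs = []")
     (simp_all add: cycle_edges_conv_path path_edges_rev last_rev hd_rev insert_commute)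

lemma Union_cycle_edges: "2 \<le> length xs \<Longrightarrow> \<Union>(cycle_edges xs) = set xs"
  using Union_path_edges[of xs] by (cases xs) (auto simp: cycle_edges_conv_path)

lemma cycle_edges_nth_in: "i < length vs \<Longrightarrow> {vs ! i, vs ! (Suc i mod length vs)} \<in> cycle_edges vs"
  by (auto simp: cycle_edges_def)

lemma cycle_edges_first_in: "3 \<le> length vs \<Longrightarrow> {vs ! 0, vs ! 1} \<in> cycle_edges vs"
  using cycle_edges_nth_in[of 0 vs] by (cases "vs = []") auto

lemma cycle_edges_neighbour:
  assumes "distinct vs" "i < length vs" "{vs ! i, y} \<in> cycle_edges vs"
  shows "y = vs ! (Suc i mod length vs) \<or> y = vs ! ((i + length vs - 1) mod length vs)"
proof -
  let ?k = "length vs"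
  obtain j where j: "j < ?k" "{vs ! i, y} = {vs ! j, vs ! (Suc j mod ?k)}"
    using assms(3) by (auto simp: cycle_edges_def)
  have lt: "Suc j mod ?k < ?k" using j by (intro mod_less_divisor) auto
  from j(2) consider "vs ! i = vs ! j" "y = vs ! (Suc j mod ?k)" | "vs ! i = vs ! (Suc j mod ?k)" "y = vs ! j"
    by (auto simp: doubleton_eq_iff)
  thus ?thesis
  proof cases
    case 1
    thus ?thesis using nth_eq_iff_index_eq[OF assms(1) assms(2) j(1)] by simp
  next
    case 2
    hence i: "i = Suc j mod ?k" using nth_eq_iff_index_eq[OF assms(1) assms(2) lt] by simp
    have "(i + ?k - 1) mod ?k = j"
    proof (cases "Suc j < ?k")
      case False
      hence "Suc j = ?k" using j(1) by simp
      thus ?thesis using i j(1) by simp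
    qed (use i in simp)
    thus ?thesis using 2 by simp
  qed
qed

text \<open>Walk along both lists: the next vertex of \<open>us\<close> is a neighbour of the
  current one on \<open>vs\<close> and differs from the previous one, so it is the next vertex of
  \<open>vs\<close>. Thus \<open>us\<close> is an initial segment of \<open>vs\<close>, and its
  closing edge forces equal length.\<close>

lemma cycle_determined:
  assumes vs: "distinct vs" "3 \<le> length vs" and us: "distinct us" "3 \<le> length us"
    and sub: "cycle_edges us \<subseteq> cycle_edges vs" and start: "us ! 0 = vs ! 0" "us ! 1 = vs ! 1"
  shows "us = vs"
proof -
  let ?k = "length vs" and ?m = "length us"
  have *: "j < ?k \<and> us ! j = vs ! j" if "j < ?m" for j
    using that
  proof (induction j rule: less_induct)
    case (less j)
    consider "j = 0" | "j = 1" | i where "j = Suc (Suc i)"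
      by (metis One_nat_def not0_implies_Suc)
    thus ?case
    proof cases
      case (3 i)
      have i: "i < ?k" "us ! i = vs ! i" "Suc i < ?k" "us ! Suc i = vs ! Suc i"
        using less.IH[of i] less.IH[of "Suc i"] less.prems 3 by auto
      have "{us ! Suc i, us ! j} \<in> cycle_edges us"
        using cycle_edges_nth_in[of "Suc i" us] less.prems 3 by simp
      hence "{vs ! Suc i, us ! j} \<in> cycle_edges vs" using sub i by auto
      from cycle_edges_neighbour[OF vs(1) i(3) this]
      have "us ! j = vs ! (j mod ?k) \<or> us ! j = vs ! i" using i 3 by simp
      moreover have "us ! j \<noteq> vs ! i"
        using nth_eq_iff_index_eq[OF us(1), of j i] less.prems 3 i by auto
      ultimately have uj: "us ! j = vs ! (j mod ?k)" by blast
      \<comment> \<open>At \<open>j = ?k\<close> the index wraps around and \<open>us\<close> would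
        visit its first vertex twice.\<close>
      have "j \<noteq> ?k"
      proof
        assume "j = ?k"
        hence "us ! j = us ! 0" using uj start by simp
        moreover have "us ! j \<noteq> us ! 0"
          using nth_eq_iff_index_eq[OF us(1), of j 0] less.prems 3 by (cases "us = []") auto
        ultimately show False by blast
      qed
      thus ?thesis using uj i 3 by auto
    qed (use start vs in auto)
  qed
  have mk: "?m \<le> ?k" using *[of "?m - 1"] us(2) by linarith
  have "{us ! (?m - 1), us ! (Suc (?m - 1) mod ?m)} \<in> cycle_edges us"
    using us(2) by (intro cycle_edges_nth_in) simp
  moreover have "Suc (?m - 1) = ?m" using us(2) by simp
  ultimately have "{us ! (?m - 1), us ! 0} \<in> cycle_edges us" by simp
  \<comment> \<open>The closing edge of \<open>us\<close> ends in one of the two neighbours of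
    \<open>vs ! 0\<close>; it is not \<open>vs ! 1\<close>, as \<open>us\<close> has at least three
    vertices.\<close>
  hence "{vs ! 0, vs ! (?m - 1)} \<in> cycle_edges vs"
    using sub *[of "?m - 1"] start us(2) by (auto simp: insert_commute)
  from cycle_edges_neighbour[OF vs(1) _ this] vs(2)
  have "vs ! (?m - 1) = vs ! 1 \<or> vs ! (?m - 1) = vs ! (?k - 1)"
    by (cases "vs = []") auto
  hence "?m - 1 = 1 \<or> ?m - 1 = ?k - 1"
    using nth_eq_iff_index_eq[OF vs(1), of "?m - 1" 1] nth_eq_iff_index_eq[OF vs(1), of "?m - 1" "?k - 1"]
      mk vs(2) us(2) by auto
  hence "?m = ?k" using us(2) vs(2) by linarith
  thus ?thesis using * by (intro nth_equalityI) auto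
qed

text \<open>A rotation brings any edge to the front in the orientation of \<open>vs\<close>; the
  other orientation needs a reversal as well.\<close>

lemma cycle_dart_representation:
  assumes "distinct vs" "3 \<le> length vs" "{u, v} \<in> cycle_edges vs"
  shows "\<exists>us. distinct us \<and> length us = length vs \<and> cycle_edges us = cycle_edges vs \<and>
           us ! 0 = u \<and> us ! 1 = v"
proof -
  let ?k = "length vs"
  obtain i where i: "i < ?k" "{u, v} = {vs ! i, vs ! (Suc i mod ?k)}"
    using assms(3) by (auto simp: cycle_edges_def)
  from i(2) consider "u = vs ! i" "v = vs ! (Suc i mod ?k)" | "u = vs ! (Suc i mod ?k)" "v = vs ! i"
    by (auto simp: doubleton_eq_iff)
  thus ?thesis
  proof cases
    case 1
    have "rotate i vs ! 0 = u" using nth_rotate[of 0 vs i] assms(2) i 1 by (cases "vs = []") auto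
    moreover have "rotate i vs ! 1 = v" using nth_rotate[of 1 vs i] assms(2) i 1 by simp
    ultimately show ?thesis using assms by (intro exI[of _ "rotate i vs"]) (simp add: cycle_edges_rotate)
  next
    case 2
    \<comment> \<open>After this rotation the last two entries are \<open>vs ! i\<close> and its
      successor, so the reversed list starts with \<open>u\<close> and \<open>v\<close>.\<close>
    define ws where "ws = rotate (Suc (Suc i)) vs"
    have lw: "length ws = ?k" by (simp add: ws_def)
    have "rev ws ! 0 = ws ! (?k - 1)" using lw assms(2) by (subst rev_nth) auto
    also have "\<dots> = vs ! ((Suc (Suc i) + (?k - 1)) mod ?k)"
      unfolding ws_def using assms(2) by (intro nth_rotate) simp
    also have "Suc (Suc i) + (?k - 1) = Suc i + ?k" using assms(2) by simp
    finally have 0: "rev ws ! 0 = u" using 2 by (simp only: mod_add_self2)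
    have "rev ws ! 1 = ws ! (?k - 2)" using lw assms(2) by (subst rev_nth) (auto simp: numeral_2_eq_2)
    also have "\<dots> = vs ! ((Suc (Suc i) + (?k - 2)) mod ?k)"
      unfolding ws_def using assms(2) by (intro nth_rotate) simp
    also have "Suc (Suc i) + (?k - 2) = i + ?k" using assms(2) by simp
    finally have 1: "rev ws ! 1 = v" using 2 i by simp
    show ?thesis using 0 1 assms(1) lw
      by (intro exI[of _ "rev ws"]) (simp add: cycle_edges_rev, simp add: ws_def cycle_edges_rotate del: rotate_Suc)
  qed
qed

text \<open>Start both lists with the same oriented edge; then \<open>cycle_determined\<close>
  applies.\<close>

lemma cycle_edges_subset_eq:
  assumes vs: "distinct vs" "3 \<le> length vs" and us: "distinct us" "3 \<le> length us"
    and sub: "cycle_edges us \<subseteq> cycle_edges vs"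
  shows "cycle_edges us = cycle_edges vs"
proof -
  have "{us ! 0, us ! 1} \<in> cycle_edges us" using us(2) by (rule cycle_edges_first_in)
  then obtain ws where ws: "distinct ws" "length ws = length vs" "cycle_edges ws = cycle_edges vs"
     "ws ! 0 = us ! 0" "ws ! 1 = us ! 1"
    using cycle_dart_representation[OF vs] sub by blast
  have "us = ws" by (rule cycle_determined) (use ws vs us sub in auto)
  thus ?thesis using ws by simp
qed

lemma cycle_edges_elem:
  assumes "distinct vs" "3 \<le> length vs" "e \<in> cycle_edges vs"
  obtains u v where "e = {u, v}" "u \<noteq> v"
proof -
  obtain i where i: "i < length vs" "e = {vs ! i, vs ! (Suc i mod length vs)}"
    using assms(3) by (auto simp: cycle_edges_def)
  have "Suc i mod length vs < length vs" using assms(2) by (intro mod_less_divisor) auto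
  moreover have "i \<noteq> Suc i mod length vs" using assms(2) i(1) by (auto simp: mod_Suc)
  ultimately have "vs ! i \<noteq> vs ! (Suc i mod length vs)"
    using nth_eq_iff_index_eq[OF assms(1) i(1)] by blast
  thus ?thesis using that i by blast
qed

text \<open>A representing list is determined by its first two vertices, which form an arbitrary
  oriented edge of the cycle.\<close>

lemma card_cycle_representations:
  assumes vs: "distinct vs" "3 \<le> length vs"
  shows "card {us. distinct us \<and> 3 \<le> length us \<and> cycle_edges us = cycle_edges vs} = 2 * length vs"
proof -
  let ?C = "cycle_edges vs"
  let ?D = "{(u, v). {u, v} \<in> ?C}"
  have "bij_betw (\<lambda>us. (us ! 0, us ! 1)) {us. distinct us \<and> 3 \<le> length us \<and> cycle_edges us = ?C} ?D"
    unfolding bij_betw_def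
  proof
    show "inj_on (\<lambda>us. (us ! 0, us ! 1)) {us. distinct us \<and> 3 \<le> length us \<and> cycle_edges us = ?C}"
      by (rule inj_onI) (auto intro!: cycle_determined)
    show "(\<lambda>us. (us ! 0, us ! 1)) ` {us. distinct us \<and> 3 \<le> length us \<and> cycle_edges us = ?C} = ?D"
    proof
      show "(\<lambda>us. (us ! 0, us ! 1)) ` {us. distinct us \<and> 3 \<le> length us \<and> cycle_edges us = ?C} \<subseteq> ?D"
      proof safe
        fix us :: "'a list" assume "3 \<le> length us" "cycle_edges us = ?C"
        thus "{us ! 0, us ! 1} \<in> ?C" using cycle_edges_first_in[of us] by simp
      qed
      show "?D \<subseteq> (\<lambda>us. (us ! 0, us ! 1)) ` {us. distinct us \<and> 3 \<le> length us \<and> cycle_edges us = ?C}"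
        using cycle_dart_representation[OF vs] vs(2) by (force simp: image_iff)
    qed
  qed
  hence "card {us. distinct us \<and> 3 \<le> length us \<and> cycle_edges us = ?C} = card ?D"
    by (rule bij_betw_same_card)
  also have "?D = (\<Union>e\<in>?C. {(u, v). {u, v} = e})" by auto
  also have "card \<dots> = (\<Sum>e\<in>?C. card {(u, v). {u, v} = e})"
  proof (rule card_UN_disjoint)
    show "finite ?C" unfolding cycle_edges_def by simp
    show "\<forall>e\<in>?C. finite {(u, v). {u, v} = e}"
    proof
      fix e assume "e \<in> ?C"
      then obtain u v where "e = {u, v}" by (rule cycle_edges_elem[OF vs])
      hence "{(u, v). {u, v} = e} \<subseteq> {u, v} \<times> {u, v}" by (auto simp: doubleton_eq_iff)
      thus "finite {(u, v). {u, v} = e}" by (rule finite_subset) simp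
    qed
  qed auto
  also have "\<dots> = (\<Sum>e\<in>?C. 2)"
  proof (rule sum.cong)
    fix e assume "e \<in> ?C"
    then obtain u v where "e = {u, v}" "u \<noteq> v" by (rule cycle_edges_elem[OF vs])
    hence "{(u, v). {u, v} = e} = {(u, v), (v, u)}" by (auto simp: doubleton_eq_iff)
    thus "card {(u, v). {u, v} = e} = 2" using \<open>u \<noteq> v\<close> by simp
  qed simp
  also have "\<dots> = 2 * length vs" using card_cycle_edges[OF vs] by simp
  finally show ?thesis .
qed

text \<open>For \<open>N > 0\<close> the interior \<open>ps\<close> may be empty, so chords and also
  edges of \<open>C\<close> lying in \<open>G\<close> count as excursions. Without excursions,
  \<open>G\<close> therefore contains no edge of the cycle \<open>C\<close>. The bound
  \<open>N\<close> on the length keeps the later union bound finite.\<close>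

definition has_excursion :: "nat \<Rightarrow> 'v set set \<Rightarrow> 'v set set \<Rightarrow> bool" where
  "has_excursion N C G \<longleftrightarrow>
     (\<exists>u ps v. u \<in> \<Union>C \<and> v \<in> \<Union>C \<and> u \<noteq> v \<and> distinct ps \<and> length ps < N \<and> set ps \<inter> \<Union>C = {} \<and>
        path_edges (u # ps @ [v]) \<subseteq> G)"

text \<open>Cut the path at its first return to \<open>C\<close>. If the first piece lies in
  \<open>C\<close>, the rest is shorter and still has an edge outside \<open>C\<close>; otherwise
  the first piece is the excursion.\<close>

lemma path_leaving_cycle:
  assumes "distinct ys" "2 \<le> length ys" "hd ys \<in> \<Union>C" "last ys \<in> \<Union>C" "path_edges ys \<subseteq> G \<union> C"
    "\<not> path_edges ys \<subseteq> C" "length ys \<le> N"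
  shows "has_excursion N C G"
  using assms
proof (induction "length ys" arbitrary: ys rule: less_induct)
  case less
  obtain u zs where ys: "ys = u # zs" using less.prems(2) by (cases ys) auto
  have zs: "zs \<noteq> []" using less.prems(2) ys by auto
  have "last zs \<in> set zs" "last zs \<in> \<Union>C" using zs less.prems(4) ys by auto
  hence "\<exists>x\<in>set zs. x \<in> \<Union>C" by blast
  then obtain ps v bs where split: "zs = ps @ v # bs" "v \<in> \<Union>C" "\<forall>x\<in>set ps. x \<notin> \<Union>C"
    by (rule split_list_first_propE)
  have pe: "path_edges ys = path_edges (u # ps @ [v]) \<union> path_edges (v # bs)"
    using path_edges_append[of "u # ps" v bs] ys split by simp
  show ?case
  proof (cases "path_edges (u # ps @ [v]) \<subseteq> C")
    case True
    hence nb: "\<not> path_edges (v # bs) \<subseteq> C" using less.prems(6) pe by auto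
    hence "bs \<noteq> []" by auto
    show ?thesis
    proof (rule less.hyps[of "v # bs"])
      show "length (v # bs) < length ys" using ys split by simp
      show "2 \<le> length (v # bs)" using \<open>bs \<noteq> []\<close> by (cases bs) auto
      show "last (v # bs) \<in> \<Union>C" using less.prems(4) ys split by auto
      show "path_edges (v # bs) \<subseteq> G \<union> C" using less.prems(5) pe by auto
    qed (use less.prems ys split nb in auto)
  next
    case False
    \<comment> \<open>A piece with empty interior is a single edge outside \<open>C\<close>; in any
      other piece every edge has an interior vertex, which lies off \<open>C\<close>.\<close>
    have "path_edges (u # ps @ [v]) \<subseteq> G"
    proof (cases ps)
      case Nil
      thus ?thesis using False less.prems(5) pe by auto
    next
      case (Cons a as)
      have "e \<notin> C" if e: "e \<in> path_edges (u # ps @ [v])" for e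
      proof -
        let ?p = "u # ps @ [v]"
        obtain i where i: "Suc i < length ?p" "e = {?p ! i, ?p ! Suc i}"
          using e unfolding path_edges_conv_nth[of ?p] by blast
        have "?p ! i \<in> set ps \<or> ?p ! Suc i \<in> set ps"
        proof (cases i)
          case 0
          thus ?thesis using Cons by simp
        next
          case (Suc j)
          hence "j < length ps" using i by simp
          thus ?thesis using Suc by (simp add: nth_append)
        qed
        thus ?thesis using i split(3) by blast
      qed
      thus ?thesis using less.prems(5) pe by auto
    qed
    moreover have "u \<in> \<Union>C" using less.prems(3) ys by simp
    moreover have "u \<noteq> v" "distinct ps" "length ps < N"
      using less.prems(1,7) ys split by auto
    ultimately show ?thesis unfolding has_excursion_def using split(2,3) by blast
  qed
qed

text \<open>A new cycle other than \<open>C\<close> uses an edge of \<open>C\<close> but is not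
  contained in \<open>C\<close>. Opened at that edge it is a path between two vertices of
  \<open>C\<close>, in which \<open>path_leaving_cycle\<close> finds an excursion.\<close>

lemma cycles_Un_cycle:
  assumes C: "C \<in> cycles E" "card C \<le> N" and no: "\<not> has_excursion N C G"
  shows "{C' \<in> cycles (G \<union> C). card C' \<le> N} = insert C {C' \<in> cycles G. card C' \<le> N}"
    and "C \<notin> cycles G"
proof -
  obtain vs where vs: "distinct vs" "3 \<le> length vs" "C = cycle_edges vs"
    using C by (auto simp: cycles_def)
  have N: "0 < N" using C vs card_cycle_edges[OF vs(1,2)] by simp
  have "\<not> C \<subseteq> G"
  proof
    assume "C \<subseteq> G"
    have "{vs ! 0, vs ! 1} \<in> C" using cycle_edges_first_in vs by simp
    moreover have "vs ! 0 \<noteq> vs ! 1" using nth_eq_iff_index_eq[OF vs(1), of 0 1] vs(2) by (cases "vs = []") auto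
    ultimately have "has_excursion N C G" unfolding has_excursion_def using \<open>C \<subseteq> G\<close> N
      by (intro exI[of _ "vs ! 0"] exI[of _ "[]"] exI[of _ "vs ! 1"]) auto
    thus False using no by blast
  qed
  thus "C \<notin> cycles G" by (auto simp: cycles_def)
  have "C' \<in> cycles G" if C': "C' \<in> cycles (G \<union> C)" "card C' \<le> N" "C' \<noteq> C" for C'
  proof (rule ccontr)
    assume nG: "C' \<notin> cycles G"
    obtain us where us: "distinct us" "3 \<le> length us" "C' = cycle_edges us" "C' \<subseteq> G \<union> C"
      using C' by (auto simp: cycles_def)
    have nsub: "\<not> C' \<subseteq> C" using cycle_edges_subset_eq[OF vs(1,2) us(1,2)] us vs C' by auto
    have "\<not> C' \<subseteq> G" using nG us by (auto simp: cycles_def)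
    then obtain e where e: "e \<in> C'" "e \<in> C" using us by blast
    then obtain u v where uv: "e = {u, v}" using cycle_edges_elem[OF us(1,2)] us(3) by metis
    have "{u, v} \<in> cycle_edges us" using e uv us by simp
    then obtain ws where ws: "distinct ws" "length ws = length us" "cycle_edges ws = C'"
      "ws ! 0 = u" "ws ! 1 = v"
      using cycle_dart_representation[OF us(1,2)] us(3) by blast
    \<comment> \<open>Rotating by one turns the list starting with \<open>u\<close> and
      \<open>v\<close> into a path from \<open>v\<close> to \<open>u\<close>: the cycle opened at
      the edge \<open>e\<close>.\<close>
    define ys where "ys = rotate1 ws"
    obtain xs where xs: "ws = u # v # xs"
      using ws us(2) by (cases ws; cases "tl ws") auto
    have ys: "ys = v # xs @ [u]" using xs by (simp add: ys_def)
    have cy: "C' = cycle_edges ys" using ws by (simp add: ys_def cycle_edges_rotate1)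
    hence cy': "C' = insert e (path_edges ys)" using uv ys by (simp add: cycle_edges_conv_path)
    have "has_excursion N C G"
    proof (rule path_leaving_cycle[of ys])
      show "distinct ys" using ws by (simp add: ys_def)
      show "2 \<le> length ys" "hd ys \<in> \<Union>C" "last ys \<in> \<Union>C" using ys e uv by auto
      show "path_edges ys \<subseteq> G \<union> C" using us cy' by auto
      show "\<not> path_edges ys \<subseteq> C" using nsub cy' e by auto
      show "length ys \<le> N" using C'(2) us card_cycle_edges[OF us(1,2)] ws by (simp add: ys_def)
    qed
    thus False using no by blast
  qed
  moreover have "C \<in> cycles (G \<union> C)" using vs by (auto simp: cycles_def)
  moreover have "cycles G \<subseteq> cycles (G \<union> C)" by (auto simp: cycles_def)
  ultimately show "{C' \<in> cycles (G \<union> C). card C' \<le> N} = insert C {C' \<in> cycles G. card C' \<le> N}"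
    using C(2) by auto
qed

lemma finite_cycles: "finite E \<Longrightarrow> finite (cycles E)"
  by (rule finite_subset[of _ "Pow E"]) (auto simp: cycles_def)

lemma cycle_count_Un_cycle:
  assumes "C \<in> cycles E" "card C \<le> N" "\<not> has_excursion N C G" "finite G" "A \<subseteq> {..N}"
  shows "cycle_count (G \<union> C) A = cycle_count G A + of_bool (card C \<in> A)"
proof -
  have fin: "finite {C' \<in> cycles G. card C' \<in> A}" using finite_cycles[OF assms(4)] by simp
  have eq: "{C' \<in> cycles H. card C' \<in> A} = {C' \<in> {C' \<in> cycles H. card C' \<le> N}. card C' \<in> A}" for H :: "'a set set"
    using assms(5) by auto
  have "{C' \<in> cycles (G \<union> C). card C' \<in> A} = {C' \<in> insert C {C' \<in> cycles G. card C' \<le> N}. card C' \<in> A}"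
    unfolding eq cycles_Un_cycle(1)[OF assms(1-3)] ..
  also have "\<dots> = (if card C \<in> A then insert C {C' \<in> cycles G. card C' \<in> A} else {C' \<in> cycles G. card C' \<in> A})"
    using assms(5) by auto
  finally show ?thesis unfolding cycle_count_def using cycles_Un_cycle(2)[OF assms(1-3)] fin by simp
qed

section \<open>Sums over cycles\<close>

lemma sum_lists_Suc:
  fixes f :: "'v list \<Rightarrow> real"
  assumes "finite V"
  shows "(\<Sum>xs\<in>{xs. set xs \<subseteq> V \<and> length xs = Suc k}. f xs) =
         (\<Sum>x\<in>V. \<Sum>xs\<in>{xs. set xs \<subseteq> V \<and> length xs = k}. f (x # xs))"
proof -
  have "(\<Sum>xs\<in>{xs. set xs \<subseteq> V \<and> length xs = Suc k}. f xs) =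
      (\<Sum>p\<in>{xs. set xs \<subseteq> V \<and> length xs = k} \<times> V. f (snd p # fst p))"
    unfolding lists_length_Suc_eq
    by (subst sum.reindex) (auto simp: inj_on_def case_prod_unfold)
  also have "\<dots> = (\<Sum>xs\<in>{xs. set xs \<subseteq> V \<and> length xs = k}. \<Sum>x\<in>V. f (x # xs))"
    by (simp add: sum.cartesian_product case_prod_unfold)
  also have "\<dots> = (\<Sum>x\<in>V. \<Sum>xs\<in>{xs. set xs \<subseteq> V \<and> length xs = k}. f (x # xs))"
    by (rule sum.swap)
  finally show ?thesis .
qed

lemma sum_lists_0: "(\<Sum>xs\<in>{xs. set xs \<subseteq> V \<and> length xs = 0}. f xs) = f []"
proof -
  have "{xs. set xs \<subseteq> V \<and> length xs = 0} = {[]}" by auto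
  thus ?thesis by simp
qed

lemma sum_lists_prod:
  fixes g :: "'v \<Rightarrow> real"
  assumes "finite V"
  shows "(\<Sum>xs\<in>{xs. set xs \<subseteq> V \<and> length xs = k}. prod_list (map g xs)) = (\<Sum>x\<in>V. g x) ^ k"
proof (induction k)
  case 0
  show ?case unfolding sum_lists_0 by simp
next
  case (Suc k)
  show ?case unfolding sum_lists_Suc[OF assms]
    by (simp add: sum_distrib_left[symmetric] Suc sum_distrib_right[symmetric])
qed

text \<open>The inner sum marks one of the \<open>k\<close> positions and squares its factor. With
  \<open>g x = w x ^ 2 / L\<close> this square is the source of \<open>eps\<close>.\<close>

lemma sum_lists_prod_sum:
  fixes g :: "'v \<Rightarrow> real"
  assumes "finite V"
  shows "(\<Sum>xs\<in>{xs. set xs \<subseteq> V \<and> length xs = k}. prod_list (map g xs) * sum_list (map g xs)) =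
     real k * (\<Sum>x\<in>V. g x ^ 2) * (\<Sum>x\<in>V. g x) ^ (k - 1)"
proof (induction k)
  case 0
  show ?case unfolding sum_lists_0 by simp
next
  case (Suc k)
  let ?L = "{xs. set xs \<subseteq> V \<and> length xs = k}"
  have "(\<Sum>xs\<in>{xs. set xs \<subseteq> V \<and> length xs = Suc k}. prod_list (map g xs) * sum_list (map g xs)) =
     (\<Sum>x\<in>V. g x ^ 2 * (\<Sum>xs\<in>?L. prod_list (map g xs)) + g x * (\<Sum>xs\<in>?L. prod_list (map g xs) * sum_list (map g xs)))"
    unfolding sum_lists_Suc[OF assms] sum_distrib_left sum.distrib[symmetric]
    by (intro sum.cong refl) (simp add: algebra_simps power2_eq_square)
  also have "\<dots> = (\<Sum>x\<in>V. g x ^ 2) * (\<Sum>x\<in>V. g x) ^ k +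
      (\<Sum>x\<in>V. g x) * (real k * (\<Sum>x\<in>V. g x ^ 2) * (\<Sum>x\<in>V. g x) ^ (k - 1))"
    unfolding Suc sum_lists_prod[OF assms] by (simp add: sum.distrib sum_distrib_right)
  also have "\<dots> = real (Suc k) * (\<Sum>x\<in>V. g x ^ 2) * (\<Sum>x\<in>V. g x) ^ (Suc k - 1)"
    by (cases k) (auto simp: algebra_simps)
  finally show ?case .
qed

lemma prod_list_nonneg_map: "(\<And>x. 0 \<le> g x) \<Longrightarrow> 0 \<le> prod_list (map (g :: 'v \<Rightarrow> real) xs)"
  by (induction xs) auto

text \<open>Split off the head: either it occurs again in the tail, which marks a position as in
  \<open>sum_lists_prod_sum\<close>, or the tail already has a repetition. For \<open>k < 2\<close>
  the truncated exponent meets a vanishing prefactor.\<close>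

lemma sum_lists_not_distinct:
  fixes g :: "'v \<Rightarrow> real"
  assumes V: "finite V" and g: "\<And>x. 0 \<le> g x"
  shows "(\<Sum>xs\<in>{xs. set xs \<subseteq> V \<and> length xs = k}. if distinct xs then 0 else prod_list (map g xs)) \<le>
     real k * (real k - 1) * (\<Sum>x\<in>V. g x ^ 2) * (\<Sum>x\<in>V. g x) ^ (k - 2)"
proof (induction k)
  case 0
  show ?case unfolding sum_lists_0 by simp
next
  case (Suc k)
  let ?L = "{xs. set xs \<subseteq> V \<and> length xs = k}"
  let ?P = "\<lambda>xs. prod_list (map g xs)"
  let ?q = "\<Sum>x\<in>V. g x ^ 2" and ?S = "\<Sum>x\<in>V. g x"
  have q: "0 \<le> ?q" "0 \<le> ?S" using g by (auto intro!: sum_nonneg)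
  have P0: "0 \<le> ?P xs" for xs using g by (rule prod_list_nonneg_map)
  have "(\<Sum>xs\<in>{xs. set xs \<subseteq> V \<and> length xs = Suc k}. if distinct xs then 0 else ?P xs) \<le>
     (\<Sum>x\<in>V. \<Sum>xs\<in>?L. (if x \<in> set xs then g x * ?P xs else 0) + g x * (if distinct xs then 0 else ?P xs))"
    unfolding sum_lists_Suc[OF V] using g P0 by (intro sum_mono) auto
  also have "\<dots> = (\<Sum>xs\<in>?L. \<Sum>x\<in>V. if x \<in> set xs then g x * ?P xs else 0) +
      (\<Sum>x\<in>V. g x * (\<Sum>xs\<in>?L. if distinct xs then 0 else ?P xs))"
    unfolding sum.distrib sum_distrib_left by (subst sum.swap) simp
  also have "(\<Sum>xs\<in>?L. \<Sum>x\<in>V. if x \<in> set xs then g x * ?P xs else 0) \<le> (\<Sum>xs\<in>?L. ?P xs * sum_list (map g xs))"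
  proof (rule sum_mono)
    fix xs assume "xs \<in> ?L"
    hence "(\<Sum>x\<in>V. if x \<in> set xs then g x * ?P xs else 0) = (\<Sum>x\<in>set xs. g x * ?P xs)"
      using V by (subst sum.inter_restrict[symmetric]) (auto simp: Int_absorb1)
    also have "\<dots> = ?P xs * (\<Sum>x\<in>set xs. g x)"
      by (simp add: sum_distrib_right[symmetric] mult.commute)
    also have "(\<Sum>x\<in>set xs. g x) \<le> sum_list (map g xs)"
    proof (induction xs)
      case (Cons a xs)
      thus ?case using g[of a] by (auto simp: sum.insert_if)
    qed simp
    finally show "(\<Sum>x\<in>V. if x \<in> set xs then g x * ?P xs else 0) \<le> ?P xs * sum_list (map g xs)"
      using P0[of xs] by (simp add: mult_left_mono)
  qed
  also have "(\<Sum>xs\<in>?L. ?P xs * sum_list (map g xs)) = real k * ?q * ?S ^ (k - 1)"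
    by (rule sum_lists_prod_sum[OF V])
  also have "(\<Sum>x\<in>V. g x * (\<Sum>xs\<in>?L. if distinct xs then 0 else ?P xs)) \<le>
      ?S * (real k * (real k - 1) * ?q * ?S ^ (k - 2))"
    unfolding sum_distrib_right[symmetric] using q Suc by (intro mult_left_mono) auto
  also have "real k * ?q * ?S ^ (k - 1) + ?S * (real k * (real k - 1) * ?q * ?S ^ (k - 2)) =
      (real k * real k) * (?q * ?S ^ (k - 1))"
  proof -
    consider "k = 0" | "k = 1" | m where "k = Suc (Suc m)" by (metis One_nat_def not0_implies_Suc)
    thus ?thesis by cases (auto simp: algebra_simps)
  qed
  also have "\<dots> \<le> (real (Suc k) * (real (Suc k) - 1)) * (?q * ?S ^ (k - 1))"
    using q by (intro mult_right_mono) (auto simp: algebra_simps)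
  finally show ?case by (simp add: mult.assoc)
qed

text \<open>The edge probability before truncation; the product over the two-element set avoids
  choosing an order of the end points.\<close>

definition edge_weight :: "('v \<Rightarrow> real) \<Rightarrow> real \<Rightarrow> 'v set \<Rightarrow> real" where
  "edge_weight w L e = (\<Prod>v\<in>e. w v) / L"

lemma edge_weight_doubleton: "u \<noteq> v \<Longrightarrow> edge_weight w L {u, v} = w u * w v / L"
  by (simp add: edge_weight_def)

lemma finite_path_edges: "finite (path_edges xs)"
  by (induction xs rule: path_edges.induct) auto

lemma path_edges_subset_set: "e \<in> path_edges xs \<Longrightarrow> e \<subseteq> set xs"
  by (induction xs rule: path_edges.induct) auto

lemma prod_edge_weight_path:
  assumes "distinct (u # ps @ [v])"
  shows "(\<Prod>e\<in>path_edges (u # ps @ [v]). edge_weight w L e) =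
     w u * w v / L * prod_list (map (\<lambda>x. w x ^ 2 / L) ps)"
  using assms
proof (induction ps arbitrary: u)
  case Nil
  thus ?case by (simp add: edge_weight_doubleton)
next
  case (Cons p ps)
  have "{u, p} \<notin> path_edges (p # ps @ [v])"
    using path_edges_subset_set[of "{u, p}" "p # ps @ [v]"] Cons.prems by auto
  hence "(\<Prod>e\<in>path_edges (u # (p # ps) @ [v]). edge_weight w L e) =
      edge_weight w L {u, p} * (\<Prod>e\<in>path_edges (p # ps @ [v]). edge_weight w L e)"
    by (simp add: finite_path_edges)
  also have "\<dots> = (w u * w p / L) * (w p * w v / L * prod_list (map (\<lambda>x. w x ^ 2 / L) ps))"
    using Cons by (simp add: edge_weight_doubleton)
  finally show ?case by (simp add: power2_eq_square)
qed

text \<open>Each edge weight is split between its end points by the inequality of arithmetic and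
  geometric means. Interior vertices lie on two edges and collect two halves, the end points only
  one.\<close>

lemma sum_edge_weight_path:
  fixes w :: "'v \<Rightarrow> real"
  assumes "distinct (u # ps @ [v])" and L: "0 < L"
  shows "(\<Sum>e\<in>path_edges (u # ps @ [v]). edge_weight w L e) \<le>
     w u ^ 2 / L / 2 + w v ^ 2 / L / 2 + sum_list (map (\<lambda>x. w x ^ 2 / L) ps)"
  using assms(1)
proof (induction ps arbitrary: u)
  have am: "a * b / L \<le> a ^ 2 / L / 2 + b ^ 2 / L / 2" for a b :: real
  proof -
    have "a * b \<le> a ^ 2 / 2 + b ^ 2 / 2"
      using sum_squares_bound[of a b] by simp
    thus ?thesis using L divide_right_mono[of "a*b" "a ^ 2 / 2 + b ^ 2 / 2" L]
      by (simp add: add_divide_distrib mult.commute)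
  qed
  {
    case Nil
    thus ?case using am[of "w u" "w v"] by (simp add: edge_weight_doubleton)
  next
    case (Cons p ps)
    have "{u, p} \<notin> path_edges (p # ps @ [v])"
      using path_edges_subset_set[of "{u, p}" "p # ps @ [v]"] Cons.prems by auto
    hence "(\<Sum>e\<in>path_edges (u # (p # ps) @ [v]). edge_weight w L e) =
        edge_weight w L {u, p} + (\<Sum>e\<in>path_edges (p # ps @ [v]). edge_weight w L e)"
      by (simp add: finite_path_edges)
    also have "\<dots> \<le> (w u ^ 2 / L / 2 + w p ^ 2 / L / 2) +
       (w p ^ 2 / L / 2 + w v ^ 2 / L / 2 + sum_list (map (\<lambda>x. w x ^ 2 / L) ps))"
      using Cons am[of "w u" "w p"] by (intro add_mono) (simp_all add: edge_weight_doubleton)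
    finally show ?case by simp
  }
qed

lemma long_list_split:
  assumes "3 \<le> length us" obtains u p ps v where "us = u # (p # ps) @ [v]"
proof -
  obtain u p vs where "us = u # p # vs" "vs \<noteq> []"
    using assms by (cases us; cases "tl us"; cases "tl (tl us)") auto
  thus ?thesis using that[of u p "butlast vs" "last vs"] by simp
qed

lemma cycle_closing_edge:
  assumes "distinct (u # (p # ps) @ [v])"
  shows "{v, u} \<notin> path_edges (u # (p # ps) @ [v])"
  using assms path_edges_subset_set[of "{v, u}" "p # ps @ [v]"] by (auto simp: doubleton_eq_iff)

lemma prod_edge_weight_cycle:
  assumes "distinct us" "3 \<le> length us"
  shows "(\<Prod>e\<in>cycle_edges us. edge_weight w L e) = prod_list (map (\<lambda>x. w x ^ 2 / L) us)"
proof -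
  obtain u p ps v where us: "us = u # (p # ps) @ [v]" using assms(2) by (rule long_list_split)
  have d: "distinct (u # (p # ps) @ [v])" using assms us by simp
  have "(\<Prod>e\<in>cycle_edges us. edge_weight w L e) =
      edge_weight w L {v, u} * (\<Prod>e\<in>path_edges (u # (p # ps) @ [v]). edge_weight w L e)"
    unfolding us using cycle_closing_edge[OF d]
    by (subst cycle_edges_conv_path) (auto simp: finite_path_edges)
  also have "\<dots> = (w v * w u / L) * (w u * w v / L * prod_list (map (\<lambda>x. w x ^ 2 / L) (p # ps)))"
    unfolding prod_edge_weight_path[OF d] using d by (subst edge_weight_doubleton) auto
  finally show ?thesis unfolding us by (simp add: power2_eq_square)
qed

lemma sum_edge_weight_cycle:
  fixes w :: "'v \<Rightarrow> real"
  assumes "distinct us" "3 \<le> length us" "0 < L"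
  shows "(\<Sum>e\<in>cycle_edges us. edge_weight w L e) \<le> sum_list (map (\<lambda>x. w x ^ 2 / L) us)"
proof -
  obtain u p ps v where us: "us = u # (p # ps) @ [v]" using assms(2) by (rule long_list_split)
  have d: "distinct (u # (p # ps) @ [v])" using assms us by simp
  have "(\<Sum>e\<in>cycle_edges us. edge_weight w L e) =
      edge_weight w L {v, u} + (\<Sum>e\<in>path_edges (u # (p # ps) @ [v]). edge_weight w L e)"
    unfolding us using cycle_closing_edge[OF d]
    by (subst cycle_edges_conv_path) (auto simp: finite_path_edges)
  also have "edge_weight w L {v, u} \<le> w v ^ 2 / L / 2 + w u ^ 2 / L / 2"
    using sum_edge_weight_path[of v "[]" u L w] d assms(3) by auto
  also note sum_edge_weight_path[OF d assms(3)]
  finally show ?thesis unfolding us by simp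
qed

text \<open>A Weierstrass product inequality with quadratic defects. The \<open>x e\<close> may
  exceed 1; then, or when the partial sum exceeds 1, the left-hand side is at most zero.\<close>

lemma prod_lower_bound:
  fixes x p :: "'e \<Rightarrow> real"
  assumes "finite S" "\<And>e. e \<in> S \<Longrightarrow> 0 \<le> p e" "\<And>e. e \<in> S \<Longrightarrow> 0 \<le> x e" "\<And>e. e \<in> S \<Longrightarrow> x e - x e ^ 2 \<le> p e"
  shows "(\<Prod>e\<in>S. x e) * (1 - (\<Sum>e\<in>S. x e)) \<le> (\<Prod>e\<in>S. p e)"
  using assms
proof (induction S rule: finite_induct)
  case (insert a S)
  let ?X = "\<Prod>e\<in>S. x e" and ?s = "\<Sum>e\<in>S. x e" and ?P = "\<Prod>e\<in>S. p e"
  have n: "0 \<le> ?X" "0 \<le> ?s" "0 \<le> ?P" "0 \<le> x a" "0 \<le> p a"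
    using insert.prems by (auto intro!: prod_nonneg sum_nonneg)
  have "x a * ?X * (1 - (x a + ?s)) \<le> p a * ?P"
  proof (cases "x a \<le> 1 \<and> ?s \<le> 1")
    case True
    have "x a * ?X * (1 - (x a + ?s)) \<le> x a * ?X * ((1 - x a) * (1 - ?s))"
      using n by (intro mult_left_mono) (auto simp: algebra_simps)
    also have "\<dots> = (x a - x a ^ 2) * (?X * (1 - ?s))"
      by (simp add: algebra_simps power2_eq_square)
    also have "\<dots> \<le> p a * ?P"
      using insert n True by (intro mult_mono) auto
    finally show ?thesis .
  next
    case False
    hence "x a * ?X * (1 - (x a + ?s)) \<le> 0"
      using n by (intro mult_nonneg_nonpos) auto
    thus ?thesis using n by (meson mult_nonneg_nonneg order_trans)
  qed
  thus ?case using insert by simp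
qed simp

section \<open>Cycles of the complete graph, grouped by length\<close>

definition all_edges :: "'v set \<Rightarrow> 'v set set" where
  "all_edges V = {{i, j} | i j. i \<in> V \<and> j \<in> V \<and> i \<noteq> j}"

lemma finite_all_edges: "finite V \<Longrightarrow> finite (all_edges V)"
  by (rule finite_subset[of _ "Pow V"]) (auto simp: all_edges_def)

lemma cycle_edges_all_edges:
  assumes "distinct us" "3 \<le> length us"
  shows "cycle_edges us \<subseteq> all_edges V \<longleftrightarrow> set us \<subseteq> V"
proof
  assume "cycle_edges us \<subseteq> all_edges V"
  hence "\<Union>(cycle_edges us) \<subseteq> V" by (auto simp: all_edges_def)
  thus "set us \<subseteq> V" using Union_cycle_edges[of us] assms by auto
next
  assume V: "set us \<subseteq> V"
  show "cycle_edges us \<subseteq> all_edges V"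
  proof
    fix e assume e: "e \<in> cycle_edges us"
    then obtain u v where "e = {u, v}" "u \<noteq> v" by (rule cycle_edges_elem[OF assms])
    moreover have "e \<subseteq> set us" using e Union_cycle_edges[of us] assms by auto
    ultimately show "e \<in> all_edges V" using V by (auto simp: all_edges_def)
  qed
qed

definition cycles_of_length :: "'v set \<Rightarrow> nat \<Rightarrow> 'v set set set" where
  "cycles_of_length V k = {C \<in> cycles (all_edges V). card C = k}"

lemma finite_cycles_of_length: "finite V \<Longrightarrow> finite (cycles_of_length V k)"
  by (rule finite_subset[OF _ finite_cycles[OF finite_all_edges[of V]]]) (auto simp: cycles_of_length_def)

text \<open>Each cycle of length \<open>k\<close> is given by \<open>2 * k\<close> lists, one for
  every oriented edge at the front. This is the origin of the factor \<open>1 / (2 * k)\<close> in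
  the Poisson rates.\<close>

lemma sum_cycles_of_length:
  fixes f :: "'v set set \<Rightarrow> real"
  assumes V: "finite V" and k: "3 \<le> k"
  shows "(\<Sum>C\<in>cycles_of_length V k. f C) =
     (\<Sum>us\<in>{xs. set xs \<subseteq> V \<and> length xs = k}. if distinct us then f (cycle_edges us) else 0) / (2 * real k)"
proof -
  let ?S = "{xs \<in> {xs. set xs \<subseteq> V \<and> length xs = k}. distinct xs}"
  have fin: "finite ?S" using finite_lists_length_eq[OF V, of k] by (rule rev_finite_subset) auto
  have img: "cycle_edges ` ?S = cycles_of_length V k"
  proof
    show "cycle_edges ` ?S \<subseteq> cycles_of_length V k"
    proof
      fix C assume "C \<in> cycle_edges ` ?S"
      then obtain us where us: "C = cycle_edges us" "set us \<subseteq> V" "length us = k" "distinct us" by auto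
      thus "C \<in> cycles_of_length V k" using k cycle_edges_all_edges[of us V] card_cycle_edges[of us]
        by (auto simp: cycles_of_length_def cycles_def)
    qed
    show "cycles_of_length V k \<subseteq> cycle_edges ` ?S"
      by (auto simp: cycles_of_length_def cycles_def card_cycle_edges cycle_edges_all_edges)
  qed
  have "(\<Sum>us\<in>{xs. set xs \<subseteq> V \<and> length xs = k}. if distinct us then f (cycle_edges us) else 0) =
      (\<Sum>us\<in>?S. f (cycle_edges us))"
    using finite_lists_length_eq[OF V, of k] by (rule sum.inter_filter[symmetric])
  also have "\<dots> = (\<Sum>C\<in>cycle_edges ` ?S. \<Sum>us\<in>{us \<in> ?S. cycle_edges us = C}. f (cycle_edges us))"
    by (rule sum.image_gen[OF fin])
  also have "\<dots> = (\<Sum>C\<in>cycles_of_length V k. 2 * real k * f C)"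
    unfolding img
  proof (rule sum.cong)
    fix C assume C: "C \<in> cycles_of_length V k"
    then obtain vs where vs: "distinct vs" "3 \<le> length vs" "C = cycle_edges vs" "set vs \<subseteq> V" "length vs = k"
      by (auto simp: cycles_of_length_def cycles_def card_cycle_edges cycle_edges_all_edges)
    have "{us \<in> ?S. cycle_edges us = C} = {us. distinct us \<and> 3 \<le> length us \<and> cycle_edges us = cycle_edges vs}"
    proof (intro set_eqI iffI)
      fix us assume "us \<in> {us. distinct us \<and> 3 \<le> length us \<and> cycle_edges us = cycle_edges vs}"
      hence us: "distinct us" "3 \<le> length us" "cycle_edges us = cycle_edges vs" by auto
      have "length us = k" using card_cycle_edges[OF us(1,2)] card_cycle_edges[OF vs(1,2)] us vs by simp
      moreover have "set us \<subseteq> V"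
        using cycle_edges_all_edges[OF us(1,2), of V] cycle_edges_all_edges[OF vs(1,2), of V] us vs by simp
      ultimately show "us \<in> {us \<in> ?S. cycle_edges us = C}" using us vs by auto
    qed (use k vs in auto)
    hence "card {us \<in> ?S. cycle_edges us = C} = 2 * k"
      using card_cycle_representations[OF vs(1,2)] vs(5) by simp
    moreover have "(\<Sum>us\<in>{us \<in> ?S. cycle_edges us = C}. f (cycle_edges us)) =
        (\<Sum>us\<in>{us \<in> ?S. cycle_edges us = C}. f C)" by (intro sum.cong) auto
    ultimately show "(\<Sum>us\<in>{us \<in> ?S. cycle_edges us = C}. f (cycle_edges us)) = 2 * real k * f C"
      by simp
  qed simp
  finally show ?thesis using k by (simp add: sum_distrib_left[symmetric])
qed

section \<open>Sums of cycle weights in terms of \<open>R\<close> and \<open>eps\<close>\<close>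

context
  fixes V :: "'v set" and w :: "'v \<Rightarrow> real" and L R eps :: real
  assumes V: "finite V" and L: "0 < L"
    and R: "R = (\<Sum>x\<in>V. w x ^ 2 / L)" and eps: "eps = (\<Sum>x\<in>V. (w x ^ 2 / L) ^ 2)"
begin

text \<open>Every vertex of a cycle lies on two of its edges, so the cycle weight is the product of
  \<open>w x ^ 2 / L\<close>. Summed over all lists this is \<open>R ^ k\<close>; the lists with a
  repetition cost the term with \<open>eps\<close>.\<close>

lemma sum_cycle_weight:
  assumes k: "3 \<le> k"
  shows "(\<Sum>C\<in>cycles_of_length V k. \<Prod>e\<in>C. edge_weight w L e) \<le> R ^ k / (2 * real k)"
    and "R ^ k / (2 * real k) - real k * eps * R ^ (k - 2) / 2 \<le>
       (\<Sum>C\<in>cycles_of_length V k. \<Prod>e\<in>C. edge_weight w L e)"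
proof -
  let ?g = "\<lambda>x. w x ^ 2 / L"
  let ?S = "{xs. set xs \<subseteq> V \<and> length xs = k}"
  let ?P = "\<lambda>xs. prod_list (map ?g xs)"
  have g: "0 \<le> ?g x" for x using L by simp
  have eps0: "0 \<le> eps" "0 \<le> R" unfolding eps R using L by (auto intro!: sum_nonneg)
  have "(\<Sum>C\<in>cycles_of_length V k. \<Prod>e\<in>C. edge_weight w L e) =
      (\<Sum>us\<in>?S. if distinct us then ?P us else 0) / (2 * real k)" (is "?c = ?d / _")
    unfolding sum_cycles_of_length[OF V k] using k
    by (intro arg_cong2[of _ _ _ _ "(/)"] sum.cong) (auto simp: prod_edge_weight_cycle)
  moreover have "?d + (\<Sum>us\<in>?S. if distinct us then 0 else ?P us) = R ^ k"
    unfolding sum.distrib[symmetric] R sum_lists_prod[OF V, symmetric] by (intro sum.cong) auto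
  moreover have "(\<Sum>us\<in>?S. if distinct us then 0 else ?P us) \<le> real k * (real k - 1) * eps * R ^ (k - 2)"
    unfolding eps R by (rule sum_lists_not_distinct[OF V g])
  moreover have "\<dots> \<le> real k * real k * eps * R ^ (k - 2)"
    using eps0 k by (intro mult_right_mono mult_left_mono) auto
  moreover have "0 \<le> (\<Sum>us\<in>?S. if distinct us then 0 else ?P us)"
    by (intro sum_nonneg) (simp add: prod_list_nonneg_map[of ?g, OF g])
  ultimately show "?c \<le> R ^ k / (2 * real k)"
    and "R ^ k / (2 * real k) - real k * eps * R ^ (k - 2) / 2 \<le> ?c"
    using k by (auto simp: field_simps)
qed

text \<open>The extra factor is the relative loss in \<open>prod_lower_bound\<close> when edge
  probabilities replace edge weights.\<close>

lemma sum_cycle_weight_edge: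
  assumes k: "3 \<le> k"
  shows "(\<Sum>C\<in>cycles_of_length V k. (\<Prod>e\<in>C. edge_weight w L e) * (\<Sum>e\<in>C. edge_weight w L e))
     \<le> eps * R ^ (k - 1) / 2"
proof -
  let ?g = "\<lambda>x. w x ^ 2 / L"
  let ?S = "{xs. set xs \<subseteq> V \<and> length xs = k}"
  let ?P = "\<lambda>xs. prod_list (map ?g xs)"
  have g: "0 \<le> ?g x" for x using L by simp
  have P0: "0 \<le> ?P xs" for xs using g by (rule prod_list_nonneg_map)
  have s0: "0 \<le> sum_list (map ?g xs)" for xs using g by (intro sum_list_nonneg) auto
  have "(\<Sum>C\<in>cycles_of_length V k. (\<Prod>e\<in>C. edge_weight w L e) * (\<Sum>e\<in>C. edge_weight w L e))
      \<le> (\<Sum>us\<in>?S. ?P us * sum_list (map ?g us)) / (2 * real k)"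
    unfolding sum_cycles_of_length[OF V k] using k P0 s0
    by (intro divide_right_mono sum_mono)
       (auto simp: prod_edge_weight_cycle intro!: mult_left_mono sum_edge_weight_cycle L)
  also have "\<dots> = eps * R ^ (k - 1) / 2"
    unfolding sum_lists_prod_sum[OF V] eps R using k by simp
  finally show ?thesis .
qed

text \<open>Here \<open>u\<close> and \<open>v\<close> are the end points of an excursion. By
  Cauchy-Schwarz the double sum is at most \<open>k\<close> times the sum of
  \<open>w x ^ 2 / L\<close> over the cycle, which again marks one vertex.\<close>

lemma sum_cycle_weight_pairs:
  assumes k: "3 \<le> k"
  shows "(\<Sum>C\<in>cycles_of_length V k. (\<Prod>e\<in>C. edge_weight w L e) * (\<Sum>u\<in>\<Union>C. \<Sum>v\<in>\<Union>C. w u * w v / L))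
     \<le> real k * eps * R ^ (k - 1) / 2"
proof -
  let ?g = "\<lambda>x. w x ^ 2 / L"
  let ?S = "{xs. set xs \<subseteq> V \<and> length xs = k}"
  let ?P = "\<lambda>xs. prod_list (map ?g xs)"
  have g: "0 \<le> ?g x" for x using L by simp
  have P0: "0 \<le> ?P xs" for xs using g by (rule prod_list_nonneg_map)
  have s0: "0 \<le> sum_list (map ?g xs)" for xs using g by (intro sum_list_nonneg) auto
  have *: "(\<Sum>u\<in>set us. \<Sum>v\<in>set us. w u * w v / L) \<le> real k * sum_list (map ?g us)"
    if us: "distinct us" "length us = k" for us
  proof -
    have "(\<Sum>u\<in>set us. \<Sum>v\<in>set us. w u * w v / L) = (\<Sum>u\<in>set us. w u) ^ 2 / L"
      by (simp add: power2_eq_square sum_product sum_divide_distrib)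
    also have "(\<Sum>u\<in>set us. w u) ^ 2 \<le> (\<Sum>u\<in>set us. w u ^ 2) * real (card (set us))"
      using Cauchy_Schwarz_ineq_sum[of w "\<lambda>_. 1" "set us"] by simp
    finally show ?thesis using us L
      by (simp add: divide_right_mono distinct_card sum_list_distinct_conv_sum_set
          sum_divide_distrib[symmetric] mult.commute)
  qed
  have "(\<Sum>C\<in>cycles_of_length V k. (\<Prod>e\<in>C. edge_weight w L e) * (\<Sum>u\<in>\<Union>C. \<Sum>v\<in>\<Union>C. w u * w v / L))
      \<le> (\<Sum>us\<in>?S. ?P us * (real k * sum_list (map ?g us))) / (2 * real k)"
    unfolding sum_cycles_of_length[OF V k] using k P0 s0 *
    by (intro divide_right_mono sum_mono)
       (auto simp: prod_edge_weight_cycle Union_cycle_edges intro!: mult_left_mono)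
  also have "(\<Sum>us\<in>?S. ?P us * (real k * sum_list (map ?g us))) = real k * (\<Sum>us\<in>?S. ?P us * sum_list (map ?g us))"
    by (simp add: sum_distrib_left mult_ac)
  also have "real k * (\<Sum>us\<in>?S. ?P us * sum_list (map ?g us)) / (2 * real k) = real k * eps * R ^ (k - 1) / 2"
    unfolding sum_lists_prod_sum[OF V] eps R using k by simp
  finally show ?thesis .
qed

end

section \<open>The random graph for fixed weights\<close>

lemma exp_minus_le_quadratic:
  assumes "0 \<le> (x::real)"
  shows "exp (- x) \<le> 1 - x + x ^ 2"
proof (cases "x \<le> 1")
  case True
  have "exp (- x) * (1 + x) \<le> exp (- x) * exp x"
    using exp_ge_add_one_self[of x] by (intro mult_left_mono) auto
  hence "exp (- x) * (1 + x) \<le> 1" by (simp add: exp_minus)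
  \<comment> \<open>The product is \<open>1 + x ^ 3\<close>.\<close>
  moreover have "1 \<le> (1 - x + x ^ 2) * (1 + x)"
    using assms by (simp add: algebra_simps power2_eq_square)
  ultimately have "exp (- x) * (1 + x) \<le> (1 - x + x ^ 2) * (1 + x)" by linarith
  thus ?thesis using assms by (simp add: mult_le_cancel_right)
next
  case False
  hence "x \<le> x ^ 2" by (simp add: power2_eq_square)
  thus ?thesis using exp_le_one_iff[of "-x"] assms by linarith
qed

definition edge_fun :: "graph_model \<Rightarrow> real \<Rightarrow> real" where
  "edge_fun model x = (case model of Chung_Lu \<Rightarrow> min 1 x | Norros_Reittu \<Rightarrow> 1 - exp (- x))"

text \<open>The estimates use the model only through these bounds, so both models are treated at
  once. By the last one an edge probability falls short of its weight by at most the square of the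
  weight.\<close>

lemma edge_fun_bounds:
  assumes "0 \<le> x"
  shows "0 \<le> edge_fun model x" "edge_fun model x \<le> 1" "edge_fun model x \<le> x" "x - x ^ 2 \<le> edge_fun model x"
proof -
  have 1: "x - x ^ 2 \<le> 1"
  proof (cases "x \<le> 1")
    case True
    thus ?thesis using zero_le_power2[of x] by linarith
  next
    case False
    hence "x \<le> x ^ 2" by (simp add: power2_eq_square)
    thus ?thesis by simp
  qed
  thus "0 \<le> edge_fun model x" "edge_fun model x \<le> 1" "edge_fun model x \<le> x" "x - x ^ 2 \<le> edge_fun model x"
    using assms 1 exp_minus_le_quadratic[OF assms] exp_ge_add_one_self[of "-x"] by (auto simp: edge_fun_def split: graph_model.splits)
qed

locale graph_weights =
  fixes model :: graph_model and n :: nat and w :: "nat \<Rightarrow> real"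
  assumes n: "0 < n" and w_pos: "\<And>i. i \<in> {1..n} \<Longrightarrow> 0 < w i"
begin

definition "V = {1..n}"
definition "L = (\<Sum>k = 1..n. w k)"
definition "R = (\<Sum>x\<in>V. w x ^ 2 / L)"
definition "eps = (\<Sum>x\<in>V. (w x ^ 2 / L) ^ 2)"
definition "P = graph_given_weights model n w"
definition "pe e = edge_fun model (edge_weight w L e)"

abbreviation "E \<equiv> measure_pmf.expectation P"

lemma finite_V: "finite V" by (simp add: V_def)

lemma L_pos: "0 < L"
  unfolding L_def using n w_pos by (intro sum_pos) auto

lemma R_nonneg: "0 \<le> R" and eps_nonneg: "0 \<le> eps"
  unfolding R_def eps_def using L_pos by (auto intro!: sum_nonneg)

lemma all_edges_V: "e \<in> all_edges V \<longleftrightarrow> (\<exists>i j. (i, j) \<in> vertex_pairs n \<and> e = {i, j})"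
proof
  assume "e \<in> all_edges V"
  then obtain i j where "e = {i, j}" "i \<in> V" "j \<in> V" "i \<noteq> j" by (auto simp: all_edges_def)
  moreover from this have "(i, j) \<in> vertex_pairs n \<or> (j, i) \<in> vertex_pairs n"
    by (auto simp: vertex_pairs_def V_def)
  ultimately show "\<exists>i j. (i, j) \<in> vertex_pairs n \<and> e = {i, j}" by (auto simp: insert_commute)
next
  assume "\<exists>i j. (i, j) \<in> vertex_pairs n \<and> e = {i, j}"
  then obtain i j where "e = {i, j}" "i \<in> V" "j \<in> V" "i \<noteq> j"
    by (auto simp: vertex_pairs_def V_def)
  thus "e \<in> all_edges V" unfolding all_edges_def by blast
qed

lemma edge_weight_nonneg:
  assumes "e \<in> all_edges V" shows "0 \<le> edge_weight w L e"
proof -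
  have "0 \<le> w v" if "v \<in> e" for v
    using assms that w_pos[of v] by (auto simp: all_edges_def V_def)
  thus ?thesis unfolding edge_weight_def using L_pos by (simp add: prod_nonneg)
qed

lemma pe_bounds:
  assumes "e \<in> all_edges V"
  shows "0 \<le> pe e" "pe e \<le> 1" "pe e \<le> edge_weight w L e" "edge_weight w L e - edge_weight w L e ^ 2 \<le> pe e"
  unfolding pe_def using edge_fun_bounds[OF edge_weight_nonneg[OF assms]] by auto

lemma graph_of_subset: "graph_of n f \<subseteq> all_edges V"
  unfolding graph_of_def using all_edges_V by blast

lemma set_P: "set_pmf P \<subseteq> Pow (all_edges V)"
  unfolding P_def graph_given_weights_def using graph_of_subset by auto

lemma finite_set_P: "finite (set_pmf P)"
  using finite_subset[OF set_P] finite_all_edges[OF finite_V] by simp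

lemma integrable_P: "integrable (measure_pmf P) (h :: _ \<Rightarrow> real)"
  by (rule integrable_measure_pmf_finite[OF finite_set_P])

lemma expectation_cong:
  "(\<And>G. G \<subseteq> all_edges V \<Longrightarrow> f G = g G) \<Longrightarrow> E f = E (g :: _ \<Rightarrow> real)"
  using set_P by (intro integral_cong_AE) (auto simp: AE_measure_pmf_iff)

lemma expectation_mono:
  "(\<And>G. G \<subseteq> all_edges V \<Longrightarrow> f G \<le> g G) \<Longrightarrow> E f \<le> E (g :: _ \<Rightarrow> real)"
  using set_P by (intro integral_mono_AE integrable_P) (auto simp: AE_measure_pmf_iff)

lemma expectation_abs_le:
  assumes "\<And>G. G \<subseteq> all_edges V \<Longrightarrow> \<bar>f G\<bar> \<le> g G"
  shows "\<bar>E f\<bar> \<le> E (g :: _ \<Rightarrow> real)"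
proof -
  have "\<bar>E f\<bar> \<le> E (\<lambda>G. \<bar>f G\<bar>)" by (rule integral_abs_bound)
  also have "\<dots> \<le> E g" by (rule expectation_mono[OF assms])
  finally show ?thesis .
qed

text \<open>\<open>Q\<close> is the law of the graph without the pair \<open>e\<close>: splitting
  off one coordinate of the product measure isolates an independent coin.\<close>

lemma edge_decomposition:
  assumes e: "e \<in> all_edges V"
  obtains Q where "finite (set_pmf Q)" "\<And>G. G \<in> set_pmf Q \<Longrightarrow> e \<notin> G"
    "P = bernoulli_pmf (pe e) \<bind> (\<lambda>y. map_pmf (\<lambda>G. if y then insert e G else G) Q)"
proof -
  obtain i j where ij: "(i, j) \<in> vertex_pairs n" "e = {i, j}" using e all_edges_V by blast
  let ?p = "\<lambda>(i, j). bernoulli_pmf (edge_prob model n w i j)"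
  let ?A = "vertex_pairs n - {(i, j)}"
  have A: "finite ?A" "(i, j) \<notin> ?A" "insert (i, j) ?A = vertex_pairs n"
    using finite_vertex_pairs ij by auto
  define Q where "Q = map_pmf (graph_of n) (Pi_pmf ?A False ?p)"
  have "i \<noteq> j" using ij(1) by (auto simp: vertex_pairs_def)
  hence pe: "?p (i, j) = bernoulli_pmf (pe e)"
    by (simp add: pe_def edge_fun_def edge_prob_def ij(2) edge_weight_doubleton L_def Let_def
        split: graph_model.splits)
  have step: "graph_of n (f((i, j) := y)) = (if y then insert e (graph_of n f) else graph_of n f)"
    if "\<not> f (i, j)" for f y
  proof -
    have eq: "{a, b} = e \<longleftrightarrow> (a, b) = (i, j)" if "(a, b) \<in> vertex_pairs n" for a b
      using that ij by (auto simp: vertex_pairs_def doubleton_eq_iff)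
    show ?thesis using that ij
    proof (cases y)
      case True
      have "graph_of n (f((i, j) := True)) = insert e (graph_of n f)"
      proof (intro set_eqI iffI)
        fix x assume "x \<in> graph_of n (f((i, j) := True))"
        then obtain a b where "x = {a, b}" "(a, b) \<in> vertex_pairs n" "(f((i, j) := True)) (a, b)"
          by (auto simp: graph_of_def)
        thus "x \<in> insert e (graph_of n f)" using ij(2) by (cases "(a, b) = (i, j)") (auto simp: graph_of_def)
      next
        fix x assume "x \<in> insert e (graph_of n f)"
        thus "x \<in> graph_of n (f((i, j) := True))" using ij by (auto simp: graph_of_def)
      qed
      thus ?thesis using True by simp
    next
      case False
      thus ?thesis using that by (simp add: fun_upd_idem)
    qed
  qed
  have off: "\<not> f (i, j)" if "f \<in> set_pmf (Pi_pmf ?A False ?p)" for f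
    using set_Pi_pmf_subset[OF A(1), of False ?p] that by auto
  show ?thesis
  proof (rule that[of Q])
    show "finite (set_pmf Q)"
    proof (rule finite_subset)
      show "set_pmf Q \<subseteq> Pow (all_edges V)" using graph_of_subset by (auto simp: Q_def)
    qed (simp add: finite_all_edges finite_V)
    show "e \<notin> G" if G: "G \<in> set_pmf Q" for G
    proof
      assume "e \<in> G"
      from G obtain f where f: "f \<in> set_pmf (Pi_pmf ?A False ?p)" "G = graph_of n f" by (auto simp: Q_def)
      from \<open>e \<in> G\<close> obtain a b where ab: "(a, b) \<in> vertex_pairs n" "f (a, b)" "{a, b} = {i, j}"
        unfolding f(2) graph_of_def ij(2) by auto
      hence "(a, b) = (i, j)" using ij(1) by (auto simp: vertex_pairs_def doubleton_eq_iff)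
      thus False using ab off[OF f(1)] by simp
    qed
    have "P = map_pmf (graph_of n) (?p (i, j) \<bind> (\<lambda>y. Pi_pmf ?A False ?p \<bind> (\<lambda>f. return_pmf (f((i, j) := y)))))"
      unfolding P_def graph_given_weights_def
      using Pi_pmf_insert'[OF A(1,2), of False ?p, unfolded A(3)] by simp
    also have "\<dots> = bernoulli_pmf (pe e) \<bind> (\<lambda>y. map_pmf (\<lambda>f. graph_of n (f((i, j) := y))) (Pi_pmf ?A False ?p))"
      unfolding pe map_bind_pmf map_return_pmf by (simp only: map_pmf_def)
    also have "\<dots> = bernoulli_pmf (pe e) \<bind> (\<lambda>y. map_pmf (\<lambda>f. if y then insert e (graph_of n f) else graph_of n f) (Pi_pmf ?A False ?p))"
      by (intro bind_pmf_cong refl map_pmf_cong step off)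
    also have "\<dots> = bernoulli_pmf (pe e) \<bind> (\<lambda>y. map_pmf (\<lambda>G. if y then insert e G else G) Q)"
      unfolding Q_def by (simp add: pmf.map_comp o_def)
    finally show "P = \<dots>" .
  qed
qed

text \<open>Given \<open>e\<close>, the rest of the graph has law \<open>Q\<close>. Inserting
  \<open>e\<close> makes both branches of \<open>edge_decomposition\<close> equal, so the mean on
  the right is also one under \<open>Q\<close>.\<close>

lemma expectation_insert:
  fixes \<phi> :: "nat set set \<Rightarrow> real"
  assumes e: "e \<in> all_edges V"
  shows "E (\<lambda>G. of_bool (e \<in> G) * \<phi> G) = pe e * E (\<lambda>G. \<phi> (insert e G))"
proof -
  obtain Q where Q: "finite (set_pmf Q)" "\<And>G. G \<in> set_pmf Q \<Longrightarrow> e \<notin> G"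
    "P = bernoulli_pmf (pe e) \<bind> (\<lambda>y. map_pmf (\<lambda>G. if y then insert e G else G) Q)"
    using edge_decomposition[OF e] by blast
  have split: "E h = pe e * measure_pmf.expectation Q (\<lambda>G. h (insert e G)) +
      (1 - pe e) * measure_pmf.expectation Q h" for h :: "nat set set \<Rightarrow> real"
    unfolding Q(3) using pe_bounds[OF e] Q(1)
    by (subst pmf_expectation_bind[of UNIV]) (simp_all add: UNIV_bool[symmetric], simp add: UNIV_bool)
  have "measure_pmf.expectation Q (\<lambda>G. of_bool (e \<in> G) * \<phi> G) = measure_pmf.expectation Q (\<lambda>G. 0)"
    using Q(2) by (intro integral_cong_AE) (auto simp: AE_measure_pmf_iff)
  thus ?thesis unfolding split by (simp add: algebra_simps)
qed

text \<open>Conditioning on the edges of \<open>S\<close> amounts to adding them: the size-bias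
  identity for independent edges.\<close>

lemma expectation_Un:
  fixes \<phi> :: "nat set set \<Rightarrow> real"
  assumes "finite S" "S \<subseteq> all_edges V"
  shows "E (\<lambda>G. of_bool (S \<subseteq> G) * \<phi> G) = (\<Prod>e\<in>S. pe e) * E (\<lambda>G. \<phi> (G \<union> S))"
  using assms
proof (induction S arbitrary: \<phi> rule: finite_induct)
  case (insert e S)
  have "E (\<lambda>G. of_bool (insert e S \<subseteq> G) * \<phi> G) = E (\<lambda>G. of_bool (e \<in> G) * (of_bool (S \<subseteq> G) * \<phi> G))"
    by (intro Bochner_Integration.integral_cong) auto
  also have "\<dots> = pe e * E (\<lambda>G. of_bool (S \<subseteq> insert e G) * \<phi> (insert e G))"
    using insert.prems by (intro expectation_insert) simp
  also have "(\<lambda>G. of_bool (S \<subseteq> insert e G) * \<phi> (insert e G)) = (\<lambda>G. of_bool (S \<subseteq> G) * \<phi> (insert e G))"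
    using insert.hyps by (auto simp: fun_eq_iff subset_insert)
  also have "E \<dots> = (\<Prod>e\<in>S. pe e) * E (\<lambda>G. \<phi> (insert e (G \<union> S)))"
    using insert.prems by (intro insert.IH) simp
  finally show ?case using insert.hyps by simp
qed simp

lemma prob_subset:
  assumes "finite S" "S \<subseteq> all_edges V"
  shows "E (\<lambda>G. of_bool (S \<subseteq> G)) = (\<Prod>e\<in>S. pe e)"
  using expectation_Un[OF assms, of "\<lambda>_. 1"] by simp

lemma cycles_of_lengthD:
  assumes "C \<in> cycles_of_length V k"
  shows "C \<subseteq> all_edges V" "finite C" "\<Union>C \<subseteq> V" "C \<in> cycles (all_edges V)" "card C = k"
proof -
  show "C \<subseteq> all_edges V" "C \<in> cycles (all_edges V)" "card C = k"
    using assms by (auto simp: cycles_of_length_def cycles_def)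
  thus "finite C" "\<Union>C \<subseteq> V"
    using finite_subset[OF _ finite_all_edges[OF finite_V]] by (auto simp: all_edges_def)
qed

lemma cycle_count_eq_sum:
  assumes G: "G \<subseteq> all_edges V" and K: "finite K"
  shows "real (cycle_count G K) = (\<Sum>k\<in>K. \<Sum>C\<in>cycles_of_length V k. of_bool (C \<subseteq> G))"
proof -
  have "{C \<in> cycles G. card C \<in> K} = (\<Union>k\<in>K. {C \<in> cycles_of_length V k. C \<subseteq> G})"
    using G unfolding cycles_of_length_def cycles_def by blast
  hence "cycle_count G K = (\<Sum>k\<in>K. card {C \<in> cycles_of_length V k. C \<subseteq> G})"
    unfolding cycle_count_def using K finite_cycles_of_length[OF finite_V]
    by (simp only:, subst card_UN_disjoint) (auto simp: cycles_of_length_def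
        intro: finite_subset[OF _ finite_cycles_of_length[OF finite_V, unfolded cycles_of_length_def]])
  also have "real \<dots> = (\<Sum>k\<in>K. \<Sum>C\<in>cycles_of_length V k. of_bool (C \<subseteq> G))"
    unfolding of_nat_sum using finite_cycles_of_length[OF finite_V]
    by (intro sum.cong refl) (simp add: of_bool_def sum.inter_filter[symmetric])
  finally show ?thesis .
qed

definition cycle_mean :: "nat set \<Rightarrow> real" where
  "cycle_mean K = (\<Sum>k\<in>K. \<Sum>C\<in>cycles_of_length V k. \<Prod>e\<in>C. pe e)"

lemma prod_pe_nonneg: "C \<in> cycles_of_length V k \<Longrightarrow> 0 \<le> (\<Prod>e\<in>C. pe e)"
  using cycles_of_lengthD(1) pe_bounds(1) by (intro prod_nonneg) blast

lemma prod_pe_le: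
  assumes "S \<subseteq> all_edges V" shows "(\<Prod>e\<in>S. pe e) \<le> (\<Prod>e\<in>S. edge_weight w L e)"
  using assms pe_bounds by (intro prod_mono) blast

lemma expectation_cycle_count:
  assumes "finite K"
  shows "E (\<lambda>G. real (cycle_count G K)) = cycle_mean K"
proof -
  have "E (\<lambda>G. real (cycle_count G K)) = E (\<lambda>G. \<Sum>k\<in>K. \<Sum>C\<in>cycles_of_length V k. of_bool (C \<subseteq> G))"
    by (rule expectation_cong) (simp add: cycle_count_eq_sum[OF _ assms])
  also have "\<dots> = (\<Sum>k\<in>K. \<Sum>C\<in>cycles_of_length V k. E (\<lambda>G. of_bool (C \<subseteq> G)))"
    by (simp add: Bochner_Integration.integral_sum integrable_P)
  finally show ?thesis unfolding cycle_mean_def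
    by (simp add: prob_subset cycles_of_lengthD cong: sum.cong)
qed

text \<open>The count is a sum of indicators of \<open>C \<subseteq> G\<close>, and
  \<open>expectation_Un\<close> turns each of them into the addition of \<open>C\<close>.
  \<open>\<psi>\<close> is the value of \<open>\<phi>\<close> after one more cycle, so the two
  differ only if there is an excursion, and then by at most \<open>2 * b\<close>.\<close>

lemma stein_error:
  assumes K: "finite K" and b: "\<And>G. \<bar>\<phi> G\<bar> \<le> b" "\<And>G. \<bar>\<psi> G\<bar> \<le> b"
    and step: "\<And>C G. C \<in> cycles (all_edges V) \<Longrightarrow> card C \<in> K \<Longrightarrow> G \<subseteq> all_edges V \<Longrightarrow>
        \<not> has_excursion N C G \<Longrightarrow> \<phi> (G \<union> C) = \<psi> G"
  shows "\<bar>E (\<lambda>G. real (cycle_count G K) * \<phi> G) - cycle_mean K * E \<psi>\<bar> \<le>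
     2 * b * (\<Sum>k\<in>K. \<Sum>C\<in>cycles_of_length V k. (\<Prod>e\<in>C. pe e) * E (\<lambda>G. of_bool (has_excursion N C G)))"
proof -
  have "E (\<lambda>G. real (cycle_count G K) * \<phi> G) =
      E (\<lambda>G. \<Sum>k\<in>K. \<Sum>C\<in>cycles_of_length V k. of_bool (C \<subseteq> G) * \<phi> G)"
    by (rule expectation_cong) (simp add: cycle_count_eq_sum[OF _ K] sum_distrib_right)
  also have "\<dots> = (\<Sum>k\<in>K. \<Sum>C\<in>cycles_of_length V k. E (\<lambda>G. of_bool (C \<subseteq> G) * \<phi> G))"
    by (subst Bochner_Integration.integral_sum, rule integrable_P)
       (simp add: Bochner_Integration.integral_sum integrable_P)
  also have "\<dots> = (\<Sum>k\<in>K. \<Sum>C\<in>cycles_of_length V k. (\<Prod>e\<in>C. pe e) * E (\<lambda>G. \<phi> (G \<union> C)))"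
    by (intro sum.cong refl expectation_Un) (auto dest: cycles_of_lengthD)
  finally have eq: "E (\<lambda>G. real (cycle_count G K) * \<phi> G) - cycle_mean K * E \<psi> =
      (\<Sum>k\<in>K. \<Sum>C\<in>cycles_of_length V k. (\<Prod>e\<in>C. pe e) * (E (\<lambda>G. \<phi> (G \<union> C)) - E \<psi>))"
    by (simp add: cycle_mean_def sum_distrib_right sum_subtractf right_diff_distrib)
  have one: "\<bar>E (\<lambda>G. \<phi> (G \<union> C)) - E \<psi>\<bar> \<le> 2 * b * E (\<lambda>G. of_bool (has_excursion N C G))"
    if "k \<in> K" "C \<in> cycles_of_length V k" for k C
  proof -
    have "E (\<lambda>G. \<phi> (G \<union> C)) - E \<psi> = E (\<lambda>G. \<phi> (G \<union> C) - \<psi> G)"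
      by (simp add: Bochner_Integration.integral_diff integrable_P)
    also have "\<bar>\<dots>\<bar> \<le> E (\<lambda>G. 2 * b * of_bool (has_excursion N C G))"
    proof (rule expectation_abs_le)
      fix G assume "G \<subseteq> all_edges V"
      thus "\<bar>\<phi> (G \<union> C) - \<psi> G\<bar> \<le> 2 * b * of_bool (has_excursion N C G)"
        using step[of C G] cycles_of_lengthD(4,5)[OF that(2)] that(1) b(1)[of "G \<union> C"] b(2)[of G] by auto
    qed
    finally show ?thesis by simp
  qed
  have "\<bar>E (\<lambda>G. real (cycle_count G K) * \<phi> G) - cycle_mean K * E \<psi>\<bar> \<le>
      (\<Sum>k\<in>K. \<Sum>C\<in>cycles_of_length V k. \<bar>(\<Prod>e\<in>C. pe e) * (E (\<lambda>G. \<phi> (G \<union> C)) - E \<psi>)\<bar>)"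
    unfolding eq by (intro order_trans[OF sum_abs] sum_mono sum_abs)
  also have "\<dots> \<le> (\<Sum>k\<in>K. \<Sum>C\<in>cycles_of_length V k. (\<Prod>e\<in>C. pe e) * (2 * b * E (\<lambda>G. of_bool (has_excursion N C G))))"
    using one by (intro sum_mono) (auto simp: abs_mult prod_pe_nonneg intro!: mult_left_mono)
  finally show ?thesis by (simp add: sum_distrib_left mult_ac)
qed

text \<open>Union bound over end points, length and interior. A path has probability at most
  \<open>w u * w v / L\<close> times the factors \<open>w x ^ 2 / L\<close> of its interior, and the
  sum over all interiors of length \<open>l\<close> is \<open>R ^ l\<close>.\<close>

lemma prob_has_excursion:
  assumes "\<Union>C \<subseteq> V"
  shows "E (\<lambda>G. of_bool (has_excursion N C G)) \<le> (\<Sum>u\<in>\<Union>C. \<Sum>v\<in>\<Union>C. w u * w v / L) * (\<Sum>l<N. R ^ l)"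
proof -
  let ?S = "\<lambda>l. {ps. set ps \<subseteq> V \<and> length ps = l}"
  \<comment> \<open>Lists with repeated vertices are set to zero, since their edge weights need not
    multiply out to the path weight.\<close>
  let ?I = "\<lambda>u v ps G. if distinct (u # ps @ [v]) then of_bool (path_edges (u # ps @ [v]) \<subseteq> G) else (0::real)"
  have finC: "finite (\<Union>C)" using finite_subset[OF assms finite_V] .
  have w0: "0 \<le> w u" if "u \<in> V" for u using w_pos[of u] that by (simp add: V_def)
  have path: "path_edges xs \<subseteq> all_edges V" if "distinct xs" "set xs \<subseteq> V" for xs
    using that
  proof (induction xs rule: path_edges.induct)
    case (1 x y zs)
    thus ?case by (auto simp: all_edges_def)
  qed auto
  have "E (\<lambda>G. of_bool (has_excursion N C G)) \<le>
      E (\<lambda>G. \<Sum>u\<in>\<Union>C. \<Sum>v\<in>\<Union>C. \<Sum>l<N. \<Sum>ps\<in>?S l. ?I u v ps G)"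
  proof (rule expectation_mono)
    fix G assume G: "G \<subseteq> all_edges V"
    show "of_bool (has_excursion N C G) \<le> (\<Sum>u\<in>\<Union>C. \<Sum>v\<in>\<Union>C. \<Sum>l<N. \<Sum>ps\<in>?S l. ?I u v ps G)"
    proof (cases "has_excursion N C G")
      case True
      then obtain u ps v where ex: "u \<in> \<Union>C" "v \<in> \<Union>C" "u \<noteq> v" "distinct ps" "length ps < N"
        "set ps \<inter> \<Union>C = {}" "path_edges (u # ps @ [v]) \<subseteq> G"
        unfolding has_excursion_def by blast
      have "set (u # ps @ [v]) = \<Union>(path_edges (u # ps @ [v]))" by (rule Union_path_edges[symmetric]) simp
      also have "\<dots> \<subseteq> V" using ex(7) G by (auto simp: all_edges_def)
      finally have ps: "ps \<in> ?S (length ps)" by auto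
      have d: "distinct (u # ps @ [v])" using ex by auto
      have "1 = ?I u v ps G" using d ex(7) by simp
      also have "\<dots> \<le> (\<Sum>ps\<in>?S (length ps). ?I u v ps G)"
        by (rule member_le_sum[OF ps, where f = "\<lambda>ps. ?I u v ps G"])
           (simp_all add: finite_lists_length_eq[OF finite_V])
      also have "\<dots> \<le> (\<Sum>l<N. \<Sum>ps\<in>?S l. ?I u v ps G)"
        using ex(5) by (intro member_le_sum[where f = "\<lambda>l. \<Sum>ps\<in>?S l. ?I u v ps G"]) (auto intro!: sum_nonneg)
      also have "\<dots> \<le> (\<Sum>v\<in>\<Union>C. \<Sum>l<N. \<Sum>ps\<in>?S l. ?I u v ps G)"
        by (rule member_le_sum[OF ex(2), where f = "\<lambda>v. \<Sum>l<N. \<Sum>ps\<in>?S l. ?I u v ps G"])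
           (auto intro!: sum_nonneg finC)
      also have "\<dots> \<le> (\<Sum>u\<in>\<Union>C. \<Sum>v\<in>\<Union>C. \<Sum>l<N. \<Sum>ps\<in>?S l. ?I u v ps G)"
        by (rule member_le_sum[OF ex(1), where f = "\<lambda>u. \<Sum>v\<in>\<Union>C. \<Sum>l<N. \<Sum>ps\<in>?S l. ?I u v ps G"])
           (auto intro!: sum_nonneg finC)
      finally show ?thesis using True by simp
    qed (auto intro!: sum_nonneg)
  qed
  also have "\<dots> = (\<Sum>u\<in>\<Union>C. \<Sum>v\<in>\<Union>C. \<Sum>l<N. \<Sum>ps\<in>?S l. E (?I u v ps))"
    by (simp only: Bochner_Integration.integral_sum integrable_P)
  also have "\<dots> \<le> (\<Sum>u\<in>\<Union>C. \<Sum>v\<in>\<Union>C. \<Sum>l<N. \<Sum>ps\<in>?S l. w u * w v / L * prod_list (map (\<lambda>x. w x ^ 2 / L) ps))"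
  proof (intro sum_mono)
    fix u v l ps assume uv: "u \<in> \<Union>C" "v \<in> \<Union>C" and ps: "ps \<in> ?S l"
    have "0 \<le> prod_list (map (\<lambda>x. w x ^ 2 / L) ps)"
      using L_pos by (intro prod_list_nonneg_map) simp
    moreover have "0 \<le> w u" "0 \<le> w v" using uv assms w0 by auto
    ultimately have nn: "0 \<le> w u * w v / L * prod_list (map (\<lambda>x. w x ^ 2 / L) ps)"
      using L_pos by simp
    show "E (?I u v ps) \<le> w u * w v / L * prod_list (map (\<lambda>x. w x ^ 2 / L) ps)"
    proof (cases "distinct (u # ps @ [v])")
      case True
      have sub: "path_edges (u # ps @ [v]) \<subseteq> all_edges V" by (rule path[OF True]) (use uv assms ps in auto)
      have "E (?I u v ps) = (\<Prod>e\<in>path_edges (u # ps @ [v]). pe e)"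
        using prob_subset[OF finite_path_edges sub] True by simp
      also have "\<dots> \<le> (\<Prod>e\<in>path_edges (u # ps @ [v]). edge_weight w L e)"
        by (rule prod_pe_le[OF sub])
      finally show ?thesis unfolding prod_edge_weight_path[OF True] .
    next
      case False
      hence "?I u v ps = (\<lambda>_. 0)" by auto
      thus ?thesis using nn by simp
    qed
  qed
  also have "\<dots> = (\<Sum>u\<in>\<Union>C. \<Sum>v\<in>\<Union>C. w u * w v / L * (\<Sum>l<N. R ^ l))"
    unfolding R_def by (simp only: sum_distrib_left[symmetric] sum_lists_prod[OF finite_V])
  also have "\<dots> = (\<Sum>u\<in>\<Union>C. \<Sum>v\<in>\<Union>C. w u * w v / L) * (\<Sum>l<N. R ^ l)"
    by (simp only: sum_distrib_right[symmetric])
  finally show ?thesis .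
qed

lemma sum_has_excursion:
  assumes "K \<subseteq> {3..}"
  shows "(\<Sum>k\<in>K. \<Sum>C\<in>cycles_of_length V k. (\<Prod>e\<in>C. pe e) * E (\<lambda>G. of_bool (has_excursion N C G))) \<le>
     eps * (\<Sum>l<N. R ^ l) * (\<Sum>k\<in>K. real k * R ^ (k - 1)) / 2"
proof -
  have "(\<Sum>k\<in>K. \<Sum>C\<in>cycles_of_length V k. (\<Prod>e\<in>C. pe e) * E (\<lambda>G. of_bool (has_excursion N C G))) \<le>
     (\<Sum>k\<in>K. (\<Sum>l<N. R ^ l) * (real k * eps * R ^ (k - 1) / 2))"
  proof (rule sum_mono)
    fix k assume k: "k \<in> K"
    have "(\<Sum>C\<in>cycles_of_length V k. (\<Prod>e\<in>C. pe e) * E (\<lambda>G. of_bool (has_excursion N C G))) \<le>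
       (\<Sum>C\<in>cycles_of_length V k. (\<Prod>e\<in>C. edge_weight w L e) *
           ((\<Sum>u\<in>\<Union>C. \<Sum>v\<in>\<Union>C. w u * w v / L) * (\<Sum>l<N. R ^ l)))"
    proof (rule sum_mono)
      fix C assume C: "C \<in> cycles_of_length V k"
      show "(\<Prod>e\<in>C. pe e) * E (\<lambda>G. of_bool (has_excursion N C G)) \<le> (\<Prod>e\<in>C. edge_weight w L e) *
           ((\<Sum>u\<in>\<Union>C. \<Sum>v\<in>\<Union>C. w u * w v / L) * (\<Sum>l<N. R ^ l))"
        using cycles_of_lengthD[OF C]
        by (intro mult_mono prod_pe_le prob_has_excursion prod_nonneg edge_weight_nonneg integral_nonneg) auto
    qed
    also have "\<dots> = (\<Sum>l<N. R ^ l) * (\<Sum>C\<in>cycles_of_length V k. (\<Prod>e\<in>C. edge_weight w L e) *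
           (\<Sum>u\<in>\<Union>C. \<Sum>v\<in>\<Union>C. w u * w v / L))"
      unfolding sum_distrib_left[of "\<Sum>l<N. R ^ l"] by (intro sum.cong refl) (simp only: mult_ac)
    also have "\<dots> \<le> (\<Sum>l<N. R ^ l) * (real k * eps * R ^ (k - 1) / 2)"
      using k assms R_nonneg sum_cycle_weight_pairs[OF finite_V L_pos R_def eps_def, of k]
      by (intro mult_left_mono sum_nonneg) auto
    finally show "(\<Sum>C\<in>cycles_of_length V k. (\<Prod>e\<in>C. pe e) * E (\<lambda>G. of_bool (has_excursion N C G))) \<le>
      (\<Sum>l<N. R ^ l) * (real k * eps * R ^ (k - 1) / 2)" .
  qed
  also have "\<dots> = eps * (\<Sum>l<N. R ^ l) * (\<Sum>k\<in>K. real k * R ^ (k - 1)) / 2"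
    by (simp add: sum_distrib_left[where A = K] sum_divide_distrib mult_ac)
  finally show ?thesis .
qed

text \<open>The two terms with \<open>eps\<close> are the losses from lists with repeated vertices
  and from the quadratic defect of the edge probabilities.\<close>

lemma cycle_mean_bounds:
  assumes "K \<subseteq> {3..}"
  shows "cycle_mean K \<le> (\<Sum>k\<in>K. R ^ k / (2 * real k))"
    and "(\<Sum>k\<in>K. R ^ k / (2 * real k)) - eps * (\<Sum>k\<in>K. real k * R ^ (k - 2) / 2 + R ^ (k - 1) / 2) \<le> cycle_mean K"
proof -
  have le: "(\<Sum>C\<in>cycles_of_length V k. \<Prod>e\<in>C. pe e) \<le> (\<Sum>C\<in>cycles_of_length V k. \<Prod>e\<in>C. edge_weight w L e)" for k
    using cycles_of_lengthD(1) by (intro sum_mono prod_pe_le)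
  show "cycle_mean K \<le> (\<Sum>k\<in>K. R ^ k / (2 * real k))" unfolding cycle_mean_def
    using assms by (intro sum_mono order_trans[OF le] sum_cycle_weight(1)[OF finite_V L_pos R_def eps_def]) auto
  have ge: "(\<Sum>C\<in>cycles_of_length V k. \<Prod>e\<in>C. edge_weight w L e) -
      (\<Sum>C\<in>cycles_of_length V k. (\<Prod>e\<in>C. edge_weight w L e) * (\<Sum>e\<in>C. edge_weight w L e)) \<le>
      (\<Sum>C\<in>cycles_of_length V k. \<Prod>e\<in>C. pe e)" for k
    unfolding sum_subtractf[symmetric]
  proof (rule sum_mono)
    fix C assume C: "C \<in> cycles_of_length V k"
    have "(\<Prod>e\<in>C. edge_weight w L e) * (1 - (\<Sum>e\<in>C. edge_weight w L e)) \<le> (\<Prod>e\<in>C. pe e)"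
      using cycles_of_lengthD(1,2)[OF C] pe_bounds edge_weight_nonneg by (intro prod_lower_bound) auto
    thus "(\<Prod>e\<in>C. edge_weight w L e) - (\<Prod>e\<in>C. edge_weight w L e) * (\<Sum>e\<in>C. edge_weight w L e) \<le> (\<Prod>e\<in>C. pe e)"
      by (simp add: algebra_simps)
  qed
  have "(\<Sum>k\<in>K. R ^ k / (2 * real k)) - eps * (\<Sum>k\<in>K. real k * R ^ (k - 2) / 2 + R ^ (k - 1) / 2) =
      (\<Sum>k\<in>K. (R ^ k / (2 * real k) - real k * eps * R ^ (k - 2) / 2) - eps * R ^ (k - 1) / 2)"
    by (simp add: sum_distrib_left sum_subtractf[symmetric] algebra_simps)
  also have "\<dots> \<le> cycle_mean K" unfolding cycle_mean_def
  proof (rule sum_mono)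
    fix k assume "k \<in> K"
    hence k: "3 \<le> k" using assms by auto
    show "(R ^ k / (2 * real k) - real k * eps * R ^ (k - 2) / 2) - eps * R ^ (k - 1) / 2 \<le>
        (\<Sum>C\<in>cycles_of_length V k. \<Prod>e\<in>C. pe e)"
      using ge[of k] sum_cycle_weight(2)[OF finite_V L_pos R_def eps_def k]
        sum_cycle_weight_edge[OF finite_V L_pos R_def eps_def k] by linarith
  qed
  finally show "(\<Sum>k\<in>K. R ^ k / (2 * real k)) - eps * (\<Sum>k\<in>K. real k * R ^ (k - 2) / 2 + R ^ (k - 1) / 2) \<le> cycle_mean K" .
qed

end

section \<open>Poisson approximation for fixed weights\<close>

lemma abs_power_diff_le:
  fixes x r q :: real
  assumes "0 \<le> x" "x \<le> q" "0 \<le> r" "r \<le> q"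
  shows "\<bar>x ^ k - r ^ k\<bar> \<le> real k * q ^ (k - 1) * \<bar>x - r\<bar>"
proof (induction k)
  case (Suc k)
  have "x ^ Suc k - r ^ Suc k = x * (x ^ k - r ^ k) + r ^ k * (x - r)"
    by (simp add: algebra_simps)
  also have "\<bar>\<dots>\<bar> \<le> x * \<bar>x ^ k - r ^ k\<bar> + r ^ k * \<bar>x - r\<bar>"
    using assms by (intro order_trans[OF abs_triangle_ineq]) (simp add: abs_mult)
  also have "\<dots> \<le> q * (real k * q ^ (k - 1) * \<bar>x - r\<bar>) + q ^ k * \<bar>x - r\<bar>"
    using assms Suc by (intro add_mono mult_mono power_mono) auto
  also have "\<dots> = real (Suc k) * q ^ (Suc k - 1) * \<bar>x - r\<bar>"
    by (cases k) (auto simp: algebra_simps)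
  finally show ?case .
qed simp

lemma abs_power_taylor_le:
  fixes x r q :: real
  assumes "0 \<le> x" "x \<le> q" "0 \<le> r" "r \<le> q"
  shows "\<bar>x ^ k - r ^ k - real k * r ^ (k - 1) * (x - r)\<bar> \<le> real k * (real k - 1) * q ^ (k - 2) * (x - r) ^ 2"
proof (induction k)
  case (Suc k)
  show ?case
  proof (cases k)
    case (Suc m)
    have "x ^ Suc k - r ^ Suc k - real (Suc k) * r ^ (Suc k - 1) * (x - r) =
       x * (x ^ k - r ^ k - real k * r ^ (k - 1) * (x - r)) + real k * r ^ (k - 1) * (x - r) ^ 2"
      using Suc by (simp add: algebra_simps power2_eq_square)
    also have "\<bar>\<dots>\<bar> \<le> x * \<bar>x ^ k - r ^ k - real k * r ^ (k - 1) * (x - r)\<bar> + real k * r ^ (k - 1) * (x - r) ^ 2"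
      using assms by (intro order_trans[OF abs_triangle_ineq]) (simp add: abs_mult)
    also have "\<dots> \<le> q * (real k * (real k - 1) * q ^ (k - 2) * (x - r) ^ 2) + real k * q ^ (k - 1) * (x - r) ^ 2"
    proof (rule add_mono)
      show "x * \<bar>x ^ k - r ^ k - real k * r ^ (k - 1) * (x - r)\<bar> \<le> q * (real k * (real k - 1) * q ^ (k - 2) * (x - r) ^ 2)"
        using assms Suc.IH by (intro mult_mono) auto
      show "real k * r ^ (k - 1) * (x - r) ^ 2 \<le> real k * q ^ (k - 1) * (x - r) ^ 2"
        using assms by (intro mult_right_mono mult_left_mono power_mono) auto
    qed
    also have "\<dots> = real k * real k * q ^ (k - 1) * (x - r) ^ 2"
      using Suc by (cases m) (auto simp: algebra_simps)
    also have "\<dots> \<le> real (Suc k) * (real (Suc k) - 1) * q ^ (Suc k - 2) * (x - r) ^ 2"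
    proof -
      have "real k * real k \<le> real (Suc k) * (real (Suc k) - 1)" by (simp add: algebra_simps)
      moreover have "Suc k - 2 = k - 1" by simp
      ultimately show ?thesis using assms by (simp only:) (intro mult_right_mono; simp)
    qed
    finally show ?thesis .
  qed simp
qed simp

text \<open>A function of \<open>x\<close>, because the Poisson parameter is compared at the random
  \<open>R\<close> and at its limit \<open>r\<close>.\<close>

definition cycle_rate_sum :: "nat set \<Rightarrow> real \<Rightarrow> real" where
  "cycle_rate_sum K x = (\<Sum>k\<in>K. x ^ k / (2 * real k))"

definition cycle_rate_slope :: "nat set \<Rightarrow> real \<Rightarrow> real" where
  "cycle_rate_slope K x = (\<Sum>k\<in>K. x ^ (k - 1) / 2)"

text \<open>One constant \<open>M\<close> for all series that occur, taken at some \<open>q\<close>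
  above both \<open>R\<close> and \<open>r\<close>. The error constants then depend on
  \<open>K\<close> and \<open>N\<close> only through \<open>M\<close>, which is uniform in the
  subcritical case.\<close>

definition cycle_bound :: "nat \<Rightarrow> nat set \<Rightarrow> real \<Rightarrow> real \<Rightarrow> bool" where
  "cycle_bound N K q M \<longleftrightarrow> 1 \<le> M \<and> (\<Sum>k\<in>K. real k * q ^ (k - 1)) \<le> M \<and>
     (\<Sum>k\<in>K. real k * q ^ (k - 2) / 2 + q ^ (k - 1) / 2) \<le> M \<and> (\<Sum>l<N. q ^ l) \<le> M \<and>
     (\<Sum>k\<in>K. real k * q ^ (k - 2)) \<le> M \<and> cycle_rate_sum K q \<le> M"

lemma cycle_rate_sum_nonneg: "0 \<le> x \<Longrightarrow> 0 \<le> cycle_rate_sum K x"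
  unfolding cycle_rate_sum_def by (intro sum_nonneg) auto

lemma cycle_rate_sum_mono: "0 \<le> x \<Longrightarrow> x \<le> q \<Longrightarrow> cycle_rate_sum K x \<le> cycle_rate_sum K q"
  unfolding cycle_rate_sum_def by (intro sum_mono divide_right_mono power_mono) auto

lemma cycle_rate_sum_bounds:
  assumes K: "K \<subseteq> {3..}" and b: "cycle_bound N K q M" and xr: "0 \<le> x" "x \<le> q" "0 \<le> r" "r \<le> q"
  shows "\<bar>cycle_rate_sum K x - cycle_rate_sum K r\<bar> \<le> M * \<bar>x - r\<bar>"
    and "\<bar>cycle_rate_sum K x - cycle_rate_sum K r\<bar> \<le> M"
    and "\<bar>cycle_rate_sum K x - cycle_rate_sum K r - cycle_rate_slope K r * (x - r)\<bar> \<le> M * (x - r) ^ 2"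
    and "\<bar>cycle_rate_slope K r\<bar> \<le> M"
proof -
  have B: "1 \<le> M" "(\<Sum>k\<in>K. real k * q ^ (k - 1)) \<le> M" "(\<Sum>k\<in>K. real k * q ^ (k - 2)) \<le> M"
    "cycle_rate_sum K q \<le> M"
    using b unfolding cycle_bound_def by blast+
  have k3: "k \<ge> 3" if "k \<in> K" for k using K that by auto
  have kk: "q ^ (k - 1) / 2 \<le> real k * q ^ (k - 1)" if "k \<in> K" for k
  proof -
    have "1 / 2 * q ^ (k - 1) \<le> real k * q ^ (k - 1)"
      using k3[OF that] xr by (intro mult_right_mono) auto
    thus ?thesis by simp
  qed
  have "\<bar>cycle_rate_sum K x - cycle_rate_sum K r\<bar> \<le> (\<Sum>k\<in>K. \<bar>x ^ k / (2 * real k) - r ^ k / (2 * real k)\<bar>)"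
    unfolding cycle_rate_sum_def sum_subtractf[symmetric] by (rule sum_abs)
  also have "\<dots> \<le> (\<Sum>k\<in>K. real k * q ^ (k - 1) * \<bar>x - r\<bar>)"
  proof (rule sum_mono)
    fix k assume k: "k \<in> K"
    have "\<bar>x ^ k / (2 * real k) - r ^ k / (2 * real k)\<bar> = \<bar>x ^ k - r ^ k\<bar> / (2 * real k)"
      by (subst diff_divide_distrib[symmetric]) (simp add: abs_divide)
    also have "\<dots> \<le> (real k * q ^ (k - 1) * \<bar>x - r\<bar>) / (2 * real k)"
      using abs_power_diff_le[OF xr] by (intro divide_right_mono) auto
    also have "\<dots> = q ^ (k - 1) / 2 * \<bar>x - r\<bar>" using k3[OF k] by simp
    also have "\<dots> \<le> real k * q ^ (k - 1) * \<bar>x - r\<bar>"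
      using kk[OF k] by (intro mult_right_mono) auto
    finally show "\<bar>x ^ k / (2 * real k) - r ^ k / (2 * real k)\<bar> \<le> real k * q ^ (k - 1) * \<bar>x - r\<bar>" .
  qed
  also have "\<dots> \<le> M * \<bar>x - r\<bar>"
    unfolding sum_distrib_right[symmetric] by (intro mult_right_mono B) simp
  finally show "\<bar>cycle_rate_sum K x - cycle_rate_sum K r\<bar> \<le> M * \<bar>x - r\<bar>" .
  have "cycle_rate_sum K x \<le> M" "cycle_rate_sum K r \<le> M"
    using cycle_rate_sum_mono[of x q K] cycle_rate_sum_mono[of r q K] B(4) xr by linarith+
  moreover have "0 \<le> cycle_rate_sum K x" "0 \<le> cycle_rate_sum K r"
    using cycle_rate_sum_nonneg xr by auto
  ultimately show "\<bar>cycle_rate_sum K x - cycle_rate_sum K r\<bar> \<le> M" by linarith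
  have "\<bar>cycle_rate_slope K r\<bar> \<le> (\<Sum>k\<in>K. real k * q ^ (k - 1))"
  proof -
    have "cycle_rate_slope K r \<le> (\<Sum>k\<in>K. real k * q ^ (k - 1))" unfolding cycle_rate_slope_def
    proof (rule sum_mono)
      fix k assume k: "k \<in> K"
      have "r ^ (k - 1) / 2 \<le> q ^ (k - 1) / 2" using xr by (intro divide_right_mono power_mono) auto
      thus "r ^ (k - 1) / 2 \<le> real k * q ^ (k - 1)" using kk[OF k] by linarith
    qed
    moreover have "0 \<le> cycle_rate_slope K r" unfolding cycle_rate_slope_def using xr by (intro sum_nonneg) auto
    ultimately show ?thesis by simp
  qed
  thus "\<bar>cycle_rate_slope K r\<bar> \<le> M" using B(2) by linarith
  have eq: "cycle_rate_sum K x - cycle_rate_sum K r - cycle_rate_slope K r * (x - r) =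
      (\<Sum>k\<in>K. x ^ k / (2 * real k) - r ^ k / (2 * real k) - r ^ (k - 1) / 2 * (x - r))"
    unfolding cycle_rate_sum_def cycle_rate_slope_def sum_subtractf sum_distrib_right ..
  have "\<bar>cycle_rate_sum K x - cycle_rate_sum K r - cycle_rate_slope K r * (x - r)\<bar> \<le>
      (\<Sum>k\<in>K. \<bar>x ^ k / (2 * real k) - r ^ k / (2 * real k) - r ^ (k - 1) / 2 * (x - r)\<bar>)"
    unfolding eq by (rule sum_abs)
  also have "\<dots> \<le> (\<Sum>k\<in>K. real k * q ^ (k - 2) * (x - r) ^ 2)"
  proof (rule sum_mono)
    fix k assume k: "k \<in> K"
    have eqk: "x ^ k / (2 * real k) - r ^ k / (2 * real k) - r ^ (k - 1) / 2 * (x - r) =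
        (x ^ k - r ^ k - real k * r ^ (k - 1) * (x - r)) / (2 * real k)"
    proof -
      have "real k * r ^ (k - 1) * (x - r) / (2 * real k) = r ^ (k - 1) / 2 * (x - r)" using k3[OF k] by simp
      thus ?thesis by (simp only: diff_divide_distrib)
    qed
    have "\<bar>x ^ k / (2 * real k) - r ^ k / (2 * real k) - r ^ (k - 1) / 2 * (x - r)\<bar> \<le>
        (real k * (real k - 1) * q ^ (k - 2) * (x - r) ^ 2) / (2 * real k)"
    proof -
      have "\<bar>2 * real k\<bar> = 2 * real k" by simp
      thus ?thesis unfolding eqk abs_divide
        using divide_right_mono[OF abs_power_taylor_le[OF xr, of k], of "2 * real k"] by (simp only:)
    qed
    also have "\<dots> = ((real k - 1) / 2) * (q ^ (k - 2) * (x - r) ^ 2)" using k3[OF k] by simp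
    also have "\<dots> \<le> real k * (q ^ (k - 2) * (x - r) ^ 2)"
      using xr by (intro mult_right_mono) auto
    finally show "\<bar>x ^ k / (2 * real k) - r ^ k / (2 * real k) - r ^ (k - 1) / 2 * (x - r)\<bar> \<le>
       real k * q ^ (k - 2) * (x - r) ^ 2" by (simp add: mult.assoc)
  qed
  also have "\<dots> \<le> M * (x - r) ^ 2"
    unfolding sum_distrib_right[symmetric] by (intro mult_right_mono B) simp
  finally show "\<bar>cycle_rate_sum K x - cycle_rate_sum K r - cycle_rate_slope K r * (x - r)\<bar> \<le> M * (x - r) ^ 2" .
qed

section \<open>Stein's method for fixed weights\<close>

context graph_weights
begin

text \<open>\<open>\<xi>\<close> is a second test function that an added cycle leaves unchanged: 1
  for a single count, the indicator of prescribed other counts for the joint law. The conditional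
  Poisson parameter is \<open>cycle_rate_sum K R\<close> rather than \<open>l\<close>, and this
  discrepancy stays explicit.\<close>

lemma stein_step:
  fixes g h :: "nat \<Rightarrow> real" and l c b q M :: real and \<xi> :: "nat set set \<Rightarrow> real"
  assumes K: "K \<subseteq> {3..N}" and bd: "cycle_bound N K q M" and Rq: "R \<le> q"
    and g: "\<And>j. \<bar>g j\<bar> \<le> b" and eq: "\<And>j. l * g (Suc j) - real j * g j = h j - c"
    and \<xi>: "\<And>G. \<bar>\<xi> G\<bar> \<le> 1"
    and inv_step: "\<And>C G. C \<in> cycles (all_edges V) \<Longrightarrow> card C \<in> K \<Longrightarrow> G \<subseteq> all_edges V \<Longrightarrow>
        \<not> has_excursion N C G \<Longrightarrow> \<xi> (G \<union> C) = \<xi> G"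
  shows "\<bar>E (\<lambda>G. h (cycle_count G K) * \<xi> G) - c * E \<xi> -
      (l - cycle_rate_sum K R) * E (\<lambda>G. g (Suc (cycle_count G K)) * \<xi> G)\<bar> \<le> b * (M + M ^ 2) * eps"
proof -
  define \<phi> where "\<phi> G = g (cycle_count G K) * \<xi> G" for G
  define \<psi> where "\<psi> G = g (Suc (cycle_count G K)) * \<xi> G" for G
  have fK: "finite K" using K finite_subset by blast
  have K3: "K \<subseteq> {3..}" using K by auto
  have b0: "0 \<le> b" using g[of 0] by linarith
  have M1: "1 \<le> M" using bd by (simp add: cycle_bound_def)
  have pb: "\<bar>\<phi> G\<bar> \<le> b" "\<bar>\<psi> G\<bar> \<le> b" for G
    unfolding \<phi>_def \<psi>_def abs_mult using g \<xi>[of G] b0 mult_mono[OF g \<xi>[of G]] by auto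
  have step: "\<phi> (G \<union> C) = \<psi> G"
    if "C \<in> cycles (all_edges V)" "card C \<in> K" "G \<subseteq> all_edges V" "\<not> has_excursion N C G" for C G
  proof -
    have "finite G" using finite_subset[OF that(3) finite_all_edges[OF finite_V]] .
    moreover have "card C \<le> N" "K \<subseteq> {..N}" using K that(2) by auto
    ultimately have "cycle_count (G \<union> C) K = Suc (cycle_count G K)"
      using cycle_count_Un_cycle[OF that(1) _ that(4), of K] that(2) by simp
    thus ?thesis unfolding \<phi>_def \<psi>_def using inv_step[OF that] by simp
  qed
  have pow: "(\<Sum>l<N. R ^ l) \<le> M" "(\<Sum>k\<in>K. real k * R ^ (k - 1)) \<le> M"
    "(\<Sum>k\<in>K. real k * R ^ (k - 2) / 2 + R ^ (k - 1) / 2) \<le> M"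
  proof -
    have "(\<Sum>l<N. R ^ l) \<le> (\<Sum>l<N. q ^ l)" "(\<Sum>k\<in>K. real k * R ^ (k - 1)) \<le> (\<Sum>k\<in>K. real k * q ^ (k - 1))"
      "(\<Sum>k\<in>K. real k * R ^ (k - 2) / 2 + R ^ (k - 1) / 2) \<le> (\<Sum>k\<in>K. real k * q ^ (k - 2) / 2 + q ^ (k - 1) / 2)"
      using R_nonneg Rq by (auto intro!: sum_mono power_mono mult_left_mono add_mono)
    thus "(\<Sum>l<N. R ^ l) \<le> M" "(\<Sum>k\<in>K. real k * R ^ (k - 1)) \<le> M"
      "(\<Sum>k\<in>K. real k * R ^ (k - 2) / 2 + R ^ (k - 1) / 2) \<le> M"
      using bd unfolding cycle_bound_def by linarith+
  qed
  have "\<bar>E (\<lambda>G. real (cycle_count G K) * \<phi> G) - cycle_mean K * E \<psi>\<bar> \<le>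
     2 * b * (\<Sum>k\<in>K. \<Sum>C\<in>cycles_of_length V k. (\<Prod>e\<in>C. pe e) * E (\<lambda>G. of_bool (has_excursion N C G)))"
    by (rule stein_error[where \<phi> = \<phi> and \<psi> = \<psi> and N = N, OF fK]) (fact pb step)+
  also have "\<dots> \<le> 2 * b * (eps * (\<Sum>l<N. R ^ l) * (\<Sum>k\<in>K. real k * R ^ (k - 1)) / 2)"
    using b0 by (intro mult_left_mono sum_has_excursion K3) auto
  also have "\<dots> = b * eps * ((\<Sum>l<N. R ^ l) * (\<Sum>k\<in>K. real k * R ^ (k - 1)))" by simp
  also have "\<dots> \<le> b * eps * (M * M)"
    using b0 eps_nonneg R_nonneg M1 by (intro mult_left_mono mult_mono pow sum_nonneg) auto
  finally have e1: "\<bar>E (\<lambda>G. real (cycle_count G K) * \<phi> G) - cycle_mean K * E \<psi>\<bar> \<le> b * M ^ 2 * eps"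
    by (simp add: power2_eq_square mult_ac)
  have "\<bar>cycle_rate_sum K R - cycle_mean K\<bar> \<le> eps * (\<Sum>k\<in>K. real k * R ^ (k - 2) / 2 + R ^ (k - 1) / 2)"
    using cycle_mean_bounds[OF K3] unfolding cycle_rate_sum_def by linarith
  also have "\<dots> \<le> eps * M" using eps_nonneg pow(3) by (intro mult_left_mono)
  finally have e2: "\<bar>cycle_rate_sum K R - cycle_mean K\<bar> \<le> eps * M" .
  have "\<bar>E \<psi>\<bar> \<le> E (\<lambda>_. b)" by (rule expectation_abs_le) (rule pb)
  hence e3: "\<bar>E \<psi>\<bar> \<le> b" by simp
  have e4: "\<bar>(cycle_rate_sum K R - cycle_mean K) * E \<psi>\<bar> \<le> (eps * M) * b"
    unfolding abs_mult using e2 e3 eps_nonneg M1 by (intro mult_mono) auto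
  \<comment> \<open>Stein's equation at the cycle count, multiplied by
    \<open>\<xi> G\<close>.\<close>
  have "h (cycle_count G K) * \<xi> G - c * \<xi> G = l * \<psi> G - real (cycle_count G K) * \<phi> G" for G
    unfolding \<phi>_def \<psi>_def using arg_cong[OF eq[of "cycle_count G K"], of "\<lambda>x. x * \<xi> G"]
    by (simp add: algebra_simps)
  hence "E (\<lambda>G. h (cycle_count G K) * \<xi> G - c * \<xi> G) = E (\<lambda>G. l * \<psi> G - real (cycle_count G K) * \<phi> G)"
    by simp
  hence "E (\<lambda>G. h (cycle_count G K) * \<xi> G) - c * E \<xi> = l * E \<psi> - E (\<lambda>G. real (cycle_count G K) * \<phi> G)"
    by (simp add: integrable_P Bochner_Integration.integral_diff)
  hence "E (\<lambda>G. h (cycle_count G K) * \<xi> G) - c * E \<xi> - (l - cycle_rate_sum K R) * E \<psi> =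
     (cycle_rate_sum K R - cycle_mean K) * E \<psi> - (E (\<lambda>G. real (cycle_count G K) * \<phi> G) - cycle_mean K * E \<psi>)"
    by (simp add: algebra_simps)
  also have "\<bar>\<dots>\<bar> \<le> (eps * M) * b + b * M ^ 2 * eps" using e1 e4 by linarith
  finally show ?thesis unfolding \<psi>_def by (simp add: algebra_simps)
qed

text \<open>Stein's equation is used twice: for \<open>h\<close>, and for its own solution \<open>g\<close>. This replaces the
  random factor of \<open>l - cycle_rate_sum K R\<close> by the constant \<open>u0\<close>, so that only the square of the
  fluctuation of \<open>R\<close> remains.\<close>

lemma second_order_estimate:
  fixes g g' h :: "nat \<Rightarrow> real" and l c b q M r u0 :: real
  assumes K: "K \<subseteq> {3..N}" and bd: "cycle_bound N K q M" and Rq: "R \<le> q" and r: "0 \<le> r" "r \<le> q"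
    and l: "l = cycle_rate_sum K r" and b1: "1 \<le> b"
    and g: "\<And>j. \<bar>g j\<bar> \<le> b" and eq: "\<And>j. l * g (Suc j) - real j * g j = h j - c"
    and g': "\<And>j. \<bar>g' j\<bar> \<le> b" and eq': "\<And>j. l * g' (Suc j) - real j * g' j = g (Suc j) / b - u0 / b"
    and u0: "\<bar>u0\<bar> \<le> b"
  shows "\<bar>E (\<lambda>G. h (cycle_count G K)) - c + cycle_rate_slope K r * u0 * (R - r)\<bar> \<le>
      (b + b ^ 2 * M) * (M + M ^ 2) * (eps + (R - r) ^ 2)"
proof -
  have M1: "1 \<le> M" using bd by (simp add: cycle_bound_def)
  define f where "f = cycle_rate_sum K R"
  define u where "u = E (\<lambda>G. g (Suc (cycle_count G K)))"
  have K3: "K \<subseteq> {3..}" using K by auto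
  note B = cycle_rate_sum_bounds[OF K3 bd R_nonneg Rq r, folded f_def l]
  have 1: "\<bar>E (\<lambda>G. h (cycle_count G K)) - c - (l - f) * u\<bar> \<le> b * (M + M ^ 2) * eps"
    using stein_step[OF K bd Rq g eq, where \<xi> = "\<lambda>_. 1"] by (simp add: f_def u_def)
  \<comment> \<open>The test function is now \<open>g (Suc j) / b\<close>, scaled to be at most 1 so
    that \<open>stein_poisson_solution\<close> can provide \<open>g'\<close>.\<close>
  have "\<bar>u / b - u0 / b - (l - f) * E (\<lambda>G. g' (Suc (cycle_count G K)))\<bar> \<le> b * (M + M ^ 2) * eps"
    using stein_step[where g = g' and l = l and h = "\<lambda>j. g (Suc j) / b" and c = "u0 / b" and \<xi> = "\<lambda>_. 1",
        OF K bd Rq g' eq'] by (simp add: f_def u_def)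
  moreover have "\<bar>E (\<lambda>G. g' (Suc (cycle_count G K)))\<bar> \<le> E (\<lambda>_. b)"
    by (rule expectation_abs_le) (rule g')
  hence "\<bar>(l - f) * E (\<lambda>G. g' (Suc (cycle_count G K)))\<bar> \<le> \<bar>l - f\<bar> * b"
    unfolding abs_mult by (intro mult_left_mono) auto
  ultimately have "\<bar>u / b - u0 / b\<bar> \<le> \<bar>l - f\<bar> * b + b * (M + M ^ 2) * eps" by linarith
  hence "b * \<bar>u / b - u0 / b\<bar> \<le> b * (\<bar>l - f\<bar> * b + b * (M + M ^ 2) * eps)"
    using b1 by (intro mult_left_mono) auto
  moreover have "b * \<bar>u / b - u0 / b\<bar> = \<bar>u - u0\<bar>"
    using b1 by (simp add: diff_divide_distrib[symmetric] abs_divide)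
  ultimately have 2: "\<bar>u - u0\<bar> \<le> b ^ 2 * (\<bar>l - f\<bar> + (M + M ^ 2) * eps)"
    by (simp add: algebra_simps power2_eq_square)
  \<comment> \<open>Two bounds on the same factor: the Lipschitz one yields
    \<open>(R - r) ^ 2\<close>, the crude one is enough next to \<open>eps\<close>.\<close>
  have lf: "\<bar>l - f\<bar> \<le> M * \<bar>R - r\<bar>" "\<bar>l - f\<bar> \<le> M" using B(1,2) by (simp_all add: abs_minus_commute)
  have "\<bar>(l - f) * (u - u0)\<bar> \<le> \<bar>l - f\<bar> * (b ^ 2 * (\<bar>l - f\<bar> + (M + M ^ 2) * eps))"
    unfolding abs_mult using 2 by (intro mult_left_mono) auto
  also have "\<dots> = b ^ 2 * (\<bar>l - f\<bar> * \<bar>l - f\<bar> + \<bar>l - f\<bar> * ((M + M ^ 2) * eps))"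
    by (simp only: ring_distribs mult_ac)
  also have "\<dots> \<le> b ^ 2 * ((M * \<bar>R - r\<bar>) * (M * \<bar>R - r\<bar>) + M * ((M + M ^ 2) * eps))"
    using lf M1 eps_nonneg by (intro mult_left_mono add_mono mult_mono mult_right_mono) auto
  also have "\<dots> = b ^ 2 * M ^ 2 * (R - r) ^ 2 + b ^ 2 * M * (M + M ^ 2) * eps"
    by (simp add: algebra_simps power2_eq_square)
  finally have 3: "\<bar>(l - f) * (u - u0)\<bar> \<le> b ^ 2 * M ^ 2 * (R - r) ^ 2 + b ^ 2 * M * (M + M ^ 2) * eps" .
  have 4: "\<bar>u0 * (l - f + cycle_rate_slope K r * (R - r))\<bar> \<le> b * (M * (R - r) ^ 2)"
    unfolding abs_mult using B(3) u0 b1 by (intro mult_mono) auto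
  \<comment> \<open>The three summands are the error of Stein's identity, a product of two small
    factors, and the Taylor remainder of the Poisson rate.\<close>
  have "E (\<lambda>G. h (cycle_count G K)) - c + cycle_rate_slope K r * u0 * (R - r) =
     (E (\<lambda>G. h (cycle_count G K)) - c - (l - f) * u) + (l - f) * (u - u0) +
       u0 * (l - f + cycle_rate_slope K r * (R - r))"
    by (simp add: algebra_simps)
  also have "\<bar>\<dots>\<bar> \<le> b * (M + M ^ 2) * eps + (b ^ 2 * M ^ 2 * (R - r) ^ 2 + b ^ 2 * M * (M + M ^ 2) * eps) +
      b * (M * (R - r) ^ 2)"
    using 1 3 4 by linarith
  also have "\<dots> = (b + b ^ 2 * M) * (M + M ^ 2) * eps + (b * M + b ^ 2 * M ^ 2) * (R - r) ^ 2"
    by (simp add: algebra_simps)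
  also have "(b * M + b ^ 2 * M ^ 2) * (R - r) ^ 2 \<le> (b + b ^ 2 * M) * (M + M ^ 2) * (R - r) ^ 2"
  proof (intro mult_right_mono)
    have "0 \<le> b * M ^ 2 + b ^ 2 * M * M ^ 2" using b1 M1 by (intro add_nonneg_nonneg mult_nonneg_nonneg) auto
    thus "b * M + b ^ 2 * M ^ 2 \<le> (b + b ^ 2 * M) * (M + M ^ 2)" by (simp add: algebra_simps power2_eq_square)
  qed auto
  finally show ?thesis by (simp add: algebra_simps)
qed

section \<open>Deviations of the weight sums from their means\<close>

definition "dev1 m = L - real n * m"
definition "dev2 m = (\<Sum>x\<in>V. w x ^ 2) - real n * m"
definition "S4 = (\<Sum>x\<in>V. w x ^ 4)"

lemma R_eq: "R = (\<Sum>x\<in>V. w x ^ 2) / L"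
  by (simp add: R_def sum_divide_distrib)

lemma eps_eq: "eps = S4 / L ^ 2"
proof -
  have "(w x ^ 2 / L) ^ 2 = w x ^ 4 / L ^ 2" for x
    by (simp add: power_divide power_mult[symmetric])
  thus ?thesis by (simp add: eps_def S4_def sum_divide_distrib)
qed

text \<open>\<open>\<delta> \<le> m1 / 2\<close> keeps \<open>L\<close> above half its mean. The
  other bound on \<open>\<delta>\<close> is \<open>m2 + \<delta> \<le> q * (m1 - \<delta>)\<close>
  solved for \<open>\<delta>\<close>, so that the ratio \<open>R\<close> stays below
  \<open>q\<close>.\<close>

lemma concentration:
  fixes m1 m2 q \<delta> :: real
  assumes m: "0 < m1" "0 < m2" and rq: "m2 / m1 < q" "0 < \<delta>" "\<delta> \<le> m1 / 2" "\<delta> \<le> m1 * (q - m2 / m1) / (1 + q)"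
    and dev: "\<bar>dev1 m1\<bar> \<le> \<delta> * n" "\<bar>dev2 m2\<bar> \<le> \<delta> * n"
  shows "R \<le> q" "n * m1 / 2 \<le> L"
proof -
  have q0: "0 < q" using rq(1) m divide_pos_pos[of m2 m1] by linarith
  have "\<delta> * n \<le> m1 / 2 * n" using rq by (intro mult_right_mono) auto
  thus L: "n * m1 / 2 \<le> L" using dev(1) unfolding dev1_def by (simp add: mult.commute)
  have "\<delta> * (1 + q) \<le> m1 * (q - m2 / m1)" using rq(4) q0 by (simp add: pos_le_divide_eq)
  also have "\<dots> = q * m1 - m2" using m by (simp add: field_simps)
  finally have "(m2 + \<delta>) * n \<le> (q * (m1 - \<delta>)) * n"
    by (intro mult_right_mono) (auto simp: algebra_simps)
  moreover have "(\<Sum>x\<in>V. w x ^ 2) \<le> (m2 + \<delta>) * n" using dev(2) unfolding dev2_def by (simp add: algebra_simps)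
  moreover have "q * ((m1 - \<delta>) * n) \<le> q * L"
    using dev(1) q0 unfolding dev1_def by (intro mult_left_mono) (simp_all add: algebra_simps)
  ultimately have "(\<Sum>x\<in>V. w x ^ 2) \<le> q * L" by (simp add: mult.assoc)
  thus "R \<le> q" unfolding R_eq using L_pos by (simp add: pos_divide_le_eq)
qed

text \<open>After linearisation the estimate holds for all weights: outside the event that \<open>dev1\<close> and
  \<open>dev2\<close> are small, their squares dominate the left-hand side.\<close>

lemma linearized_estimate:
  fixes m1 m2 q \<delta> D \<kappa> c Kp :: real
  defines "r \<equiv> m2 / m1"
  assumes m: "0 < m1" "0 < m2" and rq: "r < q" "0 < \<delta>" "\<delta> \<le> m1 / 2" "\<delta> \<le> m1 * (q - r) / (1 + q)"
    and est: "R \<le> q \<Longrightarrow> \<bar>p - c + \<kappa> * (R - r)\<bar> \<le> D * (eps + (R - r) ^ 2)"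
    and p: "\<bar>p - c\<bar> \<le> 2" and D: "0 \<le> D" and \<kappa>: "\<bar>\<kappa>\<bar> \<le> Kp"
  shows "\<bar>p - c + \<kappa> * ((dev2 m2 - r * dev1 m1) / (n * m1))\<bar> \<le>
     (D * (4 + 8 * (1 + r) ^ 2) / m1 ^ 2 + Kp * (2 * (1 + r)) / m1 ^ 2 + 2 / \<delta> ^ 2 +
       Kp / m1 * (1 / \<delta> ^ 2 + 2 * (1 + r) ^ 2)) * ((dev1 m1 ^ 2 + dev2 m2 ^ 2 + S4) / real n ^ 2)"
    (is "_ \<le> (?A + ?B + ?F + ?H) * (_ / _)")
proof -
  define v1 v2 z where "v1 = dev1 m1" and "v2 = dev2 m2" and "z = v2 - r * v1"
  define U where "U = v1 ^ 2 + v2 ^ 2 + S4"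
  have r0: "0 < r" using m by (simp add: r_def)
  have Kp0: "0 \<le> Kp" using \<kappa> by linarith
  have n0: "0 < real n" using n by simp
  have S40: "0 \<le> S4" unfolding S4_def by (intro sum_nonneg) (simp add: zero_le_even_power)
  have v12: "v1 ^ 2 \<le> U" "v2 ^ 2 \<le> U" "v1 ^ 2 + v2 ^ 2 \<le> U" "S4 \<le> U" "0 \<le> U" using S40 by (auto simp: U_def)
  have ab: "2 * (\<bar>a\<bar> * \<bar>b\<bar>) \<le> a ^ 2 + b ^ 2" for a b :: real
    using sum_squares_bound[of "\<bar>a\<bar>" "\<bar>b\<bar>"] by simp
  have zv1: "\<bar>z\<bar> * \<bar>v1\<bar> \<le> (1 + r) * U"
  proof -
    have "\<bar>z\<bar> * \<bar>v1\<bar> \<le> (\<bar>v2\<bar> + r * \<bar>v1\<bar>) * \<bar>v1\<bar>"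
      using r0 abs_triangle_ineq4[of v2 "r * v1"] by (intro mult_right_mono) (auto simp: z_def abs_mult)
    also have "\<dots> = \<bar>v2\<bar> * \<bar>v1\<bar> + r * v1 ^ 2" by (simp add: algebra_simps power2_eq_square)
    also have "\<dots> \<le> U + r * U"
    proof (intro add_mono mult_left_mono)
      show "\<bar>v2\<bar> * \<bar>v1\<bar> \<le> U" using ab[of v2 v1] v12(3) zero_le_power2[of v1] zero_le_power2[of v2] by linarith
    qed (use v12 r0 in auto)
    finally show ?thesis by (simp add: algebra_simps)
  qed
  have zz: "z ^ 2 \<le> 2 * (1 + r) ^ 2 * U"
  proof -
    have "z ^ 2 = v2 ^ 2 - r * (2 * (v1 * v2)) + r ^ 2 * v1 ^ 2"
      by (simp add: z_def algebra_simps power2_eq_square)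
    also have "\<dots> \<le> v2 ^ 2 + r * (v1 ^ 2 + v2 ^ 2) + r ^ 2 * v1 ^ 2"
    proof -
      have "- (2 * (v1 * v2)) \<le> v1 ^ 2 + v2 ^ 2"
        using zero_le_power2[of "v1 + v2"] by (simp add: power2_eq_square algebra_simps)
      hence "r * (- (2 * (v1 * v2))) \<le> r * (v1 ^ 2 + v2 ^ 2)" using r0 by (intro mult_left_mono) auto
      thus ?thesis by simp
    qed
    also have "\<dots> \<le> U + r * U + r ^ 2 * U"
      using v12 r0 by (intro add_mono mult_left_mono) auto
    also have "\<dots> \<le> 2 * (1 + r) ^ 2 * U"
    proof -
      have "0 \<le> (1 + 3 * r + r ^ 2) * U" using r0 v12 by (intro mult_nonneg_nonneg) auto
      thus ?thesis by (simp add: algebra_simps power2_eq_square)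
    qed
    finally show ?thesis .
  qed
  \<comment> \<open>\<open>?A\<close> and \<open>?B\<close> serve on the event of small deviations:
    \<open>?A\<close> for the estimate \<open>est\<close>, \<open>?B\<close> for replacing
    \<open>L\<close> by \<open>n * m1\<close>. Off this event \<open>?F\<close> and
    \<open>?H\<close> absorb the trivial bounds.\<close>
  have A0: "0 \<le> ?A" "0 \<le> ?B" "0 \<le> ?F" "0 \<le> ?H" using D Kp0 r0 m rq by auto
  have Un: "0 \<le> U / n ^ 2" using v12 by simp
  have "\<bar>p - c + \<kappa> * (z / (n * m1))\<bar> \<le> (?A + ?B + ?F + ?H) * (U / n ^ 2)"
  proof (cases "\<bar>v1\<bar> \<le> \<delta> * n \<and> \<bar>v2\<bar> \<le> \<delta> * n")
    case True
    note conc = concentration[OF m rq[unfolded r_def], folded v1_def v2_def, OF conjunct1[OF True] conjunct2[OF True]]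
    have nm: "0 < n * m1 / 2" using m n0 by simp
    have Rr: "R - r = z / L"
      using L_pos m unfolding R_eq z_def v1_def v2_def dev1_def dev2_def r_def by (simp add: field_simps)
    have L2: "(n * m1 / 2) ^ 2 \<le> L ^ 2" using conc nm by (intro power_mono) auto
    have nm2: "1 / (n * m1 / 2) ^ 2 = 4 / m1 ^ 2 * (1 / n ^ 2)" using n0 m by (simp add: field_simps power2_eq_square)
    have divL: "x / L ^ 2 \<le> 4 / m1 ^ 2 * (y / n ^ 2)" if "0 \<le> x" "x \<le> y" for x y
    proof -
      have "x / L ^ 2 \<le> y / (n * m1 / 2) ^ 2" using that L2 nm by (intro frac_le zero_less_power) auto
      also have "\<dots> = y * (1 / (n * m1 / 2) ^ 2)" by simp
      also have "\<dots> = 4 / m1 ^ 2 * (y / n ^ 2)" unfolding nm2 by simp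
      finally show ?thesis .
    qed
    have e1: "eps \<le> 4 / m1 ^ 2 * (U / n ^ 2)" unfolding eps_eq by (rule divL[OF S40 v12(4)])
    have "(R - r) ^ 2 \<le> 4 / m1 ^ 2 * ((2 * (1 + r) ^ 2 * U) / n ^ 2)"
      unfolding Rr power_divide by (rule divL[OF _ zz]) simp
    hence e2: "(R - r) ^ 2 \<le> 8 * (1 + r) ^ 2 / m1 ^ 2 * (U / n ^ 2)" by simp
    \<comment> \<open>\<open>R - r\<close> is exactly \<open>z / L\<close>; exchanging the random
      \<open>L\<close> for its mean leaves the product of \<open>z\<close> with the deviation
      \<open>v1\<close>, which is quadratic.\<close>
    have "\<bar>R - r - z / (n * m1)\<bar> = (\<bar>z\<bar> * \<bar>v1\<bar>) / (L * (n * m1))"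
    proof -
      have "R - r - z / (n * m1) = - (z * v1) / (L * (n * m1))"
        unfolding Rr using L_pos n0 m by (simp add: v1_def dev1_def field_simps)
      thus ?thesis using L_pos n0 m by (simp add: abs_mult abs_divide)
    qed
    also have "\<dots> \<le> ((1 + r) * U) / ((n * m1 / 2) * (n * m1))"
      using zv1 conc nm n0 m r0 v12 by (intro frac_le mult_right_mono) auto
    also have "\<dots> = (2 * (1 + r)) / m1 ^ 2 * (U / n ^ 2)" using n0 m by (simp add: field_simps power2_eq_square)
    finally have e3: "\<bar>R - r - z / (n * m1)\<bar> \<le> (2 * (1 + r)) / m1 ^ 2 * (U / n ^ 2)" .
    have "D * (eps + (R - r) ^ 2) \<le> D * (4 / m1 ^ 2 * (U / n ^ 2) + 8 * (1 + r) ^ 2 / m1 ^ 2 * (U / n ^ 2))"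
      using D e1 e2 by (intro mult_left_mono add_mono) auto
    also have "\<dots> = ?A * (U / n ^ 2)" by (simp add: algebra_simps add_divide_distrib)
    finally have f1: "\<bar>p - c + \<kappa> * (R - r)\<bar> \<le> ?A * (U / n ^ 2)" using est[OF conc(1)] by linarith
    have "\<bar>\<kappa> * (R - r - z / (n * m1))\<bar> \<le> Kp * ((2 * (1 + r)) / m1 ^ 2 * (U / n ^ 2))"
      unfolding abs_mult using \<kappa> e3 Kp0 by (intro mult_mono) auto
    hence f2: "\<bar>\<kappa> * (R - r - z / (n * m1))\<bar> \<le> ?B * (U / n ^ 2)" by simp
    have "p - c + \<kappa> * (z / (n * m1)) = (p - c + \<kappa> * (R - r)) - \<kappa> * (R - r - z / (n * m1))"
      by (simp add: algebra_simps)
    hence "\<bar>p - c + \<kappa> * (z / (n * m1))\<bar> \<le> (?A + ?B) * (U / n ^ 2)"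
      using f1 f2 unfolding distrib_right by linarith
    also have "\<dots> \<le> (?A + ?B + ?F + ?H) * (U / n ^ 2)"
      using A0 Un by (intro mult_right_mono) auto
    finally show ?thesis .
  next
    case False
    have "(\<delta> * n) ^ 2 \<le> U"
    proof -
      have "(\<delta> * n) ^ 2 \<le> x ^ 2" if "\<not> \<bar>x\<bar> \<le> \<delta> * n" for x
        using that rq n0 power_mono[of "\<delta> * n" "\<bar>x\<bar>" 2] by auto
      thus ?thesis using False v12(1,2) by (meson order_trans)
    qed
    \<comment> \<open>A large deviation makes \<open>U\<close> at least
      \<open>(\<delta> * n) ^ 2\<close>, so constants can be charged to the quadratic term.\<close>
    hence one: "1 \<le> 1 / \<delta> ^ 2 * (U / n ^ 2)" using rq n0 by (simp add: field_simps)
    have "\<bar>z\<bar> / n \<le> 1 + (z / n) ^ 2"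
    proof -
      have "2 * \<bar>z / n\<bar> \<le> 1 + (z / n) ^ 2" using ab[of 1 "z / n"] by simp
      moreover have "\<bar>z / n\<bar> = \<bar>z\<bar> / n" by simp
      ultimately show ?thesis using abs_ge_zero[of "z / n"] by linarith
    qed
    also have "\<dots> \<le> 1 / \<delta> ^ 2 * (U / n ^ 2) + 2 * (1 + r) ^ 2 * (U / n ^ 2)"
    proof (rule add_mono[OF one])
      show "(z / n) ^ 2 \<le> 2 * (1 + r) ^ 2 * (U / n ^ 2)"
        using divide_right_mono[OF zz, of "real n ^ 2"] by (simp add: power_divide)
    qed
    finally have z1: "\<bar>z\<bar> / n \<le> (1 / \<delta> ^ 2 + 2 * (1 + r) ^ 2) * (U / n ^ 2)" by (simp add: algebra_simps)
    have "\<bar>\<kappa> * (z / (n * m1))\<bar> = \<bar>\<kappa>\<bar> / m1 * (\<bar>z\<bar> / n)"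
      using m n0 by (simp add: abs_mult abs_divide)
    also have "\<dots> \<le> Kp / m1 * ((1 / \<delta> ^ 2 + 2 * (1 + r) ^ 2) * (U / n ^ 2))"
      using \<kappa> m z1 Kp0 n0 by (intro mult_mono divide_right_mono) auto
    finally have "\<bar>\<kappa> * (z / (n * m1))\<bar> \<le> ?H * (U / n ^ 2)" by (simp add: mult.assoc)
    moreover have "\<bar>p - c\<bar> \<le> ?F * (U / n ^ 2)" using p one by simp
    ultimately have "\<bar>p - c + \<kappa> * (z / (n * m1))\<bar> \<le> (?F + ?H) * (U / n ^ 2)"
      unfolding distrib_right by linarith
    also have "\<dots> \<le> (?A + ?B + ?F + ?H) * (U / n ^ 2)"
      using A0 Un by (intro mult_right_mono) auto
    finally show ?thesis .
  qed
  thus ?thesis by (simp add: z_def U_def v1_def v2_def)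
qed

end

section \<open>Independent weights\<close>

declare One_nat_def [simp del] \<comment> \<open>otherwise simplified goals mention \<open>{Suc 0..n}\<close> and miss the facts about \<open>{1..n}\<close>\<close>

locale weight_law = prob_space \<mu> for \<mu> :: "real measure" +
  assumes sets_mu: "sets \<mu> = sets borel" and pos: "AE x in \<mu>. 0 < x"
begin

sublocale prod: product_sigma_finite "\<lambda>_::nat. \<mu>"
  by standard

abbreviation "PW n \<equiv> \<Pi>\<^sub>M i\<in>{1..n::nat}. \<mu>"

lemma prob_space_PW: "prob_space (PW n)"
  by (intro prob_space_PiM prob_space_axioms)

lemma AE_pos: "AE w in PW n. \<forall>i\<in>{1..n}. 0 < w i"
  by (intro AE_finite_allI AE_PiM_component pos prob_space_axioms) auto

lemma measurable_component:
  assumes "i \<in> {1..n}" shows "(\<lambda>w. w i) \<in> measurable (PW n) \<mu>"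
  using assms by (rule measurable_component_singleton)

lemma measurable_comp:
  assumes "i \<in> {1..n}" "g \<in> borel_measurable \<mu>"
  shows "(\<lambda>w. g (w i)) \<in> borel_measurable (PW n)"
  by (rule measurable_compose[OF measurable_component[OF assms(1)] assms(2)])

lemma distr_component:
  assumes "i \<in> {1..n}" shows "distr (PW n) \<mu> (\<lambda>w. w i) = \<mu>"
  using assms by (intro distr_PiM_component prob_space_axioms) auto

lemma component_integral:
  fixes g :: "real \<Rightarrow> real"
  assumes i: "i \<in> {1..n}" and g: "integrable \<mu> g"
  shows "integrable (PW n) (\<lambda>w. g (w i))" "(\<integral>w. g (w i) \<partial>PW n) = (\<integral>x. g x \<partial>\<mu>)"
proof -
  have m: "g \<in> borel_measurable \<mu>" using g by simp
  have "integrable (distr (PW n) \<mu> (\<lambda>w. w i)) g" unfolding distr_component[OF i] by (rule g)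
  thus "integrable (PW n) (\<lambda>w. g (w i))"
    by (subst (asm) integrable_distr_eq[OF measurable_component[OF i] m])
  have "(\<integral>x. g x \<partial>\<mu>) = (\<integral>x. g x \<partial>distr (PW n) \<mu> (\<lambda>w. w i))" unfolding distr_component[OF i] ..
  thus "(\<integral>w. g (w i) \<partial>PW n) = (\<integral>x. g x \<partial>\<mu>)"
    by (subst (asm) integral_distr[OF measurable_component[OF i] m]) simp
qed

lemma sum_integral:
  fixes g :: "real \<Rightarrow> real"
  assumes g: "integrable \<mu> g"
  shows "integrable (PW n) (\<lambda>w. \<Sum>i=1..n. g (w i))"
    "(\<integral>w. (\<Sum>i=1..n. g (w i)) \<partial>PW n) = n * (\<integral>x. g x \<partial>\<mu>)"
proof -
  note c = component_integral[OF _ g]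
  show "integrable (PW n) (\<lambda>w. \<Sum>i=1..n. g (w i))" by (intro Bochner_Integration.integrable_sum c) simp
  have "(\<integral>w. (\<Sum>i=1..n. g (w i)) \<partial>PW n) = (\<Sum>i=1..n. \<integral>w. g (w i) \<partial>PW n)"
    by (intro Bochner_Integration.integral_sum c) simp
  also have "\<dots> = (\<Sum>i=1..n. \<integral>x. g x \<partial>\<mu>)" by (intro sum.cong refl c) simp
  finally show "(\<integral>w. (\<Sum>i=1..n. g (w i)) \<partial>PW n) = n * (\<integral>x. g x \<partial>\<mu>)" by simp
qed

lemma prod_integral:
  fixes g :: "nat \<Rightarrow> real \<Rightarrow> real"
  assumes g: "\<And>i. i \<in> S \<Longrightarrow> integrable \<mu> (g i)" and S: "S \<subseteq> {1..n}"
  shows "integrable (PW n) (\<lambda>w. \<Prod>i\<in>S. g i (w i))"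
    "(\<integral>w. (\<Prod>i\<in>S. g i (w i)) \<partial>PW n) = (\<Prod>i\<in>S. \<integral>x. g i x \<partial>\<mu>)"
proof -
  \<comment> \<open>Coordinates outside \<open>S\<close> carry the constant 1, which turns the
    product into one over the full index set.\<close>
  define h where "h i = (if i \<in> S then g i else (\<lambda>_. 1))" for i
  have fS: "finite S" using finite_subset[OF S] by simp
  have h: "integrable \<mu> (h i)" for i
  proof (cases "i \<in> S")
    case True
    hence "h i = g i" by (auto simp: h_def)
    thus ?thesis using g[OF True] by simp
  next
    case False
    hence "h i = (\<lambda>_. 1)" by (auto simp: h_def)
    thus ?thesis by simp
  qed
  have eq: "(\<Prod>i\<in>S. g i (w i)) = (\<Prod>i\<in>{1..n}. h i (w i))" for w
    using S by (intro prod.mono_neutral_cong_left) (auto simp: h_def)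
  show "integrable (PW n) (\<lambda>w. \<Prod>i\<in>S. g i (w i))"
    unfolding eq by (intro prod.product_integrable_prod h) simp
  have "(\<integral>w. (\<Prod>i\<in>S. g i (w i)) \<partial>PW n) = (\<Prod>i\<in>{1..n}. integral\<^sup>L \<mu> (h i))"
    unfolding eq by (intro prod.product_integral_prod h) simp
  also have "\<dots> = (\<Prod>i\<in>S. \<integral>x. g i x \<partial>\<mu>)"
    using S by (intro prod.mono_neutral_cong_right) (auto simp: h_def prob_space)
  finally show "(\<integral>w. (\<Prod>i\<in>S. g i (w i)) \<partial>PW n) = (\<Prod>i\<in>S. \<integral>x. g i x \<partial>\<mu>)" .
qed

lemma centered_sum_square:
  fixes g :: "real \<Rightarrow> real"
  assumes g: "integrable \<mu> g" "(\<integral>x. g x \<partial>\<mu>) = 0" and g2: "integrable \<mu> (\<lambda>x. g x ^ 2)"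
  shows "integrable (PW n) (\<lambda>w. (\<Sum>i=1..n. g (w i)) ^ 2)"
    "(\<integral>w. (\<Sum>i=1..n. g (w i)) ^ 2 \<partial>PW n) = n * (\<integral>x. g x ^ 2 \<partial>\<mu>)"
proof -
  have eq: "(\<Sum>i=1..n. g (w i)) ^ 2 = (\<Sum>i=1..n. \<Sum>j=1..n. g (w i) * g (w j))" for w :: "nat \<Rightarrow> real"
    by (simp add: power2_eq_square sum_product)
  have c: "integrable (PW n) (\<lambda>w. g (w i) * g (w j)) \<and>
      (\<integral>w. g (w i) * g (w j) \<partial>PW n) = (if i = j then (\<integral>x. g x ^ 2 \<partial>\<mu>) else 0)"
    if "i \<in> {1..n}" "j \<in> {1..n}" for i j
  proof (cases "i = j")
    case True
    thus ?thesis using component_integral[OF that(1) g2] by (simp add: power2_eq_square)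
  next
    case False
    thus ?thesis using prod_integral[of "{i, j}" "\<lambda>_. g" n] that g by simp
  qed
  show "integrable (PW n) (\<lambda>w. (\<Sum>i=1..n. g (w i)) ^ 2)"
    unfolding eq using c by (intro Bochner_Integration.integrable_sum) blast
  have "(\<integral>w. (\<Sum>i=1..n. g (w i)) ^ 2 \<partial>PW n) = (\<Sum>i=1..n. \<Sum>j=1..n. \<integral>w. g (w i) * g (w j) \<partial>PW n)"
    unfolding eq using c
    by (subst Bochner_Integration.integral_sum)
       (auto intro!: Bochner_Integration.integrable_sum sum.cong Bochner_Integration.integral_sum)
  also have "\<dots> = (\<Sum>i=1..n. \<Sum>j=1..n. if i = j then (\<integral>x. g x ^ 2 \<partial>\<mu>) else 0)"
    using c by (intro sum.cong refl) blast
  also have "\<dots> = n * (\<integral>x. g x ^ 2 \<partial>\<mu>)" by simp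
  finally show "(\<integral>w. (\<Sum>i=1..n. g (w i)) ^ 2 \<partial>PW n) = n * (\<integral>x. g x ^ 2 \<partial>\<mu>)" .
qed

lemma integrable_power_le:
  assumes "integrable \<mu> (\<lambda>x. x ^ l)" "k \<le> l"
  shows "integrable \<mu> (\<lambda>x. x ^ k)"
proof (rule Bochner_Integration.integrable_bound)
  show "integrable \<mu> (\<lambda>x. 1 + x ^ l)" using assms(1) by simp
  show "(\<lambda>x. x ^ k) \<in> borel_measurable \<mu>" by (simp add: measurable_cong_sets[OF sets_mu refl])
  show "AE x in \<mu>. norm (x ^ k) \<le> norm (1 + x ^ l)"
    using pos
  proof eventually_elim
    fix x :: real assume x: "0 < x"
    have "x ^ k \<le> 1 + x ^ l"
    proof (cases "x \<le> 1")
      case True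
      hence "x ^ k \<le> 1" using x by (intro power_le_one) auto
      thus ?thesis using x zero_le_power[of x l] by linarith
    next
      case False
      hence "x ^ k \<le> x ^ l" using assms(2) by (intro power_increasing) auto
      thus ?thesis by simp
    qed
    thus "norm (x ^ k) \<le> norm (1 + x ^ l)" using x by simp
  qed
qed

lemma moment_pos:
  assumes "integrable \<mu> (\<lambda>x. x ^ k)" shows "0 < (\<integral>x. x ^ k \<partial>\<mu>)"
proof -
  have nn: "AE x in \<mu>. 0 \<le> x ^ k" using pos by eventually_elim simp
  have "0 \<le> (\<integral>x. x ^ k \<partial>\<mu>)" by (rule integral_nonneg_AE[OF nn])
  moreover have "(\<integral>x. x ^ k \<partial>\<mu>) \<noteq> 0"
  proof
    assume "(\<integral>x. x ^ k \<partial>\<mu>) = 0"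
    hence "AE x in \<mu>. x ^ k = 0" using integral_nonneg_eq_0_iff_AE[OF assms nn] by simp
    hence "AE x in \<mu>. False" using pos by eventually_elim simp
    thus False by simp
  qed
  ultimately show ?thesis by linarith
qed

text \<open>No variance is available, so \<open>g\<close> is truncated at a level \<open>K\<close>
  and only the truncated sum is squared. A single majorant collects all error terms, and Markov's
  inequality is applied to it once.\<close>

lemma weak_law:
  fixes g :: "real \<Rightarrow> real" and \<delta> :: real
  assumes g: "integrable \<mu> g" and \<delta>: "0 < \<delta>"
  shows "(\<lambda>n. measure (PW n) {w \<in> space (PW n). \<delta> * n < \<bar>\<Sum>i=1..n. g (w i) - (\<integral>x. g x \<partial>\<mu>)\<bar>}) \<longlonglongrightarrow> 0"
proof (rule LIMSEQ_I)
  fix e :: real assume e: "0 < e"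
  define m where "m = (\<integral>x. g x \<partial>\<mu>)"
  define t where "t K x = max (- real K) (min (real K) (g x))" for K x
  have gm[measurable]: "g \<in> borel_measurable \<mu>" using g by simp
  have tm[measurable]: "t K \<in> borel_measurable \<mu>" for K unfolding t_def by measurable
  have "(\<lambda>K. \<integral>x. \<bar>g x - t K x\<bar> \<partial>\<mu>) \<longlonglongrightarrow> (\<integral>x. 0 \<partial>\<mu>)"
  proof (rule integral_dominated_convergence[where w = "\<lambda>x. \<bar>g x\<bar>"])
    show "AE x in \<mu>. (\<lambda>K. \<bar>g x - t K x\<bar>) \<longlonglongrightarrow> 0"
    proof (rule AE_I2)
      fix x
      have "eventually (\<lambda>K. \<bar>g x - t K x\<bar> = 0) sequentially"
      proof (rule eventually_sequentiallyI[of "nat \<lceil>\<bar>g x\<bar>\<rceil>"])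
        fix K assume "nat \<lceil>\<bar>g x\<bar>\<rceil> \<le> K"
        hence "\<bar>g x\<bar> \<le> real K" by linarith
        thus "\<bar>g x - t K x\<bar> = 0" by (auto simp: t_def)
      qed
      thus "(\<lambda>K. \<bar>g x - t K x\<bar>) \<longlonglongrightarrow> 0" by (rule tendsto_eventually)
    qed
    show "AE x in \<mu>. norm \<bar>g x - t K x\<bar> \<le> \<bar>g x\<bar>" for K
      by (rule AE_I2) (auto simp: t_def)
    show "integrable \<mu> (\<lambda>x. \<bar>g x\<bar>)" using g by (rule integrable_abs)
  qed simp_all
  hence "(\<lambda>K. \<integral>x. \<bar>g x - t K x\<bar> \<partial>\<mu>) \<longlonglongrightarrow> 0" by simp
  hence "eventually (\<lambda>K. (\<integral>x. \<bar>g x - t K x\<bar> \<partial>\<mu>) < e * \<delta> / 8) sequentially"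
    using e \<delta> by (intro order_tendstoD) auto
  then obtain K where K: "(\<integral>x. \<bar>g x - t K x\<bar> \<partial>\<mu>) < e * \<delta> / 8" by (auto simp: eventually_sequentially)
  have tK: "\<bar>t K x\<bar> \<le> K" for x by (auto simp: t_def)
  have ti: "integrable \<mu> (t K)"
    by (rule integrable_const_bound[of _ K]) (use tK in auto)
  define mt where "mt = (\<integral>x. t K x \<partial>\<mu>)"
  have mt: "\<bar>m - mt\<bar> \<le> (\<integral>x. \<bar>g x - t K x\<bar> \<partial>\<mu>)"
  proof -
    have "m - mt = (\<integral>x. g x - t K x \<partial>\<mu>)" unfolding m_def mt_def using g ti by simp
    thus ?thesis by (simp only: integral_abs_bound)
  qed
  define s where "s x = t K x - mt" for x
  have mtK: "\<bar>mt\<bar> \<le> K"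
  proof -
    have "\<bar>mt\<bar> \<le> (\<integral>x. \<bar>t K x\<bar> \<partial>\<mu>)" unfolding mt_def by (rule integral_abs_bound)
    also have "\<dots> \<le> (\<integral>x. K \<partial>\<mu>)" using ti tK by (intro integral_mono) auto
    finally show ?thesis by (simp add: prob_space)
  qed
  have sb: "s x ^ 2 \<le> (2 * real K) ^ 2" for x
    using tK[of x] mtK unfolding s_def by (intro abs_le_square_iff[THEN iffD1]) linarith
  have si: "integrable \<mu> s" "(\<integral>x. s x \<partial>\<mu>) = 0"
    unfolding s_def using ti by (simp_all add: mt_def prob_space)
  have sm[measurable]: "s \<in> borel_measurable \<mu>" using si(1) by simp
  have s2: "integrable \<mu> (\<lambda>x. s x ^ 2)"
    by (rule integrable_const_bound[of _ "(2 * real K) ^ 2"]) (use sb in auto)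
  have s2': "(\<integral>x. s x ^ 2 \<partial>\<mu>) \<le> (2 * real K) ^ 2"
  proof -
    have "(\<integral>x. s x ^ 2 \<partial>\<mu>) \<le> (\<integral>x. (2 * real K) ^ 2 \<partial>\<mu>)" using s2 sb by (intro integral_mono) auto
    thus ?thesis by (simp add: prob_space)
  qed
  define \<eta> where "\<eta> = e * \<delta> / 8"
  have \<eta>: "0 < \<eta>" using e \<delta> by (simp add: \<eta>_def)
  have bound: "measure (PW n) {w \<in> space (PW n). \<delta> * n < \<bar>\<Sum>i=1..n. g (w i) - m\<bar>} \<le>
      3 * e / 8 + (2 * real K) ^ 2 / (\<eta> * \<delta> * n)" if n: "0 < n" for n :: nat
  proof -
    interpret P: prob_space "PW n" by (rule prob_space_PW)
    let ?A = "\<lambda>w. \<Sum>i=1..n. \<bar>g (w i) - t K (w i)\<bar>"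
    let ?B = "\<lambda>w. \<Sum>i=1..n. s (w i)"
    \<comment> \<open>Truncation error, then \<open>\<eta> * n + B ^ 2 / (\<eta> * n)\<close> as a
      bound for the centred truncated sum \<open>B\<close>, then the bias of the truncated mean. The
      expectation is at most \<open>3 * \<eta> * n\<close> plus a constant, which after division by
      \<open>\<delta> * n\<close> leaves \<open>3 * e / 8\<close> in the limit.\<close>
    let ?X = "\<lambda>w. ?A w + \<eta> * n + ?B w ^ 2 / (\<eta> * n) + n * \<eta>"
    have gt: "integrable \<mu> (\<lambda>x. \<bar>g x - t K x\<bar>)" using g ti by auto
    note A = sum_integral[OF gt, of n]
    note B = centered_sum_square[OF si s2, of n]
    have Xi: "integrable (PW n) ?X"
      by (intro Bochner_Integration.integrable_add integrable_divide P.integrable_const A(1) B(1))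
    have "measure (PW n) {w \<in> space (PW n). \<delta> * n \<le> ?X w} \<le> (\<integral>w. ?X w \<partial>PW n) / (\<delta> * n)"
    proof (rule integral_Markov_inequality_measure[where A = "{}"])
      show "AE w in PW n. 0 \<le> ?X w" using \<eta> by (intro AE_I2 add_nonneg_nonneg sum_nonneg) auto
    qed (use Xi \<delta> n in auto)
    moreover have "(\<integral>w. ?X w \<partial>PW n) = n * (\<integral>x. \<bar>g x - t K x\<bar> \<partial>\<mu>) + \<eta> * n + n * (\<integral>x. s x ^ 2 \<partial>\<mu>) / (\<eta> * n) + n * \<eta>"
      using A B by (simp add: P.prob_space)
    moreover have "\<dots> \<le> n * \<eta> + \<eta> * n + n * (2 * real K) ^ 2 / (\<eta> * n) + n * \<eta>"
      using K s2' \<eta> n unfolding \<eta>_def[symmetric]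
      by (intro add_mono mult_left_mono divide_right_mono) auto
    ultimately have "measure (PW n) {w \<in> space (PW n). \<delta> * n \<le> ?X w} \<le>
        (3 * (n * \<eta>) + (2 * real K) ^ 2 / \<eta>) / (\<delta> * n)"
      using n \<delta> by (elim order_trans, intro divide_right_mono) auto
    also have "\<dots> = 3 * (\<eta> / \<delta>) + (2 * real K) ^ 2 / (\<eta> * \<delta> * n)"
      using n \<delta> \<eta> by (simp add: field_simps)
    also have "\<eta> / \<delta> = e / 8" using \<delta> by (simp add: \<eta>_def)
    finally have 1: "measure (PW n) {w \<in> space (PW n). \<delta> * n \<le> ?X w} \<le>
        3 * (e / 8) + (2 * real K) ^ 2 / (\<eta> * \<delta> * n)" .
    have "measure (PW n) {w \<in> space (PW n). \<delta> * n < \<bar>\<Sum>i=1..n. g (w i) - m\<bar>} \<le>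
        measure (PW n) {w \<in> space (PW n). \<delta> * n \<le> ?X w}"
    proof (rule P.finite_measure_mono)
      show "{w \<in> space (PW n). \<delta> * n < \<bar>\<Sum>i=1..n. g (w i) - m\<bar>} \<subseteq> {w \<in> space (PW n). \<delta> * n \<le> ?X w}"
      proof safe
        fix w assume *: "\<delta> * n < \<bar>\<Sum>i=1..n. g (w i) - m\<bar>"
        have "(\<Sum>i=1..n. g (w i) - m) = (\<Sum>i=1..n. g (w i) - t K (w i)) + ?B w + n * (mt - m)"
          unfolding s_def by (simp add: sum_subtractf sum.distrib algebra_simps)
        moreover have "\<bar>\<Sum>i=1..n. g (w i) - t K (w i)\<bar> \<le> ?A w" by (rule sum_abs)
        moreover have "\<bar>n * (mt - m)\<bar> \<le> n * \<eta>"
          unfolding abs_mult using mt K by (intro mult_mono) (auto simp: \<eta>_def abs_minus_commute[of mt m])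
        moreover have "\<bar>?B w\<bar> \<le> \<eta> * n + ?B w ^ 2 / (\<eta> * n)"
        proof -
          have p: "0 < \<eta> * n" using \<eta> n by simp
          have "2 * (\<eta> * n) * \<bar>?B w\<bar> \<le> (\<eta> * n) ^ 2 + \<bar>?B w\<bar> ^ 2" by (rule sum_squares_bound)
          hence "(\<eta> * n) * \<bar>?B w\<bar> \<le> (\<eta> * n) ^ 2 + ?B w ^ 2"
            using p mult_nonneg_nonneg[of "\<eta> * n" "\<bar>?B w\<bar>"] by (simp only: power2_abs) linarith
          hence "\<bar>?B w\<bar> \<le> ((\<eta> * n) ^ 2 + ?B w ^ 2) / (\<eta> * n)"
            using p by (simp only: pos_le_divide_eq mult.commute)
          thus ?thesis using \<eta> n by (simp add: add_divide_distrib power2_eq_square)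
        qed
        ultimately show "\<delta> * n \<le> ?X w" using * by linarith
      qed
      have [measurable]: "?X \<in> borel_measurable (PW n)" using Xi by simp
      show "{w \<in> space (PW n). \<delta> * n \<le> ?X w} \<in> sets (PW n)" by measurable
    qed
    with 1 show ?thesis by simp
  qed
  have "(\<lambda>n. (2 * real K) ^ 2 / (\<eta> * \<delta> * real n)) \<longlonglongrightarrow> 0"
    by (intro tendsto_divide_0[OF tendsto_const] filterlim_at_top_imp_at_infinity
          filterlim_tendsto_pos_mult_at_top[OF tendsto_const] filterlim_real_sequentially)
       (use \<eta> \<delta> in auto)
  hence "eventually (\<lambda>n. (2 * real K) ^ 2 / (\<eta> * \<delta> * real n) < e / 2) sequentially"
    using e by (intro order_tendstoD) auto
  then obtain n0 where n0: "\<And>n. n \<ge> n0 \<Longrightarrow> (2 * real K) ^ 2 / (\<eta> * \<delta> * real n) < e / 2"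
    by (auto simp: eventually_sequentially)
  show "\<exists>no. \<forall>n\<ge>no. norm (measure (PW n) {w \<in> space (PW n). \<delta> * n < \<bar>\<Sum>i=1..n. g (w i) - (\<integral>x. g x \<partial>\<mu>)\<bar>} - 0) < e"
  proof (intro exI allI impI)
    fix n assume n: "max 1 n0 \<le> n"
    thus "norm (measure (PW n) {w \<in> space (PW n). \<delta> * n < \<bar>\<Sum>i=1..n. g (w i) - (\<integral>x. g x \<partial>\<mu>)\<bar>} - 0) < e"
      using bound[of n] n0[of n] e unfolding m_def[symmetric] by simp
  qed
qed

end

section \<open>Poisson approximation at rate 1/n\<close>

context weight_law
begin

abbreviation "RG model n \<equiv> random_graph model \<mu> n"

lemma prob_space_RG: "prob_space (RG model n)"
  by (rule random_graph_prob_space[OF prob_space_axioms sets_mu])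

lemma sets_RG: "sets (RG model n) = UNIV"
  by (rule sets_random_graph[OF prob_space_axioms sets_mu])

lemma space_RG: "space (RG model n) = UNIV"
  using sets_RG[of model n] sets.sets_into_space[of UNIV "RG model n"] by auto

lemma RG_integral:
  fixes h :: "nat set set \<Rightarrow> real"
  assumes h: "\<And>G. \<bar>h G\<bar> \<le> b"
  shows "(\<integral>G. h G \<partial>RG model n) = (\<integral>w. measure_pmf.expectation (graph_given_weights model n w) h \<partial>PW n)"
    and "\<bar>measure_pmf.expectation (graph_given_weights model n w) h\<bar> \<le> b"
    and "integrable (PW n) (\<lambda>w. measure_pmf.expectation (graph_given_weights model n w) h)"
proof -
  interpret P: prob_space "PW n" by (rule prob_space_PW)
  have b0: "0 \<le> b" using h[of undefined] abs_ge_zero[of "h undefined"] by linarith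
  note ker = graph_given_weights_measurable[OF sets_mu, of model n]
  show "(\<integral>G. h G \<partial>RG model n) = (\<integral>w. measure_pmf.expectation (graph_given_weights model n w) h \<partial>PW n)"
    unfolding random_graph_def
    by (rule integral_bind[where K = "count_space UNIV" and B = b and B' = 1])
       (use h ker P.finite_measure_axioms in auto)
  have m: "(\<lambda>w. measure_pmf.expectation (graph_given_weights model n w) h) \<in> borel_measurable (PW n)"
    by (rule measurable_compose[OF ker integral_measurable_subprob_algebra]) simp
  have B: "\<bar>measure_pmf.expectation (graph_given_weights model n w) h\<bar> \<le> b" for w
  proof -
    have "\<bar>measure_pmf.expectation (graph_given_weights model n w) h\<bar> \<le>
        measure_pmf.expectation (graph_given_weights model n w) (\<lambda>G. \<bar>h G\<bar>)"
      by (rule integral_abs_bound)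
    also have "\<dots> \<le> measure_pmf.expectation (graph_given_weights model n w) (\<lambda>G. b)"
      using h b0 by (intro integral_mono measure_pmf.integrable_const_bound[where B = b]) auto
    finally show ?thesis by simp
  qed
  show "\<bar>measure_pmf.expectation (graph_given_weights model n w) h\<bar> \<le> b" by (rule B)
  show "integrable (PW n) (\<lambda>w. measure_pmf.expectation (graph_given_weights model n w) h)"
    using B m by (intro P.integrable_const_bound[where B = b]) auto
qed

lemma RG_measure:
  "measure (RG model n) {G. Q G} = (\<integral>G. of_bool (Q G) \<partial>RG model n)"
proof -
  interpret P: prob_space "RG model n" by (rule prob_space_RG)
  have "(\<integral>G. of_bool (Q G) \<partial>RG model n) = (\<integral>G. indicator {G. Q G} G \<partial>RG model n)"
    by (intro Bochner_Integration.integral_cong) (auto simp: indicator_def)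
  also have "\<dots> = measure (RG model n) {G. Q G}"
    by (simp add: sets_RG)
  finally show ?thesis ..
qed

text \<open>The random graph almost surely has its edges inside \<open>{1..n}\<close>, so events are
  compared only on such graphs.\<close>

lemma RG_mono:
  assumes "\<And>G. G \<subseteq> all_edges {1..n} \<Longrightarrow> Q G \<Longrightarrow> Q' G"
  shows "measure (RG model n) {G. Q G} \<le> measure (RG model n) {G. Q' G}"
proof -
  have sub: "G \<subseteq> all_edges {1..n}" if G: "G \<in> set_pmf (graph_given_weights model n w)" for G w
  proof -
    obtain f where f: "G = graph_of n f" using G unfolding graph_given_weights_def set_map_pmf by blast
    show ?thesis
    proof
      fix e assume "e \<in> G"
      then obtain i j where "e = {i, j}" "i \<in> {1..n}" "j \<in> {1..n}" "i \<noteq> j"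
        unfolding f graph_of_def vertex_pairs_def by auto
      thus "e \<in> all_edges {1..n}" unfolding all_edges_def by blast
    qed
  qed
  show ?thesis unfolding RG_measure RG_integral(1)[of "\<lambda>G. of_bool (Q G)" 1, simplified]
    RG_integral(1)[of "\<lambda>G. of_bool (Q' G)" 1, simplified]
  proof (rule integral_mono)
    show "measure_pmf.expectation (graph_given_weights model n w) (\<lambda>G. of_bool (Q G) :: real) \<le>
        measure_pmf.expectation (graph_given_weights model n w) (\<lambda>G. of_bool (Q' G))" for w
      using assms sub by (intro integral_mono_AE measure_pmf.integrable_const_bound[where B = 1])
        (auto simp: AE_measure_pmf_iff)
  qed (rule RG_integral(3)[of _ 1], simp)+
qed

lemma RG_cong:
  assumes "\<And>G. G \<subseteq> all_edges {1..n} \<Longrightarrow> Q G \<longleftrightarrow> Q' G"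
  shows "measure (RG model n) {G. Q G} = measure (RG model n) {G. Q' G}"
  using assms by (intro antisym RG_mono) auto

text \<open>Given the law of the weights, the constant depends on \<open>M\<close> and
  \<open>q\<close> but not on \<open>n\<close>, \<open>N\<close>, \<open>K\<close> or
  \<open>h\<close>; this uniformity later permits infinite sets of lengths. The linear term of
  \<open>linearized_estimate\<close> integrates to zero, and its right-hand side has mean of order
  \<open>1 / n\<close>.\<close>

lemma poisson_approximation:
  fixes M q :: real
  assumes i4: "integrable \<mu> (\<lambda>x. x ^ 4)"
  defines "m1 \<equiv> (\<integral>x. x \<partial>\<mu>)" and "m2 \<equiv> (\<integral>x. x ^ 2 \<partial>\<mu>)"
  assumes rq: "m2 / m1 < q" and M: "1 \<le> M"
  shows "\<exists>C>0. \<forall>n N K h. 0 < n \<longrightarrow> K \<subseteq> {3..N} \<longrightarrow> cycle_bound N K q M \<longrightarrow> (\<forall>j. \<bar>h j\<bar> \<le> (1::real)) \<longrightarrow>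
     \<bar>(\<integral>G. h (cycle_count G K) \<partial>RG model n) - poisson_mean (cycle_rate_sum K (m2 / m1)) h\<bar> \<le> C / real n"
proof -
  define r where "r = m2 / m1"
  have i1: "integrable \<mu> (\<lambda>x. x)" and i2: "integrable \<mu> (\<lambda>x. x ^ 2)"
    using integrable_power_le[OF i4, of 1] integrable_power_le[OF i4, of 2] by simp_all
  have m: "0 < m1" "0 < m2" using moment_pos[of 1] moment_pos[of 2] i1 i2 by (simp_all add: m1_def m2_def)
  have r0: "0 < r" using m by (simp add: r_def)
  define \<delta> where "\<delta> = min (m1 / 2) (m1 * (q - r) / (1 + q))"
  have q0: "0 < q" using rq r0 by (simp add: r_def)
  have \<delta>: "0 < \<delta>" "\<delta> \<le> m1 / 2" "\<delta> \<le> m1 * (q - r) / (1 + q)"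
    unfolding \<delta>_def by (rule min.cobounded1 min.cobounded2 | use m rq q0 in \<open>simp add: r_def\<close>)+
  \<comment> \<open>Since \<open>l \<le> M\<close>, this bounds the solutions of Stein's equation
    for all admissible \<open>K\<close> at once.\<close>
  define b where "b = 2 * exp M"
  have b1: "1 \<le> b" using M exp_ge_add_one_self[of M] unfolding b_def by linarith
  define D where "D = (b + b ^ 2 * M) * (M + M ^ 2)"
  have D0: "0 \<le> D" using b1 M by (simp add: D_def)
  define Kp where "Kp = M * b"
  have Kp0: "0 \<le> Kp" using b1 M by (simp add: Kp_def)
  define C0 where "C0 = D * (4 + 8 * (1 + r) ^ 2) / m1 ^ 2 + Kp * (2 * (1 + r)) / m1 ^ 2 + 2 / \<delta> ^ 2 +
       Kp / m1 * (1 / \<delta> ^ 2 + 2 * (1 + r) ^ 2)"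
  have C00: "0 \<le> C0" using D0 Kp0 r0 m \<delta> by (simp add: C0_def)
  define g1 where "g1 x = x - m1" for x
  define g2 where "g2 x = x ^ 2 - m2" for x
  have i4': "integrable \<mu> (\<lambda>x. (x ^ 2) ^ 2)" using i4 by (simp add: power_mult[symmetric])
  have g1: "integrable \<mu> g1" "(\<integral>x. g1 x \<partial>\<mu>) = 0" "integrable \<mu> (\<lambda>x. g1 x ^ 2)"
    unfolding g1_def power2_diff using i1 i2 by (simp_all add: m1_def prob_space)
  have g2: "integrable \<mu> g2" "(\<integral>x. g2 x \<partial>\<mu>) = 0" "integrable \<mu> (\<lambda>x. g2 x ^ 2)"
    unfolding g2_def power2_diff using i2 i4' by (simp_all add: m2_def prob_space)
  define v where "v = (\<integral>x. g1 x ^ 2 \<partial>\<mu>) + (\<integral>x. g2 x ^ 2 \<partial>\<mu>) + (\<integral>x. x ^ 4 \<partial>\<mu>)"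
  have v0: "0 \<le> v" unfolding v_def by (intro add_nonneg_nonneg integral_nonneg) auto
  show ?thesis
  proof (intro exI[of _ "C0 * v + 1"] conjI allI impI)
    show "0 < C0 * v + 1" using C00 v0 by (simp add: add_nonneg_pos)
    fix n N :: nat and K and h :: "nat \<Rightarrow> real"
    assume n: "0 < n" and K: "K \<subseteq> {3..N}" and bd: "cycle_bound N K q M" and h: "\<forall>j. \<bar>h j\<bar> \<le> 1"
    interpret P: prob_space "PW n" by (rule prob_space_PW)
    define l where "l = cycle_rate_sum K r"
    have l0: "0 \<le> l" unfolding l_def using r0 by (intro cycle_rate_sum_nonneg) auto
    have "l \<le> cycle_rate_sum K q" unfolding l_def using r0 rq by (intro cycle_rate_sum_mono) (auto simp: r_def)
    hence lM: "l \<le> M" using bd by (simp add: cycle_bound_def)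
    hence eb: "2 * exp l \<le> b" by (simp add: b_def)
    define c where "c = poisson_mean l h"
    obtain g where g: "\<And>j. \<bar>g j\<bar> \<le> 2 * exp l" "\<And>j. l * g (Suc j) - real j * g j = h j - c"
      using stein_poisson_solution[OF l0, of h] h unfolding c_def by metis
    have gb: "\<bar>g j\<bar> \<le> b" for j using g(1)[of j] eb by linarith
    \<comment> \<open>The Poisson mean of \<open>g (Suc j)\<close>, computed through the rescaled
      function because the Stein solution requires a test function bounded by 1.\<close>
    define u0 where "u0 = b * poisson_mean l (\<lambda>j. g (Suc j) / b)"
    have h2: "\<bar>g (Suc j) / b\<bar> \<le> 1" for j using gb[of "Suc j"] b1 by (simp add: abs_divide)
    obtain g' where g': "\<And>j. \<bar>g' j\<bar> \<le> 2 * exp l" "\<And>j. l * g' (Suc j) - real j * g' j = g (Suc j) / b - u0 / b"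
      using stein_poisson_solution[OF l0, of "\<lambda>j. g (Suc j) / b"] h2 b1 unfolding u0_def by auto
    have gb': "\<bar>g' j\<bar> \<le> b" for j using g'(1)[of j] eb by linarith
    have u0: "\<bar>u0\<bar> \<le> b"
      using poisson_mean_le[OF l0, of "\<lambda>j. g (Suc j) / b" 1, OF h2] b1 by (simp add: u0_def abs_mult)
    define \<kappa> where "\<kappa> = cycle_rate_slope K r * u0"
    have K3: "K \<subseteq> {3..}" using K by auto
    have rq': "0 \<le> r" "r \<le> q" using r0 rq by (auto simp: r_def)
    have \<kappa>: "\<bar>\<kappa>\<bar> \<le> Kp" unfolding \<kappa>_def Kp_def abs_mult
      using cycle_rate_sum_bounds(4)[OF K3 bd rq' rq'] u0 M by (intro mult_mono) auto
    have c1: "\<bar>c\<bar> \<le> 1" unfolding c_def using poisson_mean_le[OF l0, of h 1] h by simp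
    define p where "p w = measure_pmf.expectation (graph_given_weights model n w) (\<lambda>G. h (cycle_count G K))" for w
    have hb: "\<bar>h (cycle_count G K)\<bar> \<le> 1" for G using h by simp
    have p1: "\<bar>p w\<bar> \<le> 1" for w unfolding p_def by (rule RG_integral(2)[OF hb])
    have pint: "integrable (PW n) p" unfolding p_def by (rule RG_integral(3)[OF hb])
    define X1 where "X1 w = (\<Sum>i=1..n. g1 (w i))" for w :: "nat \<Rightarrow> real"
    define X2 where "X2 w = (\<Sum>i=1..n. g2 (w i))" for w :: "nat \<Rightarrow> real"
    define X4 where "X4 w = (\<Sum>i=1..n. w i ^ 4)" for w :: "nat \<Rightarrow> real"
    note I1 = sum_integral[OF g1(1), of n, folded X1_def] and I2 = sum_integral[OF g2(1), of n, folded X2_def]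
    note I4 = sum_integral[OF i4, of n, folded X4_def]
    note J1 = centered_sum_square[OF g1, of n, folded X1_def] and J2 = centered_sum_square[OF g2, of n, folded X2_def]
    \<comment> \<open>The added linear term is centred, so \<open>Z\<close> has the same mean as the
      error to be estimated.\<close>
    define Z where "Z w = p w - c + \<kappa> * ((X2 w - r * X1 w) / (n * m1))" for w
    define Y where "Y w = C0 * ((X1 w ^ 2 + X2 w ^ 2 + X4 w) / real n ^ 2)" for w
    have Zi: "integrable (PW n) Z" unfolding Z_def using pint I1 I2 by auto
    have Yi: "integrable (PW n) Y" unfolding Y_def using J1 J2 I4 by auto
    have "AE w in PW n. \<bar>Z w\<bar> \<le> Y w"
      using AE_pos[of n]
    proof eventually_elim
      case (elim w)
      interpret graph_weights model n w
        using n elim by unfold_locales auto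
      have X: "X1 w = dev1 m1" "X2 w = dev2 m2" "X4 w = S4"
        by (simp_all add: X1_def X2_def X4_def dev1_def dev2_def S4_def L_def V_def g1_def g2_def sum_subtractf)
      have p: "p w = E (\<lambda>G. h (cycle_count G K))" by (simp add: p_def P_def)
      show ?case unfolding Z_def Y_def X C0_def r_def
      proof (rule linearized_estimate[OF m rq \<delta>(1,2) \<delta>(3)[unfolded r_def] _ _ D0 \<kappa>])
        show "\<bar>p w - c\<bar> \<le> 2" using p1[of w] c1 by linarith
        assume R: "R \<le> q"
        show "\<bar>p w - c + \<kappa> * (R - m2 / m1)\<bar> \<le> D * (eps + (R - m2 / m1) ^ 2)"
          using second_order_estimate[where g' = g' and c = c, OF K bd R rq' l_def b1 gb g(2) gb' g'(2) u0]
          unfolding p \<kappa>_def D_def r_def .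
      qed
    qed
    hence le: "(\<integral>w. \<bar>Z w\<bar> \<partial>PW n) \<le> (\<integral>w. Y w \<partial>PW n)"
      using Zi Yi by (intro integral_mono_AE) auto
    have "(\<integral>w. Z w \<partial>PW n) = (\<integral>w. p w \<partial>PW n) - c"
      unfolding Z_def using pint I1 I2 g1(2) g2(2) by (simp add: P.prob_space)
    moreover have "(\<integral>w. p w \<partial>PW n) = (\<integral>G. h (cycle_count G K) \<partial>RG model n)"
      unfolding p_def by (rule RG_integral(1)[OF hb, symmetric])
    ultimately have "\<bar>(\<integral>G. h (cycle_count G K) \<partial>RG model n) - c\<bar> = \<bar>\<integral>w. Z w \<partial>PW n\<bar>" by simp
    also have "\<dots> \<le> (\<integral>w. \<bar>Z w\<bar> \<partial>PW n)" by (rule integral_abs_bound)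
    also note le
    also have "(\<integral>w. Y w \<partial>PW n) = C0 * (n * v / real n ^ 2)"
      unfolding Y_def v_def using J1 J2 I4 by (simp add: algebra_simps)
    also have "\<dots> = C0 * v / n" using n by (simp add: power2_eq_square)
    also have "\<dots> \<le> (C0 * v + 1) / n" by (intro divide_right_mono) auto
    finally show "\<bar>(\<integral>G. h (cycle_count G K) \<partial>RG model n) - poisson_mean (cycle_rate_sum K (m2 / m1)) h\<bar> \<le>
        (C0 * v + 1) / real n" unfolding c_def l_def r_def .
  qed
qed

end

section \<open>Long cycles\<close>

lemma card_le_of_cycle:
  assumes "finite V" "C \<in> cycles (all_edges V)"
  shows "card C \<le> card V"
proof -
  obtain vs where vs: "distinct vs" "3 \<le> length vs" "C = cycle_edges vs" "C \<subseteq> all_edges V"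
    using assms(2) by (auto simp: cycles_def)
  have "card C = card (set vs)" using card_cycle_edges[OF vs(1,2)] vs distinct_card[OF vs(1)] by simp
  also have "\<dots> \<le> card V"
    using cycle_edges_all_edges[OF vs(1,2), of V] vs assms(1) by (intro card_mono) auto
  finally show ?thesis .
qed

lemma cycle_count_cong:
  assumes "G \<subseteq> all_edges {1..n}" "\<And>k. 3 \<le> k \<Longrightarrow> k \<le> n \<Longrightarrow> k \<in> A \<longleftrightarrow> k \<in> B"
  shows "cycle_count G A = cycle_count G B"
proof -
  have "card C \<in> A \<longleftrightarrow> card C \<in> B" if "C \<in> cycles G" for C
  proof -
    have "C \<in> cycles (all_edges {1..n})" using that assms(1) by (auto simp: cycles_def)
    thus ?thesis using card_le_of_cycle[of "{1..n}" C] card_ge_3_cycles[OF that] assms(2) by simp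
  qed
  thus ?thesis unfolding cycle_count_def by (intro arg_cong[of _ _ card]) auto
qed

lemma sum_geometric_tail_le:
  fixes p :: real
  assumes "0 \<le> p" "p < 1" "finite K" "K \<subseteq> {k0..}"
  shows "(\<Sum>k\<in>K. p ^ k) \<le> p ^ k0 / (1 - p)"
proof -
  have s: "summable (\<lambda>k. p ^ (k + k0))"
    unfolding power_add using assms by (intro summable_mult2 summable_geometric) auto
  have "(\<Sum>k\<in>K. p ^ k) = (\<Sum>k\<in>(\<lambda>k. k - k0) ` K. p ^ (k + k0))"
  proof (subst sum.reindex)
    show "inj_on (\<lambda>k. k - k0) K"
      using assms(4) by (intro inj_onI) (metis atLeast_iff eq_diff_iff subsetD)
    show "(\<Sum>k\<in>K. p ^ k) = sum ((\<lambda>k. p ^ (k + k0)) \<circ> (\<lambda>k. k - k0)) K"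
      using assms(4) by (intro sum.cong) auto
  qed
  also have "\<dots> \<le> (\<Sum>k. p ^ (k + k0))" using assms by (intro sum_le_suminf s) auto
  also have "\<dots> = (\<Sum>k. p ^ k) * p ^ k0"
    unfolding power_add using assms by (intro suminf_mult2[symmetric] summable_geometric) auto
  also have "\<dots> = p ^ k0 / (1 - p)" using assms by (subst suminf_geometric) auto
  finally show ?thesis .
qed

text \<open>\<open>exp (c * (ln (c / \<gamma>) - 1))\<close> is the maximum of
  \<open>x powr c * exp (- \<gamma> * x)\<close> over positive \<open>x\<close>, attained at
  \<open>x = c / \<gamma>\<close>. It results from \<open>ln y \<le> y - 1\<close> at
  \<open>y = n * \<gamma> / c\<close>.\<close>

lemma exp_minus_le_powr:
  fixes \<gamma> c :: real
  assumes \<gamma>: "0 < \<gamma>" and c: "0 < c"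
  shows "\<exists>C>0. \<forall>n>0. exp (- \<gamma> * real n) \<le> C * real n powr (- c)"
proof (intro exI[of _ "exp (c * (ln (c / \<gamma>) - 1))"] conjI allI impI)
  fix n :: nat assume n: "0 < n"
  define t where "t = c / \<gamma>"
  have t: "0 < t" using \<gamma> c by (simp add: t_def)
  have "ln (real n / t) \<le> real n / t - 1" using n t by (intro ln_le_minus_one) auto
  hence "ln (real n) \<le> real n / t - 1 + ln t" using n t by (simp add: ln_div)
  hence "c * ln (real n) \<le> c * (real n / t - 1 + ln t)" using c by (intro mult_left_mono) auto
  also have "\<dots> = \<gamma> * real n + c * (ln t - 1)" using \<gamma> c by (simp add: t_def field_simps)
  finally have "- \<gamma> * real n \<le> c * (ln t - 1) + - c * ln (real n)" by simp
  hence "exp (- \<gamma> * real n) \<le> exp (c * (ln t - 1)) * exp (- c * ln (real n))"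
    by (simp only: exp_add[symmetric] exp_le_cancel_iff)
  thus "exp (- \<gamma> * real n) \<le> exp (c * (ln (c / \<gamma>) - 1)) * real n powr - c"
    using n by (simp add: powr_def t_def)
qed simp

text \<open>With the lower bound \<open>s\<close> in place of \<open>L\<close> the denominator is
  deterministic, and on distinct lists the squares \<open>w x ^ 2\<close> belong to different
  vertices, so the right-hand side can be integrated over independent weights factor by
  factor.\<close>

lemma (in graph_weights) cycle_mean_le:
  assumes s: "0 < s" "s \<le> L" and K: "K \<subseteq> {3..}"
  shows "cycle_mean K \<le> (\<Sum>k\<in>K. (\<Sum>us\<in>{xs. set xs \<subseteq> V \<and> length xs = k}. if distinct us then \<Prod>x\<in>set us. w x ^ 2 else 0) / s ^ k)"
  unfolding cycle_mean_def
proof (rule sum_mono)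
  fix k assume "k \<in> K"
  hence k: "3 \<le> k" using K by auto
  let ?S = "{xs. set xs \<subseteq> V \<and> length xs = k}"
  have "(\<Sum>C\<in>cycles_of_length V k. \<Prod>e\<in>C. pe e) \<le> (\<Sum>C\<in>cycles_of_length V k. \<Prod>e\<in>C. edge_weight w L e)"
    using cycles_of_lengthD(1) by (intro sum_mono prod_pe_le)
  also have "\<dots> \<le> (\<Sum>us\<in>?S. (if distinct us then \<Prod>x\<in>set us. w x ^ 2 else 0) / s ^ k) / (2 * real k)"
    unfolding sum_cycles_of_length[OF finite_V k]
  proof (intro divide_right_mono sum_mono)
    fix us assume us: "us \<in> ?S"
    show "(if distinct us then \<Prod>e\<in>cycle_edges us. edge_weight w L e else 0) \<le>
        (if distinct us then \<Prod>x\<in>set us. w x ^ 2 else 0) / s ^ k"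
    proof (cases "distinct us")
      case True
      have "(\<Prod>e\<in>cycle_edges us. edge_weight w L e) = prod_list (map (\<lambda>x. w x ^ 2 / L) us)"
        using True us k by (intro prod_edge_weight_cycle) auto
      also have "\<dots> = (\<Prod>x\<in>set us. w x ^ 2 / L)"
        using True by (simp add: prod.distinct_set_conv_list)
      also have "\<dots> = (\<Prod>x\<in>set us. w x ^ 2) / L ^ k"
        using True us by (simp add: prod_dividef distinct_card)
      also have "\<dots> \<le> (\<Prod>x\<in>set us. w x ^ 2) / s ^ k"
        using s L_pos by (intro divide_left_mono power_mono mult_pos_pos prod_nonneg) auto
      finally show ?thesis using True by simp
    qed simp
  qed simp
  also have "\<dots> = (\<Sum>us\<in>?S. if distinct us then \<Prod>x\<in>set us. w x ^ 2 else 0) / s ^ k / (2 * real k)"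
    by (simp only: sum_divide_distrib)
  also have "\<dots> \<le> (\<Sum>us\<in>?S. if distinct us then \<Prod>x\<in>set us. w x ^ 2 else 0) / s ^ k / 1"
    using k s by (intro divide_left_mono divide_nonneg_nonneg sum_nonneg) (auto intro: prod_nonneg)
  finally show "(\<Sum>C\<in>cycles_of_length V k. \<Prod>e\<in>C. pe e) \<le>
      (\<Sum>us\<in>?S. if distinct us then \<Prod>x\<in>set us. w x ^ 2 else 0) / s ^ k" by simp
qed

context weight_law
begin

text \<open>A Chernoff bound. For positive \<open>x\<close> one has \<open>exp (- \<theta> * x)
  \<le> 1 - \<theta> * x + \<theta> ^ 2 * x ^ 2\<close>, so two moments control the Laplace
  transform.\<close>

lemma lower_tail_weight_sum:
  assumes i2: "integrable \<mu> (\<lambda>x. x ^ 2)"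
  defines "m1 \<equiv> (\<integral>x. x \<partial>\<mu>)" and "m2 \<equiv> (\<integral>x. x ^ 2 \<partial>\<mu>)"
  assumes s: "s < m1"
  shows "\<exists>\<gamma>>0. \<forall>n. (\<integral>w. of_bool ((\<Sum>i=1..n. w i) < s * n) \<partial>PW n) \<le> exp (- \<gamma> * real n) \<and>
    integrable (PW n) (\<lambda>w. of_bool ((\<Sum>i=1..n. w i) < s * n) :: real)"
proof -
  have i1: "integrable \<mu> (\<lambda>x. x)" using integrable_power_le[OF i2, of 1] by simp
  have m: "0 < m2" using moment_pos[OF i2] by (simp add: m2_def)
  \<comment> \<open>This minimises the exponent
    \<open>- \<theta> * (m1 - s) + \<theta> ^ 2 * m2\<close>; the minimum is
    \<open>- \<gamma>\<close>.\<close>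
  define \<theta> where "\<theta> = (m1 - s) / (2 * m2)"
  have \<theta>: "0 < \<theta>" using s m by (simp add: \<theta>_def)
  define \<gamma> where "\<gamma> = \<theta> * (m1 - s) / 2"
  have \<gamma>: "0 < \<gamma>" using \<theta> s by (simp add: \<gamma>_def)
  have meas: "(\<lambda>x. exp (- \<theta> * x)) \<in> borel_measurable \<mu>"
    by (simp add: measurable_cong_sets[OF sets_mu refl])
  have ie: "integrable \<mu> (\<lambda>x. exp (- \<theta> * x))"
  proof (rule integrable_const_bound[of _ 1])
    show "AE x in \<mu>. norm (exp (- \<theta> * x)) \<le> 1" using pos by eventually_elim (use \<theta> in simp)
  qed (rule meas)
  have "(\<integral>x. exp (- \<theta> * x) \<partial>\<mu>) \<le> (\<integral>x. 1 - \<theta> * x + \<theta> ^ 2 * x ^ 2 \<partial>\<mu>)"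
  proof (rule integral_mono_AE[OF ie])
    show "AE x in \<mu>. exp (- \<theta> * x) \<le> 1 - \<theta> * x + \<theta> ^ 2 * x ^ 2" using pos
    proof eventually_elim
      fix x :: real assume "0 < x"
      thus "exp (- \<theta> * x) \<le> 1 - \<theta> * x + \<theta> ^ 2 * x ^ 2"
        using exp_minus_le_quadratic[of "\<theta> * x"] \<theta> by (simp add: power_mult_distrib)
    qed
  qed (use i1 i2 in auto)
  also have "\<dots> = 1 - \<theta> * m1 + \<theta> ^ 2 * m2" using i1 i2 by (simp add: m1_def m2_def prob_space)
  also have "\<dots> \<le> exp (- (\<theta> * m1) + \<theta> ^ 2 * m2)"
    using exp_ge_add_one_self[of "- (\<theta> * m1) + \<theta> ^ 2 * m2"] by linarith
  finally have mgf: "(\<integral>x. exp (- \<theta> * x) \<partial>\<mu>) \<le> exp (- (\<theta> * m1) + \<theta> ^ 2 * m2)" .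
  have ex: "\<theta> * s + (- (\<theta> * m1) + \<theta> ^ 2 * m2) = - \<gamma>"
    using m by (simp add: \<gamma>_def \<theta>_def power2_eq_square field_simps)
  show ?thesis
  proof (intro exI[of _ \<gamma>] conjI allI \<gamma>)
    fix n :: nat
    interpret P: prob_space "PW n" by (rule prob_space_PW)
    have eq: "exp (\<theta> * s * n) * (\<Prod>i\<in>{1..n}. exp (- \<theta> * w i)) = exp (\<theta> * (s * n - (\<Sum>i=1..n. w i)))" for w
      by (simp add: exp_sum[symmetric] exp_add[symmetric] sum_distrib_left[symmetric] sum_negf algebra_simps)
    note PI = prod_integral[of "{1..n}" "\<lambda>_ x. exp (- \<theta> * x)" n, OF ie subset_refl]
    have msum: "(\<lambda>w. \<Sum>i=1..n. w i) \<in> borel_measurable (PW n)"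
      using sum_integral(1)[OF i1] by simp
    have mb: "(\<lambda>w. of_bool ((\<Sum>i=1..n. w i) < s * n) :: real) \<in> borel_measurable (PW n)"
      unfolding of_bool_def using msum by measurable
    show ib: "integrable (PW n) (\<lambda>w. of_bool ((\<Sum>i=1..n. w i) < s * n) :: real)"
      by (rule P.integrable_const_bound[of _ 1]) (use mb in auto)
    have "(\<integral>w. of_bool ((\<Sum>i=1..n. w i) < s * n) \<partial>PW n) \<le> (\<integral>w. exp (\<theta> * s * n) * (\<Prod>i\<in>{1..n}. exp (- \<theta> * w i)) \<partial>PW n)"
    proof (rule integral_mono[OF ib integrable_mult_right[OF PI(1)]])
      fix w
      show "of_bool ((\<Sum>i=1..n. w i) < s * n) \<le> exp (\<theta> * s * n) * (\<Prod>i\<in>{1..n}. exp (- \<theta> * w i))"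
        unfolding eq using \<theta> by (auto simp: of_bool_def)
    qed
    also have "\<dots> = exp (\<theta> * s * n) * (\<integral>x. exp (- \<theta> * x) \<partial>\<mu>) ^ n"
      using PI by simp
    also have "\<dots> \<le> exp (\<theta> * s * n) * exp (- (\<theta> * m1) + \<theta> ^ 2 * m2) ^ n"
      using mgf by (intro mult_left_mono power_mono integral_nonneg) auto
    also have "\<dots> = exp ((\<theta> * s + (- (\<theta> * m1) + \<theta> ^ 2 * m2)) * n)"
      by (simp add: exp_of_nat_mult[symmetric] exp_add[symmetric] algebra_simps)
    also have "\<dots> = exp (- \<gamma> * n)" unfolding ex by simp
    finally show "(\<integral>w. of_bool ((\<Sum>i=1..n. w i) < s * n) \<partial>PW n) \<le> exp (- \<gamma> * real n)" .
  qed
qed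

text \<open>On the event that the total weight is at least \<open>s * n\<close>, cycles of length
  \<open>k\<close> contribute at most \<open>(n * m2) ^ k / (s * n) ^ k = p ^ k\<close> to the mean,
  and the tail of the geometric series starts beyond \<open>a * ln (real n)\<close>. The
  exponentially small remainder is at most a constant times the same power of
  \<open>n\<close>.\<close>

lemma long_cycle_probability:
  fixes a :: real
  assumes i2: "integrable \<mu> (\<lambda>x. x ^ 2)"
  defines "m1 \<equiv> (\<integral>x. x \<partial>\<mu>)" and "m2 \<equiv> (\<integral>x. x ^ 2 \<partial>\<mu>)"
  assumes sub: "m2 < m1" and a: "0 < a"
  shows "\<exists>C>0. \<forall>n\<ge>3. measure (RG model n) {G. 0 < cycle_count G {nat \<lfloor>a * ln (real n)\<rfloor> + 1..n}} \<le>
      C * real n powr (a * ln (2 * m2 / (m2 + m1)))"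
proof -
  define p where "p = 2 * m2 / (m2 + m1)"
  \<comment> \<open>The midpoint of \<open>m2\<close> and \<open>m1\<close>: below \<open>m1\<close>
    for the large deviation bound, above \<open>m2\<close> for
    \<open>p = m2 / s < 1\<close>.\<close>
  define s where "s = (m2 + m1) / 2"
  have i1: "integrable \<mu> (\<lambda>x. x)" using integrable_power_le[OF i2, of 1] by simp
  have m: "0 < m2" "0 < m1" using moment_pos[OF i2] sub by (simp_all add: m2_def)
  have p: "0 < p" "p < 1" using m sub by (simp_all add: p_def)
  have s: "0 < s" "s < m1" "m2 / s = p" using m sub by (auto simp: s_def p_def field_simps)
  obtain \<gamma> where \<gamma>: "0 < \<gamma>"
    "\<And>n. (\<integral>w. of_bool ((\<Sum>i=1..n. w i) < s * n) \<partial>PW n) \<le> exp (- \<gamma> * real n)"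
    "\<And>n. integrable (PW n) (\<lambda>w. of_bool ((\<Sum>i=1..n. w i) < s * n) :: real)"
    using lower_tail_weight_sum[OF i2, of s] s unfolding m1_def by auto
  \<comment> \<open>Chosen so that \<open>real n powr (- c)\<close> equals
    \<open>p powr (a * ln (real n))\<close>.\<close>
  define c where "c = - a * ln p"
  have c: "0 < c" using a p by (simp add: c_def mult_pos_neg)
  obtain C1 where C1: "0 < C1" "\<And>n. 0 < n \<Longrightarrow> exp (- \<gamma> * real n) \<le> C1 * real n powr (- c)"
    using exp_minus_le_powr[OF \<gamma>(1) c] by auto
  show ?thesis
  proof (intro exI[of _ "C1 + 1 / (1 - p)"] conjI allI impI)
    show "0 < C1 + 1 / (1 - p)" using C1 p by (simp add: add_pos_pos)
    fix n :: nat assume n: "3 \<le> n"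
    interpret P: prob_space "PW n" by (rule prob_space_PW)
    define k0 where "k0 = nat \<lfloor>a * ln (real n)\<rfloor> + 1"
    \<comment> \<open>The maximum with 3 removes only lengths at which there are no cycles, and
      keeps \<open>K\<close> in the range of the cycle sums.\<close>
    define K where "K = {max 3 k0..n}"
    have K: "finite K" "K \<subseteq> {3..}" "K \<subseteq> {k0..}" by (auto simp: K_def)
    let ?S = "\<lambda>k. {xs. set xs \<subseteq> {1..n} \<and> length xs = k}"
    define T where "T w us = (if distinct us then \<Prod>x\<in>set us. w x ^ 2 else 0 :: real)" for w :: "nat \<Rightarrow> real" and us
    \<comment> \<open>A majorant of the conditional probability: at least 1 when the total weight is
      small, and otherwise the first moment bound.\<close>
    define Y where "Y w = of_bool ((\<Sum>i=1..n. w i) < s * n) + (\<Sum>k\<in>K. (\<Sum>us\<in>?S k. T w us) / (s * n) ^ k)" for w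
    have T: "integrable (PW n) (\<lambda>w. T w us)" "(\<integral>w. T w us \<partial>PW n) \<le> m2 ^ k" if "us \<in> ?S k" for us k
    proof -
      note PI = prod_integral[of "set us" "\<lambda>_ x. x ^ 2" n, OF i2]
      have sub: "set us \<subseteq> {1..n}" using that by auto
      show "integrable (PW n) (\<lambda>w. T w us)" unfolding T_def using PI(1)[OF sub] by (cases "distinct us") auto
      show "(\<integral>w. T w us \<partial>PW n) \<le> m2 ^ k"
        unfolding T_def using PI(2)[OF sub] that m by (cases "distinct us") (auto simp: m2_def distinct_card)
    qed
    have finS: "finite (?S k)" "card (?S k) = n ^ k" for k
      using finite_lists_length_eq[of "{1..n}" k] card_lists_length_eq[of "{1..n}" k] by simp_all
    have Yi: "integrable (PW n) Y"
      unfolding Y_def using T(1)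
      by (intro Bochner_Integration.integrable_add \<gamma>(3) Bochner_Integration.integrable_sum integrable_divide)
    have "(\<integral>w. Y w \<partial>PW n) = (\<integral>w. of_bool ((\<Sum>i=1..n. w i) < s * n) \<partial>PW n) +
        (\<Sum>k\<in>K. (\<Sum>us\<in>?S k. \<integral>w. T w us \<partial>PW n) / (s * n) ^ k)"
    proof -
      have 1: "integrable (PW n) (\<lambda>w. \<Sum>us\<in>?S k. T w us)" for k
        using T(1) by (intro Bochner_Integration.integrable_sum)
      have 2: "(\<integral>w. (\<Sum>us\<in>?S k. T w us) \<partial>PW n) = (\<Sum>us\<in>?S k. \<integral>w. T w us \<partial>PW n)" for k
        using T(1) by (intro Bochner_Integration.integral_sum)
      show ?thesis unfolding Y_def
        using 1 by (subst Bochner_Integration.integral_add[OF \<gamma>(3)])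
          (auto intro!: Bochner_Integration.integrable_sum simp: Bochner_Integration.integral_sum 2)
    qed
    also have "\<dots> \<le> exp (- \<gamma> * real n) + (\<Sum>k\<in>K. (real n ^ k * m2 ^ k) / (s * n) ^ k)"
    proof (intro add_mono \<gamma>(2) sum_mono divide_right_mono)
      fix k
      have "(\<Sum>us\<in>?S k. \<integral>w. T w us \<partial>PW n) \<le> (\<Sum>us\<in>?S k. m2 ^ k)" by (intro sum_mono T(2))
      thus "(\<Sum>us\<in>?S k. \<integral>w. T w us \<partial>PW n) \<le> real n ^ k * m2 ^ k" using finS by simp
    qed (use s in auto)
    also have "(\<Sum>k\<in>K. (real n ^ k * m2 ^ k) / (s * n) ^ k) = (\<Sum>k\<in>K. p ^ k)"
      using n s(1) by (intro sum.cong) (auto simp: s(3)[symmetric] power_mult_distrib power_divide)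
    also have "\<dots> \<le> p ^ k0 / (1 - p)" using p K by (intro sum_geometric_tail_le) auto
    also have "p ^ k0 \<le> real n powr (- c)"
    proof -
      have "a * ln (real n) \<le> real k0" unfolding k0_def by linarith
      hence "p powr real k0 \<le> p powr (a * ln (real n))" using p by (intro powr_mono') auto
      moreover have "p powr real k0 = p ^ k0" using p by (simp add: powr_realpow)
      moreover have "p powr (a * ln (real n)) = real n powr (- c)"
        using p n by (simp add: powr_def c_def mult_ac)
      ultimately show ?thesis by simp
    qed
    also have "exp (- \<gamma> * real n) + real n powr (- c) / (1 - p) \<le> (C1 + 1 / (1 - p)) * real n powr (- c)"
      using C1(2)[of n] n by (simp add: algebra_simps)
    finally have Y: "(\<integral>w. Y w \<partial>PW n) \<le> (C1 + 1 / (1 - p)) * real n powr (- c)"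
      using p by (simp add: divide_right_mono)
    have "measure (RG model n) {G. 0 < cycle_count G {k0..n}} = measure (RG model n) {G. 0 < cycle_count G K}"
    proof (rule RG_cong)
      fix G assume "G \<subseteq> all_edges {1..n}"
      hence "cycle_count G {k0..n} = cycle_count G K" by (rule cycle_count_cong) (auto simp: K_def)
      thus "0 < cycle_count G {k0..n} \<longleftrightarrow> 0 < cycle_count G K" by simp
    qed
    also have "\<dots> = (\<integral>w. measure_pmf.expectation (graph_given_weights model n w) (\<lambda>G. of_bool (0 < cycle_count G K)) \<partial>PW n)"
      unfolding RG_measure by (rule RG_integral(1)[of _ 1]) simp
    also have "\<dots> \<le> (\<integral>w. Y w \<partial>PW n)"
    proof (rule integral_mono_AE[OF _ Yi])
      show "integrable (PW n) (\<lambda>w. measure_pmf.expectation (graph_given_weights model n w) (\<lambda>G. of_bool (0 < cycle_count G K) :: real))"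
        by (rule RG_integral(3)[of _ 1]) simp
      show "AE w in PW n. measure_pmf.expectation (graph_given_weights model n w) (\<lambda>G. of_bool (0 < cycle_count G K)) \<le> Y w"
        using AE_pos[of n]
      proof eventually_elim
        case (elim w)
        interpret graph_weights model n w using n elim by unfold_locales auto
        have T0: "0 \<le> (\<Sum>k\<in>K. (\<Sum>us\<in>?S k. T w us) / (s * n) ^ k)"
          using s by (intro sum_nonneg divide_nonneg_nonneg) (auto simp: T_def intro!: prod_nonneg)
        show ?case
        proof (cases "(\<Sum>i=1..n. w i) < s * n")
          case True
          have "E (\<lambda>G. of_bool (0 < cycle_count G K)) \<le> E (\<lambda>_. 1 :: real)" by (rule expectation_mono) simp
          thus ?thesis using True T0 unfolding Y_def P_def by simp
        next
          case False
          have "E (\<lambda>G. of_bool (0 < cycle_count G K)) \<le> E (\<lambda>G. real (cycle_count G K))"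
            by (rule expectation_mono) (auto simp: of_bool_def)
          also have "\<dots> = cycle_mean K" by (rule expectation_cycle_count[OF K(1)])
          also have "\<dots> \<le> (\<Sum>k\<in>K. (\<Sum>us\<in>?S k. T w us) / (s * n) ^ k)"
            unfolding T_def V_def[symmetric] using False s n K(2) by (intro cycle_mean_le) (auto simp: L_def)
          finally show ?thesis using False unfolding Y_def P_def by simp
        qed
      qed
    qed
    also note Y
    finally show "measure (RG model n) {G. 0 < cycle_count G {nat \<lfloor>a * ln (real n)\<rfloor> + 1..n}} \<le>
      (C1 + 1 / (1 - p)) * real n powr (a * ln (2 * m2 / (m2 + m1)))"
      unfolding k0_def c_def p_def by simp
  qed
qed

end

section \<open>Constants for \<open>cycle_bound\<close>\<close>

lemma cycle_bound_finite:
  assumes q: "0 \<le> q"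
  shows "\<exists>M\<ge>1. \<forall>K\<subseteq>{3..N}. cycle_bound N K q M"
proof -
  define F1 F2 F3 F4 where "F1 k = real k * q ^ (k - 1)" and "F2 k = real k * q ^ (k - 2) / 2 + q ^ (k - 1) / 2"
    and "F3 k = real k * q ^ (k - 2)" and "F4 k = q ^ k / (2 * real k)" for k
  have F: "0 \<le> F1 k" "0 \<le> F2 k" "0 \<le> F3 k" "0 \<le> F4 k" for k
    using q by (simp_all add: F1_def F2_def F3_def F4_def)
  have q0: "0 \<le> (\<Sum>l<N. q ^ l)" using q by (intro sum_nonneg) auto
  define M where "M = 1 + (\<Sum>k=3..N. F1 k) + (\<Sum>k=3..N. F2 k) + (\<Sum>k=3..N. F3 k) + (\<Sum>k=3..N. F4 k) + (\<Sum>l<N. q ^ l)"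
  have S0: "0 \<le> (\<Sum>k=3..N. F1 k)" "0 \<le> (\<Sum>k=3..N. F2 k)" "0 \<le> (\<Sum>k=3..N. F3 k)" "0 \<le> (\<Sum>k=3..N. F4 k)"
    using F by (auto intro!: sum_nonneg)
  show ?thesis
  proof (intro exI[of _ M] conjI allI impI)
    show "1 \<le> M" using S0 q0 unfolding M_def by linarith
    fix K assume K: "K \<subseteq> {3..N}"
    have "(\<Sum>k\<in>K. F1 k) \<le> (\<Sum>k=3..N. F1 k)" "(\<Sum>k\<in>K. F2 k) \<le> (\<Sum>k=3..N. F2 k)"
      "(\<Sum>k\<in>K. F3 k) \<le> (\<Sum>k=3..N. F3 k)" "(\<Sum>k\<in>K. F4 k) \<le> (\<Sum>k=3..N. F4 k)"
      using K F by (auto intro!: sum_mono2)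
    hence "(\<Sum>k\<in>K. F1 k) \<le> M" "(\<Sum>k\<in>K. F2 k) \<le> M" "(\<Sum>k\<in>K. F3 k) \<le> M" "(\<Sum>k\<in>K. F4 k) \<le> M"
      "(\<Sum>l<N. q ^ l) \<le> M" using S0 q0 unfolding M_def by linarith+
    thus "cycle_bound N K q M" using \<open>1 \<le> M\<close>
      unfolding cycle_bound_def cycle_rate_sum_def F1_def F2_def F3_def F4_def by blast
  qed
qed

text \<open>For \<open>q < 1\<close> every sum over \<open>K\<close> is dominated by the convergent
  series of \<open>k * q ^ (k - 1) / q\<close>, so one \<open>M\<close> serves all \<open>N\<close>
  and \<open>K\<close>.\<close>

lemma cycle_bound_subcritical:
  assumes q: "0 < q" "q < 1"
  shows "\<exists>M\<ge>1. \<forall>N. \<forall>K\<subseteq>{3..N}. cycle_bound N K q M"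
proof -
  have "summable (\<lambda>k. real k * q ^ (k - 1))"
    using geometric_deriv_sums[of q] q summable_Suc_iff[of "\<lambda>k. real k * q ^ (k - 1)"] by (simp add: sums_iff)
  hence s1: "summable (\<lambda>k. real k * q ^ (k - 1) / q)" by (rule summable_divide)
  define m where "m = (\<Sum>k. real k * q ^ (k - 1) / q)"
  define m' where "m' = (\<Sum>l. q ^ l)"
  have m0: "0 \<le> m" unfolding m_def using q by (intro suminf_nonneg s1) auto
  have m'0: "0 \<le> m'" unfolding m'_def using q by (intro suminf_nonneg summable_geometric) auto
  show ?thesis
  proof (intro exI[of _ "1 + m + m'"] conjI allI impI)
    show "1 \<le> 1 + m + m'" using m0 m'0 by simp
    fix N K assume K: "K \<subseteq> {3..N::nat}"
    have fK: "finite K" using K finite_subset by blast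
    have le: "(\<Sum>k\<in>K. f k) \<le> m" if f: "\<And>k. 3 \<le> k \<Longrightarrow> f k \<le> real k * q ^ (k - 1) / q" for f
    proof -
      have "(\<Sum>k\<in>K. f k) \<le> (\<Sum>k\<in>K. real k * q ^ (k - 1) / q)" using K f by (intro sum_mono) auto
      also have "\<dots> \<le> m" unfolding m_def using q by (intro sum_le_suminf s1 fK) auto
      finally show ?thesis .
    qed
    have e: "real k * q ^ (k - 1) / q = real k * q ^ (k - 2)" if "3 \<le> k" for k
    proof -
      have "k - 1 = Suc (k - 2)" using that by simp
      thus ?thesis using q by simp
    qed
    have p1: "real k * q ^ (k - 1) \<le> real k * q ^ (k - 2)" for k
      using q by (intro mult_left_mono power_decreasing) auto
    have p2: "q ^ (k - 1) \<le> real k * q ^ (k - 1)" if "3 \<le> k" for k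
      using q that mult_right_mono[of 1 "real k" "q ^ (k - 1)"] by simp
    have p3: "q ^ k / (2 * real k) \<le> real k * q ^ (k - 2)" if "3 \<le> k" for k
    proof -
      have "q ^ k / (2 * real k) \<le> q ^ k / 1" using q that by (intro divide_left_mono) auto
      also have "\<dots> \<le> q ^ (k - 1)" using q by (simp add: power_decreasing)
      finally show ?thesis using p1[of k] p2[OF that] by linarith
    qed
    have "(\<Sum>k\<in>K. real k * q ^ (k - 1)) \<le> m" by (rule le) (use p1 e in simp)
    moreover have "(\<Sum>k\<in>K. real k * q ^ (k - 2) / 2 + q ^ (k - 1) / 2) \<le> m"
    proof (rule le)
      fix k :: nat assume k: "3 \<le> k"
      show "real k * q ^ (k - 2) / 2 + q ^ (k - 1) / 2 \<le> real k * q ^ (k - 1) / q"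
        unfolding e[OF k] using p1[of k] p2[OF k] by linarith
    qed
    moreover have "(\<Sum>l<N. q ^ l) \<le> m'" unfolding m'_def using q by (intro sum_le_suminf summable_geometric) auto
    moreover have "(\<Sum>k\<in>K. real k * q ^ (k - 2)) \<le> m" by (rule le) (simp only: e)
    moreover have "(\<Sum>k\<in>K. q ^ k / (2 * real k)) \<le> m" by (rule le) (simp only: e p3)
    ultimately show "cycle_bound N K q (1 + m + m')"
      unfolding cycle_bound_def cycle_rate_sum_def using m0 m'0 by linarith
  qed
qed

text \<open>A series, because \<open>A\<close> may be infinite and \<open>sum\<close> over an
  infinite set is 0.\<close>

definition total_rate :: "real \<Rightarrow> nat set \<Rightarrow> real" where
  "total_rate r A = (\<Sum>k. if k \<in> A then r ^ k / (2 * real k) else 0)"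

lemma total_rate_finite:
  assumes "finite A" shows "total_rate r A = cycle_rate_sum A r"
proof -
  have "total_rate r A = (\<Sum>k\<in>A. if k \<in> A then r ^ k / (2 * real k) else 0)"
    unfolding total_rate_def by (rule suminf_finite[OF assms]) simp
  thus ?thesis by (simp add: cycle_rate_sum_def)
qed

lemma summable_total_rate:
  assumes "0 \<le> r" "finite A \<or> r < 1"
  shows "summable (\<lambda>k. if k \<in> A then r ^ k / (2 * real k) else 0)"
proof (cases "finite A")
  case True
  thus ?thesis by (rule summable_finite) simp
next
  case False
  hence "summable (\<lambda>k. r ^ k)" using assms by (intro summable_geometric) auto
  moreover have "norm (if k \<in> A then r ^ k / (2 * real k) else 0) \<le> r ^ k" for k
    using assms(1) divide_left_mono[of 1 "2 * real k" "r ^ k"] by (cases "k = 0") auto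
  ultimately show ?thesis by (rule summable_comparison_test'[where N = 0])
qed

lemma total_rate_limit:
  assumes "0 \<le> r" "finite A \<or> r < 1"
  shows "(\<lambda>N. cycle_rate_sum (A \<inter> {..N}) r) \<longlonglongrightarrow> total_rate r A"
proof -
  have "(\<lambda>N. \<Sum>k\<le>N. if k \<in> A then r ^ k / (2 * real k) else 0) \<longlonglongrightarrow> total_rate r A"
    unfolding total_rate_def by (rule summable_LIMSEQ'[OF summable_total_rate[OF assms]])
  moreover have "(\<Sum>k\<le>N. if k \<in> A then r ^ k / (2 * real k) else 0) = cycle_rate_sum (A \<inter> {..N}) r" for N
    unfolding cycle_rate_sum_def by (subst sum.inter_restrict[symmetric]) (auto simp: Int_commute)
  ultimately show ?thesis by simp
qed

lemma total_rate_nonneg: "0 \<le> r \<Longrightarrow> finite A \<or> r < 1 \<Longrightarrow> 0 \<le> total_rate r A"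
  unfolding total_rate_def by (intro suminf_nonneg summable_total_rate) auto

section \<open>Approximation of the cycle counts with error of order \<open>1 / n\<close>\<close>

context weight_law
begin

lemma poisson_approximation_bounded_length:
  assumes i4: "integrable \<mu> (\<lambda>x. x ^ 4)"
  defines "r \<equiv> (\<integral>x. x ^ 2 \<partial>\<mu>) / (\<integral>x. x \<partial>\<mu>)"
  shows "\<exists>C>0. \<forall>n>0. \<forall>A\<subseteq>{3..N}. \<forall>B. \<bar>measure (RG model n) {G. cycle_count G A \<in> B} -
     poisson_mean (total_rate r A) (\<lambda>j. of_bool (j \<in> B))\<bar> \<le> C / real n"
proof -
  have r0: "0 < r" unfolding r_def
    using moment_pos[of 1] moment_pos[of 2] integrable_power_le[OF i4, of 1] integrable_power_le[OF i4, of 2] by simp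
  \<comment> \<open>With finitely many lengths any \<open>q > r\<close> has a bound
    \<open>M\<close>; here \<open>q = r + 1\<close>.\<close>
  obtain M where M: "1 \<le> M" "\<And>K. K \<subseteq> {3..N} \<Longrightarrow> cycle_bound N K (r + 1) M"
    using cycle_bound_finite[of "r + 1" N] r0 by auto
  obtain C where C: "0 < C" "\<And>n N K h. 0 < n \<Longrightarrow> K \<subseteq> {3..N} \<Longrightarrow> cycle_bound N K (r + 1) M \<Longrightarrow> (\<forall>j. \<bar>h j\<bar> \<le> (1::real)) \<Longrightarrow>
     \<bar>(\<integral>G. h (cycle_count G K) \<partial>RG model n) - poisson_mean (cycle_rate_sum K r) h\<bar> \<le> C / real n"
    using poisson_approximation[OF i4, of "r + 1" M model] M(1) unfolding r_def by auto
  show ?thesis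
  proof (intro exI[of _ C] conjI allI impI C(1))
    fix n :: nat and A B :: "nat set" assume n: "0 < n" and A: "A \<subseteq> {3..N}"
    show "\<bar>measure (RG model n) {G. cycle_count G A \<in> B} -
      poisson_mean (total_rate r A) (\<lambda>j. of_bool (j \<in> B))\<bar> \<le> C / real n"
      using C(2)[OF n A M(2)[OF A], of "\<lambda>j. of_bool (j \<in> B)"] total_rate_finite[OF finite_subset[OF A]]
      unfolding RG_measure by simp
  qed
qed

text \<open>A graph on \<open>n\<close> vertices has no cycle longer than \<open>n\<close>, so
  cutting \<open>A\<close> at \<open>N \<ge> n\<close> leaves the count unchanged. The constant does
  not depend on \<open>N\<close>, and only the Poisson side moves as \<open>N\<close> tends to
  infinity.\<close>

lemma poisson_approximation_subcritical:
  assumes i4: "integrable \<mu> (\<lambda>x. x ^ 4)"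
  defines "r \<equiv> (\<integral>x. x ^ 2 \<partial>\<mu>) / (\<integral>x. x \<partial>\<mu>)"
  assumes sub: "(\<integral>x. x ^ 2 \<partial>\<mu>) < (\<integral>x. x \<partial>\<mu>)"
  shows "\<exists>C>0. \<forall>n>0. \<forall>A\<subseteq>{3..}. \<forall>B. \<bar>measure (RG model n) {G. cycle_count G A \<in> B} -
     poisson_mean (total_rate r A) (\<lambda>j. of_bool (j \<in> B))\<bar> \<le> C / real n"
proof -
  have r0: "0 < r" unfolding r_def
    using moment_pos[of 1] moment_pos[of 2] integrable_power_le[OF i4, of 1] integrable_power_le[OF i4, of 2] by simp
  have m: "0 < (\<integral>x. x \<partial>\<mu>)" using moment_pos[of 1] integrable_power_le[OF i4, of 1] by simp
  have r1: "r < 1" unfolding r_def using sub m by simp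
  define q where "q = (r + 1) / 2"
  have q: "0 < q" "q < 1" "r < q" using r0 r1 by (auto simp: q_def)
  obtain M where M: "1 \<le> M" "\<And>N K. K \<subseteq> {3..N} \<Longrightarrow> cycle_bound N K q M"
    using cycle_bound_subcritical[OF q(1,2)] by auto
  obtain C where C: "0 < C" "\<And>n N K h. 0 < n \<Longrightarrow> K \<subseteq> {3..N} \<Longrightarrow> cycle_bound N K q M \<Longrightarrow> (\<forall>j. \<bar>h j\<bar> \<le> (1::real)) \<Longrightarrow>
     \<bar>(\<integral>G. h (cycle_count G K) \<partial>RG model n) - poisson_mean (cycle_rate_sum K r) h\<bar> \<le> C / real n"
    using poisson_approximation[OF i4, of q M model] M(1) q(3) unfolding r_def by auto
  show ?thesis
  proof (intro exI[of _ C] conjI allI impI C(1))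
    fix n :: nat and A B :: "nat set" assume n: "0 < n" and A: "A \<subseteq> {3..}"
    define h :: "nat \<Rightarrow> real" where "h j = of_bool (j \<in> B)" for j
    have h: "\<bar>h j\<bar> \<le> 1" for j by (simp add: h_def)
    have "(\<lambda>N. \<bar>measure (RG model n) {G. cycle_count G A \<in> B} - poisson_mean (cycle_rate_sum (A \<inter> {..N}) r) h\<bar>)
        \<longlonglongrightarrow> \<bar>measure (RG model n) {G. cycle_count G A \<in> B} - poisson_mean (total_rate r A) h\<bar>"
      using r0 r1 by (intro tendsto_intros isCont_poisson_mean h total_rate_limit cycle_rate_sum_nonneg) auto
    moreover have "eventually (\<lambda>N. \<bar>measure (RG model n) {G. cycle_count G A \<in> B} -
        poisson_mean (cycle_rate_sum (A \<inter> {..N}) r) h\<bar> \<le> C / n) sequentially"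
    proof (rule eventually_sequentiallyI[of n])
      fix N assume N: "n \<le> N"
      have K: "A \<inter> {..N} \<subseteq> {3..N}" using A by auto
      have "measure (RG model n) {G. cycle_count G A \<in> B} = measure (RG model n) {G. cycle_count G (A \<inter> {..N}) \<in> B}"
      proof (rule RG_cong)
        fix G assume "G \<subseteq> all_edges {1..n}"
        hence "cycle_count G A = cycle_count G (A \<inter> {..N})" by (rule cycle_count_cong) (use N in auto)
        thus "cycle_count G A \<in> B \<longleftrightarrow> cycle_count G (A \<inter> {..N}) \<in> B" by simp
      qed
      thus "\<bar>measure (RG model n) {G. cycle_count G A \<in> B} -
        poisson_mean (cycle_rate_sum (A \<inter> {..N}) r) h\<bar> \<le> C / n"
        using C(2)[OF n K M(2)[OF K], of h] h unfolding RG_measure h_def by simp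
    qed
    ultimately have "\<bar>measure (RG model n) {G. cycle_count G A \<in> B} - poisson_mean (total_rate r A) h\<bar> \<le> C / n"
      by (rule tendsto_upperbound) simp
    thus "\<bar>measure (RG model n) {G. cycle_count G A \<in> B} -
      poisson_mean (total_rate r A) (\<lambda>j. of_bool (j \<in> B))\<bar> \<le> C / real n" unfolding h_def .
  qed
qed

end

section \<open>Convergence in the vague topology\<close>

lemma counting_measuresD:
  assumes "\<nu> \<in> counting_measures"
  shows "sets \<nu> = Pow {3..}" "space \<nu> = {3..}" "3 \<le> k \<Longrightarrow> \<exists>m::nat. emeasure \<nu> {k} = of_nat m"
  using assms sets_eq_imp_space_eq[of \<nu> "count_space {3..}"] by (auto simp: counting_measures_def)

lemma integral_counting_measure:
  fixes f :: "nat \<Rightarrow> real"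
  assumes \<nu>: "\<nu> \<in> counting_measures" and fin: "finite {k. 3 \<le> k \<and> f k \<noteq> 0}"
  shows "(\<integral>k. f k \<partial>\<nu>) = (\<Sum>k\<in>{k. 3 \<le> k \<and> f k \<noteq> 0}. f k * measure \<nu> {k})"
proof -
  let ?S = "{k. 3 \<le> k \<and> f k \<noteq> 0}"
  note D = counting_measuresD[OF \<nu>]
  have int: "integrable \<nu> (\<lambda>x. f k * indicator {k} x)" if "k \<in> ?S" for k
  proof -
    obtain m :: nat where "emeasure \<nu> {k} = of_nat m" using D(3)[of k] \<open>k \<in> ?S\<close> by auto
    thus ?thesis using D(1) that by (intro integrable_mult_right integrable_real_indicator) (auto simp: of_nat_less_top)
  qed
  have "(\<integral>k. f k \<partial>\<nu>) = (\<integral>x. (\<Sum>k\<in>?S. f k * indicator {k} x) \<partial>\<nu>)"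
  proof (rule Bochner_Integration.integral_cong)
    fix x assume "x \<in> space \<nu>"
    hence x: "3 \<le> x" using D by simp
    have "(\<Sum>k\<in>?S. f k * indicator {k} x) = (\<Sum>k\<in>?S. if k = x then f k else 0)"
      by (intro sum.cong) (auto simp: indicator_def)
    also have "\<dots> = f x" using fin x by (subst sum.delta) auto
    finally show "f x = (\<Sum>k\<in>?S. f k * indicator {k} x)" ..
  qed simp
  also have "\<dots> = (\<Sum>k\<in>?S. \<integral>x. f k * indicator {k} x \<partial>\<nu>)" by (intro Bochner_Integration.integral_sum int)
  also have "\<dots> = (\<Sum>k\<in>?S. f k * measure \<nu> {k})" using D(2) by (intro sum.cong) auto
  finally show ?thesis .
qed

lemma topspace_vague: "topspace vague_topology = counting_measures"
proof -
  have "counting_measures \<in> {{\<nu> \<in> counting_measures. (\<integral>k. f k \<partial>\<nu>) \<in> U} | (f :: nat \<Rightarrow> real) U.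
        finite {k. 3 \<le> k \<and> f k \<noteq> 0} \<and> open U}"
    by (intro CollectI exI[of _ "\<lambda>_. 0"] exI[of _ UNIV]) auto
  thus ?thesis unfolding vague_topology_def topology_generated_by_topspace by blast
qed

text \<open>A subbasic set tests a function of finite support and so depends on finitely many
  masses. Binary intersections take the larger \<open>N\<close>, unions the \<open>N\<close> of one
  member.\<close>

lemma vague_open_cylinder:
  assumes "openin vague_topology U" "\<nu> \<in> U"
  shows "\<exists>N. \<forall>\<nu>'\<in>counting_measures. (\<forall>k\<in>{3..N}. emeasure \<nu>' {k} = emeasure \<nu> {k}) \<longrightarrow> \<nu>' \<in> U"
proof -
  have "generate_topology_on {{\<nu> \<in> counting_measures. (\<integral>k. f k \<partial>\<nu>) \<in> U} | (f :: nat \<Rightarrow> real) U.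
        finite {k. 3 \<le> k \<and> f k \<noteq> 0} \<and> open U} U"
    using assms(1) unfolding vague_topology_def openin_topology_generated_by_iff .
  thus ?thesis using assms(2)
  proof (induction U rule: generate_topology_on.induct)
    case (Int a b)
    from Int.IH(1) Int.prems obtain N1 where
      N1: "\<And>\<nu>'. \<nu>' \<in> counting_measures \<Longrightarrow> (\<forall>k\<in>{3..N1}. emeasure \<nu>' {k} = emeasure \<nu> {k}) \<Longrightarrow> \<nu>' \<in> a" by auto
    from Int.IH(2) Int.prems obtain N2 where
      N2: "\<And>\<nu>'. \<nu>' \<in> counting_measures \<Longrightarrow> (\<forall>k\<in>{3..N2}. emeasure \<nu>' {k} = emeasure \<nu> {k}) \<Longrightarrow> \<nu>' \<in> b" by auto
    show ?case by (rule exI[of _ "max N1 N2"]) (auto intro!: N1 N2)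
  next
    case (UN S)
    then obtain s where "s \<in> S" "\<nu> \<in> s" by auto
    thus ?case using UN.IH[of s] by blast
  next
    case (Basis s)
    then obtain f :: "nat \<Rightarrow> real" and W where f: "s = {\<nu> \<in> counting_measures. (\<integral>k. f k \<partial>\<nu>) \<in> W}"
      "finite {k. 3 \<le> k \<and> f k \<noteq> 0}" by auto
    obtain N where N: "{k. 3 \<le> k \<and> f k \<noteq> 0} \<subseteq> {..N}" using finite_nat_iff_bounded_le f(2) by blast
    show ?case
    proof (intro exI[of _ N] ballI impI)
      fix \<nu>' assume \<nu>': "\<nu>' \<in> counting_measures" "\<forall>k\<in>{3..N}. emeasure \<nu>' {k} = emeasure \<nu> {k}"
      have "\<nu> \<in> counting_measures" using Basis.prems f by simp
      hence "(\<integral>k. f k \<partial>\<nu>') = (\<integral>k. f k \<partial>\<nu>)"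
        using \<nu>' f(2) N by (subst (1 2) integral_counting_measure) (auto simp: measure_def intro!: sum.cong)
      thus "\<nu>' \<in> s" using Basis.prems f(1) \<nu>' by simp
    qed
  qed simp
qed

lemma point_measure_counting:
  fixes x :: "nat \<Rightarrow> nat"
  shows "point_measure {3..} (\<lambda>k. of_nat (x k)) \<in> counting_measures"
    and "3 \<le> k \<Longrightarrow> emeasure (point_measure {3..} (\<lambda>k. of_nat (x k))) {k} = of_nat (x k)"
proof -
  show e: "emeasure (point_measure {3..} (\<lambda>k. of_nat (x k))) {k} = of_nat (x k)" if "3 \<le> k" for k
    using that by (subst emeasure_point_measure_finite2) auto
  show "point_measure {3..} (\<lambda>k. of_nat (x k)) \<in> counting_measures"
    unfolding counting_measures_def using e by (auto simp: sets_point_measure)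
qed

section \<open>Cylinder sets and approximation from below\<close>

definition agrees :: "nat \<Rightarrow> (nat \<Rightarrow> nat) \<Rightarrow> nat measure \<Rightarrow> bool" where
  "agrees N a \<nu> \<longleftrightarrow> (\<forall>k\<in>{3..N}. emeasure \<nu> {k} = of_nat (a k))"

definition cylinder_inf :: "(nat measure \<Rightarrow> real) \<Rightarrow> nat \<Rightarrow> (nat \<Rightarrow> nat) \<Rightarrow> real" where
  "cylinder_inf F N a = Inf (F ` {\<nu> \<in> counting_measures. agrees N a \<nu>})"

text \<open>The infima of \<open>F\<close> over cylinders approximate \<open>F\<close> from below by continuity and depend on
  finitely many coordinates; restricting these to a finite box makes all sums finite.\<close>

definition cylinder_step :: "(nat measure \<Rightarrow> real) \<Rightarrow> real \<Rightarrow> nat \<Rightarrow> nat \<Rightarrow> nat measure \<Rightarrow> real" where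
  "cylinder_step F B N T \<nu> =
     (\<Sum>a\<in>PiE {3..N} (\<lambda>_. {..T}). (cylinder_inf F N a + B) * of_bool (agrees N a \<nu>))"

lemma finite_box: "finite (PiE {3..N::nat} (\<lambda>_. {..T::nat}))"
  by (intro finite_PiE) auto

context
  fixes F :: "nat measure \<Rightarrow> real" and B :: real
  assumes B: "\<And>\<nu>. \<nu> \<in> counting_measures \<Longrightarrow> \<bar>F \<nu>\<bar> \<le> B"
begin

lemma cylinder_inf_bounds:
  shows "\<nu> \<in> counting_measures \<Longrightarrow> agrees N a \<nu> \<Longrightarrow> cylinder_inf F N a \<le> F \<nu>"
    and "- B \<le> cylinder_inf F N a" "cylinder_inf F N a \<le> B"
proof -
  let ?S = "{\<nu> \<in> counting_measures. agrees N a \<nu>}"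
  \<comment> \<open>Every cylinder is nonempty, so its infimum is a genuine one.\<close>
  have ne: "point_measure {3..} (\<lambda>k. of_nat (a k)) \<in> ?S"
    by (simp add: agrees_def point_measure_counting)
  have bdd: "bdd_below (F ` ?S)" by (rule bdd_belowI[of _ "- B"]) (use B in force)
  show le: "cylinder_inf F N a \<le> F \<nu>" if "\<nu> \<in> counting_measures" "agrees N a \<nu>" for \<nu>
    unfolding cylinder_inf_def using bdd that by (intro cInf_lower) auto
  show "- B \<le> cylinder_inf F N a" unfolding cylinder_inf_def
    using ne B by (intro cInf_greatest) (auto simp: abs_le_iff minus_le_iff)
  show "cylinder_inf F N a \<le> B"
    using le[of "point_measure {3..} (\<lambda>k. of_nat (a k))"] ne B[of "point_measure {3..} (\<lambda>k. of_nat (a k))"] by auto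
qed

lemma cylinder_step_eq:
  assumes \<nu>: "\<nu> \<in> counting_measures" and x: "\<And>k. 3 \<le> k \<Longrightarrow> emeasure \<nu> {k} = of_nat (x k)"
  shows "cylinder_step F B N T \<nu> =
    (if \<forall>k\<in>{3..N}. x k \<le> T then cylinder_inf F N (restrict x {3..N}) + B else 0)"
proof -
  have "agrees N a \<nu> \<longleftrightarrow> a = restrict x {3..N}" if "a \<in> PiE {3..N} (\<lambda>_. {..T})" for a
    using that x unfolding agrees_def
    by (auto simp: fun_eq_iff PiE_iff extensional_def restrict_def)
  hence "cylinder_step F B N T \<nu> =
      (\<Sum>a\<in>PiE {3..N} (\<lambda>_. {..T}). if a = restrict x {3..N} then cylinder_inf F N a + B else 0)"
    unfolding cylinder_step_def by (intro sum.cong) auto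
  also have "\<dots> = (if restrict x {3..N} \<in> PiE {3..N} (\<lambda>_. {..T}) then cylinder_inf F N (restrict x {3..N}) + B else 0)"
    using finite_box[of N T] by (rule sum.delta)
  also have "restrict x {3..N} \<in> PiE {3..N} (\<lambda>_. {..T}) \<longleftrightarrow> (\<forall>k\<in>{3..N}. x k \<le> T)"
    by (auto simp: PiE_iff)
  finally show ?thesis .
qed

lemma counting_values:
  assumes "\<nu> \<in> counting_measures"
  obtains x :: "nat \<Rightarrow> nat" where "\<And>k. 3 \<le> k \<Longrightarrow> emeasure \<nu> {k} = of_nat (x k)"
  using counting_measuresD(3)[OF assms] by metis

text \<open>Adding \<open>B\<close> makes the function nonnegative, so the value 0 outside the box
  is still a lower bound.\<close>

lemma cylinder_step_bounds:
  assumes \<nu>: "\<nu> \<in> counting_measures"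
  shows "cylinder_step F B N T \<nu> \<le> F \<nu> + B" "\<bar>cylinder_step F B N T \<nu>\<bar> \<le> 2 * B"
proof -
  obtain x :: "nat \<Rightarrow> nat" where x: "\<And>k. 3 \<le> k \<Longrightarrow> emeasure \<nu> {k} = of_nat (x k)"
    using counting_values[OF \<nu>] by blast
  have "agrees N (restrict x {3..N}) \<nu>" using x by (auto simp: agrees_def)
  note b = cylinder_inf_bounds(1)[OF \<nu> this] cylinder_inf_bounds(2,3)[of N "restrict x {3..N}"]
  have "cylinder_step F B N T \<nu> =
      (if \<forall>k\<in>{3..N}. x k \<le> T then cylinder_inf F N (restrict x {3..N}) + B else 0)"
    by (rule cylinder_step_eq[OF \<nu>]) (rule x)
  thus "cylinder_step F B N T \<nu> \<le> F \<nu> + B" "\<bar>cylinder_step F B N T \<nu>\<bar> \<le> 2 * B"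
    using b B[OF \<nu>] by auto
qed

lemma cylinder_step_limit:
  assumes \<nu>: "\<nu> \<in> counting_measures" and x: "\<And>k. 3 \<le> k \<Longrightarrow> emeasure \<nu> {k} = of_nat (x k)"
  shows "(\<lambda>T. cylinder_step F B N T \<nu>) \<longlonglongrightarrow> cylinder_inf F N (restrict x {3..N}) + B"
proof (rule tendsto_eventually, rule eventually_sequentiallyI)
  fix T assume T: "(\<Sum>k=3..N. x k) \<le> T"
  have "x k \<le> T" if "k \<in> {3..N}" for k
    using member_le_sum[OF that, of x] T by simp
  moreover have "cylinder_step F B N T \<nu> =
      (if \<forall>k\<in>{3..N}. x k \<le> T then cylinder_inf F N (restrict x {3..N}) + B else 0)"
    by (rule cylinder_step_eq[OF \<nu>]) (rule x)
  ultimately show "cylinder_step F B N T \<nu> = cylinder_inf F N (restrict x {3..N}) + B" by simp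
qed

text \<open>By continuity the set where \<open>F\<close> exceeds \<open>F \<nu> - e / 2\<close> is
  open and contains a whole cylinder around \<open>\<nu>\<close>, so the infimum over that cylinder
  cannot fall lower.\<close>

lemma cylinder_inf_limit:
  assumes F: "continuous_map vague_topology euclideanreal F"
    and \<nu>: "\<nu> \<in> counting_measures" and x: "\<And>k. 3 \<le> k \<Longrightarrow> emeasure \<nu> {k} = of_nat (x k)"
  shows "(\<lambda>N. cylinder_inf F N (restrict x {3..N})) \<longlonglongrightarrow> F \<nu>"
proof (rule LIMSEQ_I)
  fix e :: real assume e: "0 < e"
  have op: "openin vague_topology {\<nu>' \<in> topspace vague_topology. F \<nu>' \<in> {F \<nu> - e / 2<..}}"
    using F by (rule openin_continuous_map_preimage) (simp add: open_openin[symmetric])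
  have "\<nu> \<in> {\<nu>' \<in> topspace vague_topology. F \<nu>' \<in> {F \<nu> - e / 2<..}}" using \<nu> e by (simp add: topspace_vague)
  then obtain N0 where N0: "\<And>\<nu>'. \<nu>' \<in> counting_measures \<Longrightarrow> (\<forall>k\<in>{3..N0}. emeasure \<nu>' {k} = emeasure \<nu> {k}) \<Longrightarrow> F \<nu> - e / 2 < F \<nu>'"
    using vague_open_cylinder[OF op] by blast
  show "\<exists>no. \<forall>N\<ge>no. norm (cylinder_inf F N (restrict x {3..N}) - F \<nu>) < e"
  proof (intro exI[of _ N0] allI impI)
    fix N assume N: "N0 \<le> N"
    have "agrees N (restrict x {3..N}) \<nu>" using x by (auto simp: agrees_def)
    hence "cylinder_inf F N (restrict x {3..N}) \<le> F \<nu>" by (rule cylinder_inf_bounds(1)[OF \<nu>])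
    moreover have "F \<nu> - e / 2 \<le> cylinder_inf F N (restrict x {3..N})"
      unfolding cylinder_inf_def
    proof (rule cInf_greatest)
      show "F ` {\<nu> \<in> counting_measures. agrees N (restrict x {3..N}) \<nu>} \<noteq> {}"
        using \<nu> \<open>agrees N (restrict x {3..N}) \<nu>\<close> by blast
      fix y assume "y \<in> F ` {\<nu> \<in> counting_measures. agrees N (restrict x {3..N}) \<nu>}"
      then obtain \<nu>' where \<nu>': "\<nu>' \<in> counting_measures" "agrees N (restrict x {3..N}) \<nu>'" "y = F \<nu>'" by auto
      have "F \<nu> - e / 2 < F \<nu>'" using \<nu>' x N by (intro N0) (auto simp: agrees_def)
      thus "F \<nu> - e / 2 \<le> y" using \<nu>' by simp
    qed
    ultimately show "norm (cylinder_inf F N (restrict x {3..N}) - F \<nu>) < e" using e by simp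
  qed
qed

end

text \<open>The lower half of weak convergence; the upper half is the same bound for
  \<open>- F\<close>. First \<open>N\<close> and then \<open>T\<close> is fixed under the limit law
  by dominated convergence, after which only finitely many cylinder probabilities have to
  converge.\<close>

lemma cylinder_lower_bound:
  fixes P :: "nat \<Rightarrow> 'a measure" and X :: "'a \<Rightarrow> nat measure" and Q :: "'b measure" and \<eta> :: "'b \<Rightarrow> nat measure"
  assumes P: "\<And>n. prob_space (P n)" "\<And>n. sets (P n) = UNIV" and X: "\<And>n. AE \<omega> in P n. X \<omega> \<in> counting_measures"
    and Q: "prob_space Q" and \<eta>: "\<And>\<omega>. \<omega> \<in> space Q \<Longrightarrow> \<eta> \<omega> \<in> counting_measures"
    and meas: "\<And>N a. {\<omega> \<in> space Q. agrees N a (\<eta> \<omega>)} \<in> sets Q"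
    and conv: "\<And>N a. (\<lambda>n. measure (P n) {\<omega>. agrees N a (X \<omega>)}) \<longlonglongrightarrow> measure Q {\<omega> \<in> space Q. agrees N a (\<eta> \<omega>)}"
    and F: "continuous_map vague_topology euclideanreal F"
    and B: "\<And>\<nu>. \<nu> \<in> counting_measures \<Longrightarrow> \<bar>F \<nu>\<bar> \<le> B" and e: "0 < e"
  shows "eventually (\<lambda>n. (\<integral>\<omega>. F (\<eta> \<omega>) \<partial>Q) - e < (\<integral>\<omega>. F (X \<omega>) \<partial>P n)) sequentially"
proof -
  interpret Q: prob_space Q by (rule Q)
  let ?S = "cylinder_step F B"
  define x where "x \<omega> k = (SOME m::nat. emeasure (\<eta> \<omega>) {k} = of_nat m)" for \<omega> k
  have x: "emeasure (\<eta> \<omega>) {k} = of_nat (x \<omega> k)" if "\<omega> \<in> space Q" "3 \<le> k" for \<omega> k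
    unfolding x_def by (rule someI_ex) (rule counting_measuresD(3)[OF \<eta>[OF that(1)] that(2)])
  define I where "I N \<omega> = cylinder_inf F N (restrict (x \<omega>) {3..N})" for N \<omega>
  have ib: "integrable Q (\<lambda>\<omega>. of_bool (agrees N a (\<eta> \<omega>)) :: real)"
    "(\<integral>\<omega>. of_bool (agrees N a (\<eta> \<omega>)) \<partial>Q) = measure Q {\<omega> \<in> space Q. agrees N a (\<eta> \<omega>)}" for N a
  proof -
    have eq: "(\<integral>\<omega>. of_bool (agrees N a (\<eta> \<omega>)) \<partial>Q) = (\<integral>\<omega>. indicator {\<omega> \<in> space Q. agrees N a (\<eta> \<omega>)} \<omega> \<partial>Q)"
      by (intro Bochner_Integration.integral_cong) (auto simp: indicator_def)
    show "(\<integral>\<omega>. of_bool (agrees N a (\<eta> \<omega>)) \<partial>Q) = measure Q {\<omega> \<in> space Q. agrees N a (\<eta> \<omega>)}"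
      unfolding eq using meas by (simp add: Int_absorb2)
    have "integrable Q (\<lambda>\<omega>. of_bool (agrees N a (\<eta> \<omega>)) :: real) \<longleftrightarrow>
        integrable Q (indicator {\<omega> \<in> space Q. agrees N a (\<eta> \<omega>)} :: 'b \<Rightarrow> real)"
      by (intro Bochner_Integration.integrable_cong) (auto simp: indicator_def)
    thus "integrable Q (\<lambda>\<omega>. of_bool (agrees N a (\<eta> \<omega>)) :: real)"
      using meas by (simp add: integrable_real_indicator Q.emeasure_finite less_top[symmetric])
  qed
  have Sint: "integrable Q (\<lambda>\<omega>. ?S N T (\<eta> \<omega>))"
    "(\<integral>\<omega>. ?S N T (\<eta> \<omega>) \<partial>Q) = (\<Sum>a\<in>PiE {3..N} (\<lambda>_. {..T}). (cylinder_inf F N a + B) * measure Q {\<omega> \<in> space Q. agrees N a (\<eta> \<omega>)})" for N T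
    unfolding cylinder_step_def using ib by (auto simp: Bochner_Integration.integral_sum)
  have Im: "(\<lambda>\<omega>. I N \<omega> + B) \<in> borel_measurable Q" for N
  proof (rule borel_measurable_LIMSEQ_real)
    show "(\<lambda>\<omega>. ?S N T (\<eta> \<omega>)) \<in> borel_measurable Q" for T using Sint(1) by simp
    show "(\<lambda>T. ?S N T (\<eta> \<omega>)) \<longlonglongrightarrow> I N \<omega> + B" if "\<omega> \<in> space Q" for \<omega>
      unfolding I_def by (rule cylinder_step_limit[OF B \<eta>[OF that] x[OF that]])
  qed
  have Ilim: "(\<lambda>N. I N \<omega> + B) \<longlonglongrightarrow> F (\<eta> \<omega>) + B" if "\<omega> \<in> space Q" for \<omega>
    unfolding I_def by (intro tendsto_add tendsto_const cylinder_inf_limit[OF B F \<eta>[OF that] x[OF that]])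
  \<comment> \<open>\<open>F\<close> composed with \<open>\<eta>\<close> is measurable as a limit of
    functions that are built from cylinder events.\<close>
  have Fm: "(\<lambda>\<omega>. F (\<eta> \<omega>) + B) \<in> borel_measurable Q"
    by (rule borel_measurable_LIMSEQ_real[OF Ilim Im])
  have Fi: "integrable Q (\<lambda>\<omega>. F (\<eta> \<omega>) + B)"
    using B \<eta> by (intro Q.integrable_const_bound[where B = "2 * B"] Fm AE_I2) (force simp: abs_le_iff)
  hence Fi': "integrable Q (\<lambda>\<omega>. F (\<eta> \<omega>))"
    using Bochner_Integration.integrable_diff[OF Fi Q.integrable_const[of B]] by simp
  have "(\<lambda>N. \<integral>\<omega>. I N \<omega> + B \<partial>Q) \<longlonglongrightarrow> (\<integral>\<omega>. F (\<eta> \<omega>) + B \<partial>Q)"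
  proof (rule integral_dominated_convergence[where w = "\<lambda>_. 2 * B"])
    show "AE \<omega> in Q. norm (I N \<omega> + B) \<le> 2 * B" for N
    proof (rule AE_I2)
      fix \<omega> show "norm (I N \<omega> + B) \<le> 2 * B"
        using cylinder_inf_bounds(2)[of F B N "restrict (x \<omega>) {3..N}"]
          cylinder_inf_bounds(3)[of F B N "restrict (x \<omega>) {3..N}"] B unfolding I_def by auto
    qed
  qed (use Fm Im Ilim in auto)
  moreover have "(\<integral>\<omega>. F (\<eta> \<omega>) + B \<partial>Q) = (\<integral>\<omega>. F (\<eta> \<omega>) \<partial>Q) + B"
    using Fi' by (simp add: Q.prob_space)
  ultimately have "eventually (\<lambda>N. (\<integral>\<omega>. F (\<eta> \<omega>) \<partial>Q) + B - e < (\<integral>\<omega>. I N \<omega> + B \<partial>Q)) sequentially"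
    using e by (intro order_tendstoD) auto
  then obtain N where N: "(\<integral>\<omega>. F (\<eta> \<omega>) \<partial>Q) + B - e < (\<integral>\<omega>. I N \<omega> + B \<partial>Q)"
    by (auto simp: eventually_sequentially)
  have "(\<lambda>T. \<integral>\<omega>. ?S N T (\<eta> \<omega>) \<partial>Q) \<longlonglongrightarrow> (\<integral>\<omega>. I N \<omega> + B \<partial>Q)"
  proof (rule integral_dominated_convergence[where w = "\<lambda>_. 2 * B"])
    show "AE \<omega> in Q. norm (?S N T (\<eta> \<omega>)) \<le> 2 * B" for T
      using cylinder_step_bounds(2)[OF B \<eta>] by (intro AE_I2) simp
    show "AE \<omega> in Q. (\<lambda>T. ?S N T (\<eta> \<omega>)) \<longlonglongrightarrow> I N \<omega> + B"
      unfolding I_def by (rule AE_I2) (rule cylinder_step_limit[OF B \<eta> x])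
  qed (use Im Sint in auto)
  hence "eventually (\<lambda>T. (\<integral>\<omega>. F (\<eta> \<omega>) \<partial>Q) + B - e < (\<integral>\<omega>. ?S N T (\<eta> \<omega>) \<partial>Q)) sequentially"
    using N by (rule order_tendstoD)
  then obtain T where T: "(\<integral>\<omega>. F (\<eta> \<omega>) \<partial>Q) + B - e < (\<integral>\<omega>. ?S N T (\<eta> \<omega>) \<partial>Q)"
    by (auto simp: eventually_sequentially)
  have "(\<lambda>n. \<Sum>a\<in>PiE {3..N} (\<lambda>_. {..T}). (cylinder_inf F N a + B) * measure (P n) {\<omega>. agrees N a (X \<omega>)})
      \<longlonglongrightarrow> (\<integral>\<omega>. ?S N T (\<eta> \<omega>) \<partial>Q)"
    unfolding Sint(2) by (intro tendsto_intros conv)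
  hence "eventually (\<lambda>n. (\<integral>\<omega>. F (\<eta> \<omega>) \<partial>Q) + B - e <
      (\<Sum>a\<in>PiE {3..N} (\<lambda>_. {..T}). (cylinder_inf F N a + B) * measure (P n) {\<omega>. agrees N a (X \<omega>)})) sequentially"
    using T by (rule order_tendstoD)
  thus ?thesis
  proof eventually_elim
    fix n assume n: "(\<integral>\<omega>. F (\<eta> \<omega>) \<partial>Q) + B - e <
      (\<Sum>a\<in>PiE {3..N} (\<lambda>_. {..T}). (cylinder_inf F N a + B) * measure (P n) {\<omega>. agrees N a (X \<omega>)})"
    interpret Pn: prob_space "P n" by (rule P(1))
    have allm: "f \<in> borel_measurable (P n)" for f :: "'a \<Rightarrow> real"
      by (auto simp: measurable_def P(2))
    have sp: "space (P n) = UNIV" using P(2)[of n] sets.sets_into_space[of UNIV "P n"] by auto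
    have ind: "integrable (P n) (\<lambda>\<omega>. of_bool (R \<omega>) :: real)"
      "(\<integral>\<omega>. of_bool (R \<omega>) \<partial>P n) = measure (P n) {\<omega>. R \<omega>}" for R
    proof -
      show "integrable (P n) (\<lambda>\<omega>. of_bool (R \<omega>) :: real)"
        by (rule Pn.integrable_const_bound[where B = 1]) (auto intro: allm)
      have "(\<integral>\<omega>. of_bool (R \<omega>) \<partial>P n) = (\<integral>\<omega>. indicator {\<omega>. R \<omega>} \<omega> \<partial>P n)"
        by (intro Bochner_Integration.integral_cong) (auto simp: indicator_def)
      also have "\<dots> = measure (P n) {\<omega>. R \<omega>}" by (simp add: P(2) sp)
      finally show "(\<integral>\<omega>. of_bool (R \<omega>) \<partial>P n) = measure (P n) {\<omega>. R \<omega>}" .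
    qed
    have Si: "integrable (P n) (\<lambda>\<omega>. ?S N T (X \<omega>))" and
      Se: "(\<integral>\<omega>. ?S N T (X \<omega>) \<partial>P n) = (\<Sum>a\<in>PiE {3..N} (\<lambda>_. {..T}). (cylinder_inf F N a + B) * measure (P n) {\<omega>. agrees N a (X \<omega>)})"
      unfolding cylinder_step_def using ind by (auto simp: Bochner_Integration.integral_sum)
    have FX: "integrable (P n) (\<lambda>\<omega>. F (X \<omega>))"
      by (rule Pn.integrable_const_bound[where B = B]) (use X[of n] B allm in auto)
    have "(\<integral>\<omega>. ?S N T (X \<omega>) \<partial>P n) \<le> (\<integral>\<omega>. F (X \<omega>) + B \<partial>P n)"
    proof (rule integral_mono_AE[OF Si])
      show "AE \<omega> in P n. ?S N T (X \<omega>) \<le> F (X \<omega>) + B"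
        using X[of n] by eventually_elim (rule cylinder_step_bounds(1)[OF B])
    qed (use FX in simp)
    also have "\<dots> = (\<integral>\<omega>. F (X \<omega>) \<partial>P n) + B" using FX by (simp add: Pn.prob_space)
    finally show "(\<integral>\<omega>. F (\<eta> \<omega>) \<partial>Q) - e < (\<integral>\<omega>. F (X \<omega>) \<partial>P n)" using n Se by linarith
  qed
qed

lemma converges_in_distribution_vagueI:
  fixes P :: "nat \<Rightarrow> 'a measure" and X :: "'a \<Rightarrow> nat measure" and Q :: "'b measure" and \<eta> :: "'b \<Rightarrow> nat measure"
  assumes P: "\<And>n. prob_space (P n)" "\<And>n. sets (P n) = UNIV" and X: "\<And>n. AE \<omega> in P n. X \<omega> \<in> counting_measures"
    and Q: "prob_space Q" and \<eta>: "\<And>\<omega>. \<omega> \<in> space Q \<Longrightarrow> \<eta> \<omega> \<in> counting_measures"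
    and meas: "\<And>N a. {\<omega> \<in> space Q. agrees N a (\<eta> \<omega>)} \<in> sets Q"
    and conv: "\<And>N a. (\<lambda>n. measure (P n) {\<omega>. agrees N a (X \<omega>)}) \<longlonglongrightarrow> measure Q {\<omega> \<in> space Q. agrees N a (\<eta> \<omega>)}"
  shows "converges_in_distribution vague_topology P (\<lambda>n. X) Q \<eta>"
  unfolding converges_in_distribution_def
proof (intro allI impI)
  fix F assume F: "continuous_map vague_topology euclideanreal F \<and> bounded (F ` topspace vague_topology)"
  then obtain B where "\<forall>y\<in>F ` counting_measures. norm y \<le> B"
    unfolding topspace_vague bounded_iff by blast
  hence B: "\<And>\<nu>. \<nu> \<in> counting_measures \<Longrightarrow> \<bar>F \<nu>\<bar> \<le> B" by auto
  have Fc: "continuous_map vague_topology euclideanreal F" using F by blast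
  have Fm: "continuous_map vague_topology euclideanreal (\<lambda>\<nu>. - F \<nu>)" by (intro continuous_map_minus Fc)
  have Bm: "\<And>\<nu>. \<nu> \<in> counting_measures \<Longrightarrow> \<bar>- F \<nu>\<bar> \<le> B" using B by simp
  show "(\<lambda>n. \<integral>\<omega>. F (X \<omega>) \<partial>P n) \<longlonglongrightarrow> (\<integral>\<omega>. F (\<eta> \<omega>) \<partial>Q)"
  proof (rule tendstoI)
    fix e :: real assume e: "0 < e"
    show "eventually (\<lambda>n. dist (\<integral>\<omega>. F (X \<omega>) \<partial>P n) (\<integral>\<omega>. F (\<eta> \<omega>) \<partial>Q) < e) sequentially"
    proof -
      have "eventually (\<lambda>n. (\<integral>\<omega>. F (\<eta> \<omega>) \<partial>Q) - e < (\<integral>\<omega>. F (X \<omega>) \<partial>P n)) sequentially"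
        by (rule cylinder_lower_bound[OF P X Q _ meas conv Fc _ e]) (fact \<eta> B)+
      moreover have "eventually (\<lambda>n. (\<integral>\<omega>. - F (\<eta> \<omega>) \<partial>Q) - e < (\<integral>\<omega>. - F (X \<omega>) \<partial>P n)) sequentially"
        by (rule cylinder_lower_bound[OF P X Q _ meas conv Fm _ e]) (fact \<eta> Bm)+
      ultimately show ?thesis by eventually_elim (simp add: dist_real_def)
    qed
  qed
qed

section \<open>Joint convergence of the cycle counts\<close>

lemma poisson_mean_point: "poisson_mean l (\<lambda>j. of_bool (j = a)) = exp (- l) * l ^ a / fact a"
proof -
  have "poisson_mean l (\<lambda>j. of_bool (j = a)) = (\<Sum>j\<in>{a}. exp (- l) * (l ^ j / fact j) * of_bool (j = a))"
    unfolding poisson_mean_def by (rule suminf_finite) auto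
  thus ?thesis by simp
qed

text \<open>The qualitative counterpart of \<open>linearized_estimate\<close>, for weights without
  fourth moments: on the event of small deviations both error parameters are controlled by
  \<open>\<delta>\<close> and \<open>t\<close>.\<close>

lemma (in graph_weights) concentration_rate:
  fixes m1 m2 \<delta> t :: real
  assumes m: "0 < m1" "0 < m2" and \<delta>: "0 < \<delta>" "\<delta> \<le> m1 / 2"
    and dev: "\<bar>dev1 m1\<bar> \<le> \<delta> * n" "\<bar>dev2 m2\<bar> \<le> \<delta> * n" and S4: "S4 \<le> t * real n ^ 2"
  shows "\<bar>R - m2 / m1\<bar> \<le> 2 * (1 + m2 / m1) * \<delta> / m1" "eps \<le> 4 * t / m1 ^ 2"
proof -
  have n0: "0 < real n" using n by simp
  have "\<delta> * n \<le> m1 / 2 * n" using \<delta> by (intro mult_right_mono) auto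
  hence L: "n * m1 / 2 \<le> L" using dev(1) unfolding dev1_def by (simp add: mult.commute)
  have nm: "0 < n * m1 / 2" using n0 m by simp
  have "R - m2 / m1 = (dev2 m2 - m2 / m1 * dev1 m1) / L"
    using L_pos m unfolding R_eq dev1_def dev2_def by (simp add: field_simps)
  hence "\<bar>R - m2 / m1\<bar> = \<bar>dev2 m2 - m2 / m1 * dev1 m1\<bar> / L" using L_pos by (simp add: abs_divide)
  also have "\<dots> \<le> ((1 + m2 / m1) * (\<delta> * n)) / (n * m1 / 2)"
  proof (rule frac_le)
    have "\<bar>dev2 m2 - m2 / m1 * dev1 m1\<bar> \<le> \<bar>dev2 m2\<bar> + \<bar>m2 / m1 * dev1 m1\<bar>" by (rule abs_triangle_ineq4)
    also have "\<bar>m2 / m1 * dev1 m1\<bar> = m2 / m1 * \<bar>dev1 m1\<bar>" using m by (simp add: abs_mult)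
    also have "\<bar>dev2 m2\<bar> + m2 / m1 * \<bar>dev1 m1\<bar> \<le> \<delta> * n + m2 / m1 * (\<delta> * n)"
      using dev m by (intro add_mono mult_left_mono) auto
    finally show "\<bar>dev2 m2 - m2 / m1 * dev1 m1\<bar> \<le> (1 + m2 / m1) * (\<delta> * n)" by (simp add: algebra_simps)
  qed (use L nm m \<delta> in auto)
  also have "\<dots> = 2 * (1 + m2 / m1) * \<delta> / m1" using n0 m by (simp add: field_simps)
  finally show "\<bar>R - m2 / m1\<bar> \<le> 2 * (1 + m2 / m1) * \<delta> / m1" .
  have S0: "0 \<le> S4" unfolding S4_def by (intro sum_nonneg) (simp add: zero_le_even_power)
  have "eps \<le> (t * real n ^ 2) / (n * m1 / 2) ^ 2"
    unfolding eps_eq using S4 S0 L nm by (intro frac_le power_mono zero_less_power) auto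
  also have "\<dots> = 4 * t / m1 ^ 2" using n0 m by (simp add: field_simps power2_eq_square)
  finally show "eps \<le> 4 * t / m1 ^ 2" .
qed

context weight_law
begin

text \<open>Only the second moment is used: the large squares contribute little to \<open>\<Sum>i. w i ^ 2\<close>.\<close>

lemma fourth_powers_negligible:
  fixes t :: real
  assumes i2: "integrable \<mu> (\<lambda>x. x ^ 2)" and t: "0 < t"
  shows "(\<lambda>n. measure (PW n) {w \<in> space (PW n). t * real n ^ 2 < (\<Sum>i=1..n. w i ^ 4)}) \<longlonglongrightarrow> 0"
proof (rule LIMSEQ_I)
  fix e :: real assume e: "0 < e"
  define m2 where "m2 = (\<integral>x. x ^ 2 \<partial>\<mu>)"
  have m2: "0 < m2" using moment_pos[OF i2] by (simp add: m2_def)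
  \<comment> \<open>Chosen so that the final bound \<open>2 * (m2 + 1) * \<eta> * n ^ 2\<close> is
    \<open>t * n ^ 2\<close>.\<close>
  define \<eta> where "\<eta> = t / (2 * (m2 + 1))"
  have \<eta>: "0 < \<eta>" using t m2 by (simp add: \<eta>_def)
  define g where "g K x = (if real K < x ^ 2 then x ^ 2 else 0)" for K and x :: real
  have idm[measurable]: "(\<lambda>x. x) \<in> borel_measurable \<mu>" by (simp add: measurable_cong_sets[OF sets_mu refl])
  have gm[measurable]: "g K \<in> borel_measurable \<mu>" for K unfolding g_def by measurable
  have "(\<lambda>K. \<integral>x. g K x \<partial>\<mu>) \<longlonglongrightarrow> (\<integral>x. 0 \<partial>\<mu>)"
  proof (rule integral_dominated_convergence[where w = "\<lambda>x. x ^ 2"])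
    show "AE x in \<mu>. (\<lambda>K. g K x) \<longlonglongrightarrow> 0"
    proof (rule AE_I2)
      fix x :: real
      have "eventually (\<lambda>K. g K x = 0) sequentially"
      proof (rule eventually_sequentiallyI[of "nat \<lceil>x ^ 2\<rceil>"])
        fix K assume "nat \<lceil>x ^ 2\<rceil> \<le> K"
        hence "x ^ 2 \<le> real K" by linarith
        thus "g K x = 0" by (simp add: g_def)
      qed
      thus "(\<lambda>K. g K x) \<longlonglongrightarrow> 0" by (rule tendsto_eventually)
    qed
    show "AE x in \<mu>. norm (g K x) \<le> x ^ 2" for K by (rule AE_I2) (simp add: g_def)
  qed (use i2 in simp_all)
  hence "eventually (\<lambda>K. (\<integral>x. g K x \<partial>\<mu>) < \<eta> * e / 2) sequentially"
    using \<eta> e by (intro order_tendstoD) auto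
  then obtain K where K: "(\<integral>x. g K x \<partial>\<mu>) < \<eta> * e / 2" by (auto simp: eventually_sequentially)
  have gi: "integrable \<mu> (g K)"
    by (rule Bochner_Integration.integrable_bound[OF i2]) (auto simp: g_def)
  have wl: "(\<lambda>n. measure (PW n) {w \<in> space (PW n). real n < \<bar>\<Sum>i=1..n. w i ^ 2 - m2\<bar>}) \<longlonglongrightarrow> 0"
    unfolding m2_def using weak_law[OF i2, of 1] by simp
  hence "eventually (\<lambda>n. measure (PW n) {w \<in> space (PW n). real n < \<bar>\<Sum>i=1..n. w i ^ 2 - m2\<bar>} < e / 2) sequentially"
    using e by (intro order_tendstoD) auto
  then obtain n0 where n0: "\<And>n. n0 \<le> n \<Longrightarrow> measure (PW n) {w \<in> space (PW n). real n < \<bar>\<Sum>i=1..n. w i ^ 2 - m2\<bar>} < e / 2"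
    by (auto simp: eventually_sequentially)
  show "\<exists>no. \<forall>n\<ge>no. norm (measure (PW n) {w \<in> space (PW n). t * real n ^ 2 < (\<Sum>i=1..n. w i ^ 4)} - 0) < e"
  proof (intro exI allI impI)
    fix n assume n: "max (max 1 n0) (nat \<lceil>K / \<eta>\<rceil>) \<le> n"
    hence n1: "1 \<le> n" "n0 \<le> n" "K / \<eta> \<le> n" by linarith+
    have Kn: "K \<le> \<eta> * n" using n1(3) \<eta> by (simp add: pos_divide_le_eq mult.commute)
    interpret P: prob_space "PW n" by (rule prob_space_PW)
    let ?A = "{w \<in> space (PW n). real n < \<bar>\<Sum>i=1..n. w i ^ 2 - m2\<bar>}"
    let ?B = "{w \<in> space (PW n). \<eta> * n \<le> (\<Sum>i=1..n. g K (w i))}"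
    note GI = sum_integral[OF gi, of n]
    have [measurable]: "(\<lambda>w. \<Sum>i=1..n. g K (w i)) \<in> borel_measurable (PW n)" using GI(1) by simp
    have cm[measurable]: "(\<lambda>w. \<Sum>i=1..n. w i ^ 2 - m2) \<in> borel_measurable (PW n)"
      using sum_integral(1)[of "\<lambda>x. x ^ 2 - m2" n] i2 by simp
    have meas: "?A \<in> sets (PW n)" "?B \<in> sets (PW n)" by measurable
    have B: "measure (PW n) ?B < e / 2"
    proof -
      have "measure (PW n) ?B \<le> (\<integral>w. (\<Sum>i=1..n. g K (w i)) \<partial>PW n) / (\<eta> * n)"
        using GI(1) \<eta> n1 by (intro integral_Markov_inequality_measure[where A = "{}"])
          (auto simp: g_def intro!: AE_I2 sum_nonneg)
      also have "\<dots> = (\<integral>x. g K x \<partial>\<mu>) / \<eta>" using GI(2) n1 by simp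
      also have "\<dots> < e / 2" using K \<eta> by (simp add: pos_divide_less_eq mult.commute)
      finally show ?thesis .
    qed
    have "measure (PW n) {w \<in> space (PW n). t * real n ^ 2 < (\<Sum>i=1..n. w i ^ 4)} \<le> measure (PW n) (?A \<union> ?B)"
    proof (rule P.finite_measure_mono)
      show "{w \<in> space (PW n). t * real n ^ 2 < (\<Sum>i=1..n. w i ^ 4)} \<subseteq> ?A \<union> ?B"
      proof (rule subsetI, rule ccontr)
        fix w assume w: "w \<in> {w \<in> space (PW n). t * real n ^ 2 < (\<Sum>i=1..n. w i ^ 4)}" and nw: "w \<notin> ?A \<union> ?B"
        have g0: "0 \<le> g K x" for x by (simp add: g_def)
        have a: "(\<Sum>i=1..n. w i ^ 2) \<le> (m2 + 1) * n"
        proof -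
          have "\<bar>\<Sum>i=1..n. w i ^ 2 - m2\<bar> \<le> n" using w nw by auto
          hence "(\<Sum>i=1..n. w i ^ 2 - m2) \<le> n" by linarith
          thus ?thesis by (simp add: sum_subtractf algebra_simps)
        qed
        have b: "(\<Sum>i=1..n. g K (w i)) < \<eta> * n" using w nw by auto
        \<comment> \<open>Outside \<open>?A\<close> and \<open>?B\<close> no single square exceeds
          \<open>2 * \<eta> * n\<close>: it is at most \<open>K\<close> or part of the small sum of
          large squares. The fourth powers then sum to at most this bound times the sum of
          squares.\<close>
        have le: "w i ^ 2 \<le> 2 * (\<eta> * n)" if i: "i \<in> {1..n}" for i
        proof -
          have "w i ^ 2 \<le> K + g K (w i)" by (simp add: g_def)
          also have "g K (w i) \<le> (\<Sum>i=1..n. g K (w i))"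
            using g0 by (intro member_le_sum[OF i, where f = "\<lambda>i. g K (w i)"]) auto
          finally show ?thesis using b Kn by linarith
        qed
        have "(\<Sum>i=1..n. w i ^ 4) \<le> (\<Sum>i=1..n. w i ^ 2 * (2 * (\<eta> * n)))"
        proof (rule sum_mono)
          fix i assume "i \<in> {1..n}"
          hence "w i ^ 2 * w i ^ 2 \<le> w i ^ 2 * (2 * (\<eta> * n))" by (intro mult_left_mono le) auto
          thus "w i ^ 4 \<le> w i ^ 2 * (2 * (\<eta> * n))" by (simp add: power_add[symmetric])
        qed
        also have "\<dots> = (\<Sum>i=1..n. w i ^ 2) * (2 * (\<eta> * n))" by (simp only: sum_distrib_right)
        also have "\<dots> \<le> (m2 + 1) * n * (2 * (\<eta> * n))" using a \<eta> by (intro mult_right_mono) auto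
        also have "\<dots> = ((2 * (m2 + 1)) * \<eta>) * real n ^ 2" by (simp add: power2_eq_square)
        also have "(2 * (m2 + 1)) * \<eta> = t" using m2 by (simp add: \<eta>_def)
        finally show False using w by simp
      qed
    qed (use meas in auto)
    also have "\<dots> \<le> measure (PW n) ?A + measure (PW n) ?B"
      using meas by (intro measure_Un_le)
    also have "\<dots> < e" using add_strict_mono[OF n0[OF n1(2)] B] by simp
    finally show "norm (measure (PW n) {w \<in> space (PW n). t * real n ^ 2 < (\<Sum>i=1..n. w i ^ 4)} - 0) < e" by simp
  qed
qed

text \<open>Stein's method for the count of length \<open>k\<close>, tested together with the
  indicator \<open>\<xi>\<close> of the counts with lengths in \<open>J\<close>. A cycle of length
  \<open>k\<close> added without excursion changes none of these, so the indicator factors out in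
  the limit.\<close>

lemma joint_step:
  fixes a :: "nat \<Rightarrow> nat"
  assumes i2: "integrable \<mu> (\<lambda>x. x ^ 2)"
  defines "r \<equiv> (\<integral>x. x ^ 2 \<partial>\<mu>) / (\<integral>x. x \<partial>\<mu>)"
  assumes k: "k \<in> {3..N}" and J: "J \<subseteq> {3..N}" "k \<notin> J"
  shows "(\<lambda>n. measure (RG model n) {G. \<forall>j\<in>insert k J. cycle_count G {j} = a j} -
     poisson_mean (r ^ k / (2 * real k)) (\<lambda>j. of_bool (j = a k)) * measure (RG model n) {G. \<forall>j\<in>J. cycle_count G {j} = a j}) \<longlonglongrightarrow> 0"
proof -
  define m1 m2 where "m1 = (\<integral>x. x \<partial>\<mu>)" and "m2 = (\<integral>x. x ^ 2 \<partial>\<mu>)"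
  have r: "r = m2 / m1" by (simp add: r_def m1_def m2_def)
  have i1: "integrable \<mu> (\<lambda>x. x)" using integrable_power_le[OF i2, of 1] by simp
  have m: "0 < m1" "0 < m2" using moment_pos[of 1] moment_pos[of 2] i1 i2 by (simp_all add: m1_def m2_def)
  have r0: "0 < r" using m by (simp add: r)
  define l where "l = r ^ k / (2 * real k)"
  have l0: "0 \<le> l" using r0 by (simp add: l_def)
  have lK: "cycle_rate_sum {k} r = l" by (simp add: cycle_rate_sum_def l_def)
  define h :: "nat \<Rightarrow> real" where "h j = of_bool (j = a k)" for j
  define c where "c = poisson_mean l h"
  have h1: "\<bar>h j\<bar> \<le> 1" for j by (simp add: h_def)
  have c1: "\<bar>c\<bar> \<le> 1" unfolding c_def by (rule poisson_mean_le[OF l0 h1])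
  obtain g where g: "\<And>j. \<bar>g j\<bar> \<le> 2 * exp l" "\<And>j. l * g (Suc j) - real j * g j = h j - c"
    unfolding c_def by (rule stein_poisson_solution[where h = h, OF l0 h1]) blast
  define b where "b = 2 * exp l"
  have b0: "0 < b" by (simp add: b_def)
  obtain M where M: "1 \<le> M" "\<And>K. K \<subseteq> {3..N} \<Longrightarrow> cycle_bound N K (r + 1) M"
    using cycle_bound_finite[of "r + 1" N] r0 by auto
  have K: "{k} \<subseteq> {3..N}" "{k} \<subseteq> {3..}" using k by auto
  define \<xi> :: "nat set set \<Rightarrow> real" where "\<xi> G = of_bool (\<forall>j\<in>J. cycle_count G {j} = a j)" for G
  have \<xi>1: "\<bar>\<xi> G\<bar> \<le> 1" for G by (simp add: \<xi>_def)
  define D where "D = b * M * 2 * (1 + r) / m1 + b * (M + M ^ 2) * 4 / m1 ^ 2"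
  have D: "0 < D" unfolding D_def using b0 M r0 m
    by (intro add_pos_pos mult_pos_pos divide_pos_pos) auto
  define p where "p n = (\<integral>G. h (cycle_count G {k}) * \<xi> G \<partial>RG model n) - c * (\<integral>G. \<xi> G \<partial>RG model n)" for n
  have lim: "(\<lambda>n. p n) \<longlonglongrightarrow> 0"
  proof (rule LIMSEQ_I)
    fix e :: real assume e: "0 < e"
    \<comment> \<open>The three constraints give \<open>D * \<delta> \<le> e / 2\<close>, the
      hypothesis of \<open>concentration_rate\<close>, and \<open>R \<le> r + 1\<close>.\<close>
    define \<delta> where "\<delta> = min (e / (2 * D)) (min (m1 / 2) (m1 / (2 * (1 + r))))"
    have \<delta>: "0 < \<delta>" "\<delta> \<le> m1 / 2"       unfolding \<delta>_def by (rule min.coboundedI2[OF min.cobounded1] | use e D m r0 in simp)+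
    have \<delta>D: "D * \<delta> \<le> e / 2"
    proof -
      have "\<delta> \<le> e / (2 * D)" by (simp add: \<delta>_def)
      thus ?thesis using D by (simp add: field_simps)
    qed
    have \<delta>r: "2 * (1 + r) * \<delta> / m1 \<le> 1"
    proof -
      have "\<delta> \<le> m1 / (2 * (1 + r))" by (simp add: \<delta>_def)
      thus ?thesis using m r0 by (simp add: field_simps)
    qed
    define A1 where "A1 n = {w \<in> space (PW n). \<delta> * n < \<bar>\<Sum>i=1..n. w i - m1\<bar>}" for n
    define A2 where "A2 n = {w \<in> space (PW n). \<delta> * n < \<bar>\<Sum>i=1..n. w i ^ 2 - m2\<bar>}" for n
    define A3 where "A3 n = {w \<in> space (PW n). \<delta> * real n ^ 2 < (\<Sum>i=1..n. w i ^ 4)}" for n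
    have idm: "(\<lambda>x. x ^ j) \<in> borel_measurable \<mu>" for j by (simp add: measurable_cong_sets[OF sets_mu refl])
    have meas: "A1 n \<in> sets (PW n)" "A2 n \<in> sets (PW n)" "A3 n \<in> sets (PW n)" for n
    proof -
      have [measurable]: "(\<lambda>w. \<Sum>i=1..n. w i - m1) \<in> borel_measurable (PW n)"
        using sum_integral(1)[of "\<lambda>x. x - m1" n] i1 by simp
      have [measurable]: "(\<lambda>w. \<Sum>i=1..n. w i ^ 2 - m2) \<in> borel_measurable (PW n)"
        using sum_integral(1)[of "\<lambda>x. x ^ 2 - m2" n] i2 by simp
      have [measurable]: "(\<lambda>w. \<Sum>i=1..n. w i ^ 4) \<in> borel_measurable (PW n)"
        by (intro borel_measurable_sum measurable_comp[OF _ idm])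
      show "A1 n \<in> sets (PW n)" "A2 n \<in> sets (PW n)" "A3 n \<in> sets (PW n)"
        unfolding A1_def A2_def A3_def by measurable
    qed
    have "(\<lambda>n. 2 * (measure (PW n) (A1 n) + measure (PW n) (A2 n) + measure (PW n) (A3 n))) \<longlonglongrightarrow> 2 * (0 + 0 + 0)"
      unfolding A1_def A2_def A3_def m1_def m2_def
      by (intro tendsto_intros weak_law[OF i1 \<delta>(1)] weak_law[OF i2 \<delta>(1)] fourth_powers_negligible[OF i2 \<delta>(1)])
    hence "eventually (\<lambda>n. 2 * (measure (PW n) (A1 n) + measure (PW n) (A2 n) + measure (PW n) (A3 n)) < e / 2) sequentially"
      using e by (intro order_tendstoD) auto
    then obtain n0 where n0: "\<And>n. n0 \<le> n \<Longrightarrow> 2 * (measure (PW n) (A1 n) + measure (PW n) (A2 n) + measure (PW n) (A3 n)) < e / 2"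
      by (auto simp: eventually_sequentially)
    show "\<exists>no. \<forall>n\<ge>no. norm (p n - 0) < e"
    proof (intro exI allI impI)
      fix n assume "max 1 n0 \<le> n"
      hence n: "0 < n" "n0 \<le> n" by auto
      interpret P: prob_space "PW n" by (rule prob_space_PW)
      define E1 where "E1 w = measure_pmf.expectation (graph_given_weights model n w) (\<lambda>G. h (cycle_count G {k}) * \<xi> G)" for w
      define E2 where "E2 w = measure_pmf.expectation (graph_given_weights model n w) \<xi>" for w
      have hx: "\<bar>h (cycle_count G {k}) * \<xi> G\<bar> \<le> 1" for G by (simp add: h_def \<xi>_def)
      note I1 = RG_integral[where h = "\<lambda>G. h (cycle_count G {k}) * \<xi> G" and model = model and n = n, OF hx, folded E1_def]
        and I2 = RG_integral[where h = \<xi> and model = model and n = n, OF \<xi>1, folded E2_def]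
      \<comment> \<open>On the exceptional events the difference is at most 2, which the indicators
        cover.\<close>
      define Y where "Y w = D * \<delta> + 2 * (indicator (A1 n) w + indicator (A2 n) w + indicator (A3 n) w)" for w
      have ii: "integrable (PW n) (indicator (A1 n) :: _ \<Rightarrow> real)" "integrable (PW n) (indicator (A2 n) :: _ \<Rightarrow> real)"
        "integrable (PW n) (indicator (A3 n) :: _ \<Rightarrow> real)"
        using meas by (auto simp: integrable_real_indicator P.emeasure_finite less_top[symmetric])
      have Yi: "integrable (PW n) Y" unfolding Y_def using ii by auto
      have "AE w in PW n. \<bar>E1 w - c * E2 w\<bar> \<le> Y w"
        using AE_pos[of n] AE_space
      proof eventually_elim
        case (elim w)
        interpret graph_weights model n w using n elim by unfold_locales auto
        have E: "E1 w = E (\<lambda>G. h (cycle_count G {k}) * \<xi> G)" "E2 w = E \<xi>" by (simp_all add: E1_def E2_def P_def)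
        show ?case
        proof (cases "w \<in> A1 n \<union> A2 n \<union> A3 n")
          case True
          have "\<bar>E1 w - c * E2 w\<bar> \<le> 1 + 1 * 1"
          proof -
            have "\<bar>c * E2 w\<bar> \<le> 1 * 1" unfolding abs_mult using c1 I2(2)[of w] by (intro mult_mono) auto
            thus ?thesis using I1(2)[of w] abs_triangle_ineq4[of "E1 w" "c * E2 w"] by linarith
          qed
          moreover have "2 \<le> Y w" using True D \<delta> by (auto simp: Y_def indicator_def)
          ultimately show ?thesis by simp
        next
          case False
          hence dev: "\<bar>dev1 m1\<bar> \<le> \<delta> * n" "\<bar>dev2 m2\<bar> \<le> \<delta> * n" "S4 \<le> \<delta> * real n ^ 2"
            using elim(2) by (auto simp: A1_def A2_def A3_def dev1_def dev2_def S4_def L_def V_def sum_subtractf)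
          note C = concentration_rate[OF m \<delta> dev, folded r]
          have Rq: "R \<le> r + 1" using C(1) \<delta>r by linarith
          have "\<bar>E1 w - c * E2 w - (l - cycle_rate_sum {k} R) * E (\<lambda>G. g (Suc (cycle_count G {k})) * \<xi> G)\<bar> \<le> b * (M + M ^ 2) * eps"
            unfolding E
          proof (rule stein_step[OF K(1) M(2)[OF K(1)] Rq _ g(2) \<xi>1])
            show "\<bar>g j\<bar> \<le> b" for j unfolding b_def by (rule g(1))
            fix C G assume C: "C \<in> cycles (all_edges V)" "card C \<in> {k}" "G \<subseteq> all_edges V" "\<not> has_excursion N C G"
            have "finite G" using finite_subset[OF C(3) finite_all_edges[OF finite_V]] .
            hence "cycle_count (G \<union> C) {j} = cycle_count G {j}" if "j \<in> J" for j
              using cycle_count_Un_cycle[OF C(1) _ C(4), of "{j}"] C(2) k J that by auto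
            thus "\<xi> (G \<union> C) = \<xi> G" by (simp add: \<xi>_def)
          qed
          moreover have "\<bar>(l - cycle_rate_sum {k} R) * E (\<lambda>G. g (Suc (cycle_count G {k})) * \<xi> G)\<bar> \<le> M * (2 * (1 + r) * \<delta> / m1) * b"
            unfolding abs_mult
          proof (rule mult_mono)
            have "\<bar>cycle_rate_sum {k} R - cycle_rate_sum {k} r\<bar> \<le> M * \<bar>R - r\<bar>"
              using r0 by (intro cycle_rate_sum_bounds(1)[OF K(2) M(2)[OF K(1)] R_nonneg Rq]) auto
            also have "\<dots> \<le> M * (2 * (1 + r) * \<delta> / m1)" using M C(1) by (intro mult_left_mono) auto
            finally show "\<bar>l - cycle_rate_sum {k} R\<bar> \<le> M * (2 * (1 + r) * \<delta> / m1)" by (simp add: lK abs_minus_commute)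
            have "\<bar>E (\<lambda>G. g (Suc (cycle_count G {k})) * \<xi> G)\<bar> \<le> E (\<lambda>_. b)"
            proof (rule expectation_abs_le)
              fix G
              have "\<bar>g (Suc (cycle_count G {k}))\<bar> * \<bar>\<xi> G\<bar> \<le> b * 1"
                using g(1) b0 by (intro mult_mono \<xi>1) (auto simp: b_def)
              thus "\<bar>g (Suc (cycle_count G {k})) * \<xi> G\<bar> \<le> b" by (simp add: abs_mult)
            qed
            thus "\<bar>E (\<lambda>G. g (Suc (cycle_count G {k})) * \<xi> G)\<bar> \<le> b" by simp
          qed (use M r0 \<delta> m in auto)
          moreover have "b * (M + M ^ 2) * eps \<le> b * (M + M ^ 2) * (4 * \<delta> / m1 ^ 2)"
            using C(2) b0 M by (intro mult_left_mono) auto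
          ultimately have "\<bar>E1 w - c * E2 w\<bar> \<le> M * (2 * (1 + r) * \<delta> / m1) * b + b * (M + M ^ 2) * (4 * \<delta> / m1 ^ 2)"
            by linarith
          also have "\<dots> = D * \<delta>" by (simp add: D_def algebra_simps)
          also have "\<dots> \<le> Y w" by (simp add: Y_def)
          finally show ?thesis .
        qed
      qed
      hence le: "(\<integral>w. \<bar>E1 w - c * E2 w\<bar> \<partial>PW n) \<le> (\<integral>w. Y w \<partial>PW n)"
        using I1(3) I2(3) Yi by (intro integral_mono_AE) auto
      have "p n = (\<integral>w. E1 w - c * E2 w \<partial>PW n)"
        unfolding p_def I1(1) I2(1) using I1(3) I2(3) by simp
      hence "\<bar>p n\<bar> \<le> (\<integral>w. \<bar>E1 w - c * E2 w\<bar> \<partial>PW n)" by (simp only: integral_abs_bound)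
      also note le
      also have "(\<integral>w. Y w \<partial>PW n) = D * \<delta> + 2 * (measure (PW n) (A1 n) + measure (PW n) (A2 n) + measure (PW n) (A3 n))"
      proof -
        have "A1 n \<subseteq> space (PW n)" "A2 n \<subseteq> space (PW n)" "A3 n \<subseteq> space (PW n)" by (auto simp: A1_def A2_def A3_def)
        thus ?thesis unfolding Y_def using ii by (simp add: P.prob_space Int_absorb2)
      qed
      also have "\<dots> < e" using \<delta>D n0[OF n(2)] by linarith
      finally show "norm (p n - 0) < e" by simp
    qed
  qed
  have eq: "p n = measure (RG model n) {G. \<forall>j\<in>insert k J. cycle_count G {j} = a j} -
     poisson_mean (r ^ k / (2 * real k)) (\<lambda>j. of_bool (j = a k)) * measure (RG model n) {G. \<forall>j\<in>J. cycle_count G {j} = a j}" for n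
  proof -
    have "(\<integral>G. h (cycle_count G {k}) * \<xi> G \<partial>RG model n) = (\<integral>G. of_bool (\<forall>j\<in>insert k J. cycle_count G {j} = a j) \<partial>RG model n)"
      by (intro Bochner_Integration.integral_cong) (auto simp: h_def \<xi>_def)
    thus ?thesis unfolding p_def RG_measure c_def l_def h_def \<xi>_def by simp
  qed
  show ?thesis using lim unfolding eq .
qed

lemma joint_limit:
  fixes a :: "nat \<Rightarrow> nat"
  assumes i2: "integrable \<mu> (\<lambda>x. x ^ 2)"
  defines "r \<equiv> (\<integral>x. x ^ 2 \<partial>\<mu>) / (\<integral>x. x \<partial>\<mu>)"
  assumes J: "J \<subseteq> {3..N}"
  shows "(\<lambda>n. measure (RG model n) {G. \<forall>j\<in>J. cycle_count G {j} = a j}) \<longlonglongrightarrow>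
     (\<Prod>j\<in>J. exp (- (r ^ j / (2 * real j))) * (r ^ j / (2 * real j)) ^ a j / fact (a j))"
proof -
  have "finite J" using finite_subset[OF J] by simp
  thus ?thesis using J
  proof (induction J rule: finite_induct)
    case empty
    have "measure (RG model n) UNIV = 1" for n
      using prob_space.prob_space[OF prob_space_RG, of model n] by (simp add: space_RG)
    thus ?case by simp
  next
    case (insert k J)
    let ?c = "poisson_mean (r ^ k / (2 * real k)) (\<lambda>j. of_bool (j = a k))"
    let ?p = "\<lambda>J n. measure (RG model n) {G. \<forall>j\<in>J. cycle_count G {j} = a j}"
    have 1: "(\<lambda>n. ?p (insert k J) n - ?c * ?p J n) \<longlonglongrightarrow> 0"
      unfolding r_def using insert by (intro joint_step[OF i2, where N = N]) auto
    have "(\<lambda>n. (?p (insert k J) n - ?c * ?p J n) + ?c * ?p J n) \<longlonglongrightarrow>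
        0 + ?c * (\<Prod>j\<in>J. exp (- (r ^ j / (2 * real j))) * (r ^ j / (2 * real j)) ^ a j / fact (a j))"
      using insert by (intro tendsto_add[OF 1] tendsto_mult tendsto_const) auto
    thus ?case using insert.hyps by (simp add: poisson_mean_point)
  qed
qed

end

section \<open>Distances to the limit laws\<close>

lemma infsum_cycle_rate:
  assumes r: "0 \<le> r" "r < 1"
  shows "(\<Sum>\<^sub>\<infinity>k\<in>A. r ^ k / (2 * real k)) = total_rate r A"
proof -
  let ?f = "\<lambda>k. if k \<in> A then r ^ k / (2 * real k) else 0"
  have s: "summable ?f" using r by (intro summable_total_rate) auto
  have "(?f has_sum total_rate r A) UNIV"
    unfolding total_rate_def using s r by (intro norm_summable_imp_has_sum summable_sums) (auto cong: if_cong)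
  hence "((\<lambda>k. r ^ k / (2 * real k)) has_sum total_rate r A) A"
    by (rule has_sum_cong_neutral[THEN iffD1, rotated -1]) auto
  thus ?thesis by (rule infsumI)
qed

lemma emeasure_point_measure_rate:
  assumes A: "A \<subseteq> {3..}" and r: "0 \<le> r" "finite A \<or> r < 1"
  shows "emeasure (point_measure {3..} (\<lambda>k. ennreal (r ^ k / (2 * real k)))) A = ennreal (total_rate r A)"
proof -
  have "emeasure (point_measure {3..} (\<lambda>k. ennreal (r ^ k / (2 * real k)))) A =
      (\<integral>\<^sup>+k. ennreal (r ^ k / (2 * real k)) * indicator A k \<partial>count_space {3..})"
    unfolding point_measure_def using A by (subst emeasure_density) auto
  also have "\<dots> = (\<integral>\<^sup>+k. ennreal (r ^ k / (2 * real k)) * indicator A k * indicator {3..} k \<partial>count_space UNIV)"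
    by (rule nn_integral_count_space_indicator) simp
  also have "\<dots> = (\<Sum>k. ennreal (r ^ k / (2 * real k)) * indicator A k * indicator {3..} k)"
    by (rule nn_integral_count_space_nat)
  also have "\<dots> = (\<Sum>k. ennreal (if k \<in> A then r ^ k / (2 * real k) else 0))"
    using A by (intro suminf_cong) (auto simp: indicator_def)
  also have "\<dots> = ennreal (total_rate r A)" unfolding total_rate_def
    using r by (intro suminf_ennreal2 summable_total_rate) auto
  finally show ?thesis .
qed

lemma poisson_point_process_mean:
  assumes \<eta>: "poisson_point_process Q \<eta> \<Lambda>" and A: "A \<subseteq> {3..}" and l: "emeasure \<Lambda> A = ennreal l" "0 \<le> l"
  shows "measure Q {y \<in> space Q. emeasure (\<eta> y) A \<in> of_nat ` B} = poisson_mean l (\<lambda>j. of_bool (j \<in> B))"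
proof -
  interpret Q: prob_space Q using \<eta> by (simp add: poisson_point_process_def)
  have [measurable]: "(\<lambda>\<omega>. emeasure (\<eta> \<omega>) A) \<in> borel_measurable Q"
    using \<eta> A by (simp add: poisson_point_process_def)
  have "measure \<Lambda> A = l" using l by (simp add: measure_def)
  hence pj: "measure Q {\<omega> \<in> space Q. emeasure (\<eta> \<omega>) A = of_nat j} = exp (- l) * l ^ j / fact j" for j :: nat
    using \<eta> A l by (simp add: poisson_point_process_def)
  define S where "S j = {\<omega> \<in> space Q. emeasure (\<eta> \<omega>) A = of_nat j \<and> j \<in> B}" for j :: nat
  have S: "S j \<in> sets Q" for j
  proof (cases "j \<in> B")
    case True
    thus ?thesis unfolding S_def by simp
  qed (simp add: S_def)
  have "(\<lambda>j. measure Q (S j)) sums measure Q (\<Union>j. S j)"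
    by (rule Q.finite_measure_UNION) (use S in \<open>auto simp: disjoint_family_on_def S_def\<close>)
  moreover have "(\<Union>j. S j) = {y \<in> space Q. emeasure (\<eta> y) A \<in> of_nat ` B}" by (auto simp: S_def)
  moreover have "measure Q (S j) = exp (- l) * (l ^ j / fact j) * of_bool (j \<in> B)" for j
    using pj[of j] by (cases "j \<in> B") (simp_all add: S_def)
  ultimately show ?thesis unfolding poisson_mean_def by (simp add: sums_iff)
qed

lemma cycle_process_counting:
  assumes "finite E"
  shows "cycle_process E \<in> counting_measures"
    and "agrees N a (cycle_process E) \<longleftrightarrow> (\<forall>j\<in>{3..N}. cycle_count E {j} = a j)"
proof -
  have "sets (cycle_process E) = Pow {3..}" by (simp add: cycle_process_def)
  moreover have e: "emeasure (cycle_process E) {k} = of_nat (cycle_count E {k})" if "3 \<le> k" for k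
    using that by (intro emeasure_cycle_process assms) auto
  ultimately show "cycle_process E \<in> counting_measures" unfolding counting_measures_def by blast
  show "agrees N a (cycle_process E) \<longleftrightarrow> (\<forall>j\<in>{3..N}. cycle_count E {j} = a j)"
    unfolding agrees_def using e by (auto simp: of_nat_eq_iff)
qed

lemma poisson_point_process_agrees:
  fixes a :: "nat \<Rightarrow> nat"
  assumes \<eta>: "poisson_point_process Q \<eta> \<Lambda>" and \<Lambda>: "\<And>k. 3 \<le> k \<Longrightarrow> emeasure \<Lambda> {k} = ennreal (l k) \<and> 0 \<le> l k"
  shows "{\<omega> \<in> space Q. agrees N a (\<eta> \<omega>)} \<in> sets Q"
    and "measure Q {\<omega> \<in> space Q. agrees N a (\<eta> \<omega>)} = (\<Prod>j\<in>{3..N}. exp (- l j) * l j ^ a j / fact (a j))"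
proof -
  interpret Q: prob_space Q using \<eta> by (simp add: poisson_point_process_def)
  have meas: "(\<lambda>\<omega>. emeasure (\<eta> \<omega>) {k}) \<in> borel_measurable Q" if "k \<in> {3..N}" for k
    using \<eta> that by (simp add: poisson_point_process_def)
  have sk: "{\<omega> \<in> space Q. emeasure (\<eta> \<omega>) {k} = of_nat (a k)} \<in> sets Q" if "k \<in> {3..N}" for k
  proof -
    note [measurable] = meas[OF that]
    show ?thesis by simp
  qed
  show "{\<omega> \<in> space Q. agrees N a (\<eta> \<omega>)} \<in> sets Q"
    unfolding agrees_def by (intro sets.sets_Collect_finite_All' sets.sets_Collect_finite_All sk) auto
  have pk: "measure Q {\<omega> \<in> space Q. emeasure (\<eta> \<omega>) {k} = of_nat (a k)} = exp (- l k) * l k ^ a k / fact (a k)"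
    if "k \<in> {3..N}" for k
  proof -
    have \<Lambda>k: "emeasure \<Lambda> {k} < \<infinity>" "measure \<Lambda> {k} = l k" using \<Lambda>[of k] that by (auto simp: measure_def)
    have "\<forall>A\<subseteq>{3..}. emeasure \<Lambda> A < \<infinity> \<longrightarrow> (\<forall>j::nat. measure Q {\<omega> \<in> space Q. emeasure (\<eta> \<omega>) A = of_nat j}
        = exp (- measure \<Lambda> A) * measure \<Lambda> A ^ j / fact j)"
      using \<eta> unfolding poisson_point_process_def by (elim conjE)
    from this[rule_format, of "{k}" "a k"] show ?thesis using that \<Lambda>k by simp
  qed
  show "measure Q {\<omega> \<in> space Q. agrees N a (\<eta> \<omega>)} = (\<Prod>j\<in>{3..N}. exp (- l j) * l j ^ a j / fact (a j))"
  \<comment> \<open>For \<open>N < 3\<close> there is no point to test, and the intersection over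
    the empty family would not stay inside \<open>space Q\<close>.\<close>
  proof (cases "3 \<le> N")
    case False
    thus ?thesis by (simp add: agrees_def Q.prob_space)
  next
    case True
    let ?A = "(\<lambda>k. {k}) ` {3..N}"
    let ?X = "\<lambda>A \<omega>. emeasure (\<eta> \<omega>) A"
    have ind: "Q.indep_vars (\<lambda>_. borel) ?X ?A"
    proof -
      have "finite ?A \<and> ?A \<subseteq> Pow {3..} \<and> disjoint ?A" by (auto simp: disjoint_def)
      thus ?thesis using \<eta> unfolding poisson_point_process_def by blast
    qed
    have inj: "inj_on (\<lambda>k. {k}) {3..N}" by (auto simp: inj_on_def)
    \<comment> \<open>The family is indexed by singletons; \<open>the_elem\<close> recovers the
      point.\<close>
    define Y where "Y S = {of_nat (a (the_elem S)) :: ennreal}" for S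
    have vim: "?X {k} -` Y {k} \<inter> space Q = {\<omega> \<in> space Q. emeasure (\<eta> \<omega>) {k} = of_nat (a k)}" for k
      by (auto simp: Y_def)
    have "{\<omega> \<in> space Q. agrees N a (\<eta> \<omega>)} = (\<Inter>S\<in>?A. ?X S -` Y S \<inter> space Q)"
      using True unfolding agrees_def by (auto simp: Y_def)
    also have "measure Q \<dots> = (\<Prod>S\<in>?A. measure Q (?X S -` Y S \<inter> space Q))"
      using True by (intro Q.indep_varsD[OF ind]) (auto simp: Y_def)
    also have "\<dots> = (\<Prod>k\<in>{3..N}. measure Q (?X {k} -` Y {k} \<inter> space Q))"
      by (subst prod.reindex[OF inj]) simp
    also have "\<dots> = (\<Prod>j\<in>{3..N}. exp (- l j) * l j ^ a j / fact (a j))"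
      unfolding vim by (intro prod.cong refl pk)
    finally show ?thesis .
  qed
qed

text \<open>A graph without cycles has the value 0 and belongs to every such event, which is the
  first alternative. The event is thereby expressed through two cycle counts being zero or
  not.\<close>

lemma shortest_cycle_le_iff:
  assumes E: "finite E"
  shows "shortest_cycle E \<le> T \<longleftrightarrow> cycle_count E {3..} = 0 \<or> 0 < cycle_count E {3..T}"
proof -
  have fin: "finite (cycles E)" by (rule finite_cycles[OF E])
  have z: "cycle_count E {3..} = 0 \<longleftrightarrow> cycles E = {}"
    unfolding cycle_count_def using fin card_ge_3_cycles[of _ E] by auto
  have p: "0 < cycle_count E {3..T} \<longleftrightarrow> (\<exists>C\<in>cycles E. card C \<le> T)"
    unfolding cycle_count_def using fin card_ge_3_cycles[of _ E] by (auto simp: card_gt_0_iff)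
  show ?thesis
  proof (cases "cycles E = {}")
    case False
    thus ?thesis unfolding z p using fin by (simp add: shortest_cycle_def Min_le_iff)
  qed (simp add: z shortest_cycle_def)
qed

text \<open>Here the value 0 of a graph without cycles fits the inequality, so one void event
  suffices. The intersection with \<open>{3..}\<close> cuts off something only for
  \<open>T < 2\<close>.\<close>

lemma longest_cycle_le_iff:
  assumes E: "finite E"
  shows "longest_cycle E \<le> T \<longleftrightarrow> cycle_count E ({T + 1..} \<inter> {3..}) = 0"
proof -
  have fin: "finite (cycles E)" by (rule finite_cycles[OF E])
  have z: "cycle_count E ({T + 1..} \<inter> {3..}) = 0 \<longleftrightarrow> (\<forall>C\<in>cycles E. card C \<le> T)"
  proof -
    have "{C \<in> cycles E. card C \<in> {T + 1..} \<inter> {3..}} = {C \<in> cycles E. T < card C}"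
      using card_ge_3_cycles[of _ E] by auto
    thus ?thesis unfolding cycle_count_def using fin by (auto simp: not_less)
  qed
  show ?thesis
  proof (cases "cycles E = {}")
    case False
    thus ?thesis unfolding z using fin by (simp add: longest_cycle_def)
  qed (simp add: z longest_cycle_def)
qed

lemma nat_le_real_iff:
  assumes "0 \<le> t" shows "real k \<le> t \<longleftrightarrow> k \<le> nat \<lfloor>t\<rfloor>"
  using assms by linarith

lemma has_shortest_law_cdf:
  assumes S: "has_shortest_law R S lam" and t: "0 \<le> t"
  shows "measure R {x \<in> space R. real (S x) \<le> t} = exp (- (\<Sum>\<^sub>\<infinity>k\<in>{3..}. lam k)) +
     (1 - exp (- (\<Sum>k = 3..nat \<lfloor>t\<rfloor>. lam k)))"
proof -
  interpret R: prob_space R using S by (simp add: has_shortest_law_def)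
  have [measurable]: "S \<in> measurable R (count_space UNIV)" using S by (simp add: has_shortest_law_def)
  define T where "T = nat \<lfloor>t\<rfloor>"
  have z: "measure R {x \<in> space R. S x = 0} = exp (- (\<Sum>\<^sub>\<infinity>k\<in>{3..}. lam k))"
    using S by (simp add: has_shortest_law_def)
  have v: "S x = 0 \<or> 3 \<le> S x" if "x \<in> space R" for x using S that by (simp add: has_shortest_law_def)
  have eq: "{x \<in> space R. real (S x) \<le> t} = {x \<in> space R. S x = 0} \<union> {x \<in> space R. 3 \<le> S x \<and> S x \<le> T}"
    unfolding nat_le_real_iff[OF t] T_def using v by force
  have "measure R {x \<in> space R. real (S x) \<le> t} =
      measure R {x \<in> space R. S x = 0} + measure R {x \<in> space R. 3 \<le> S x \<and> S x \<le> T}"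
    unfolding eq by (rule R.finite_measure_Union) auto
  moreover have "measure R {x \<in> space R. 3 \<le> S x \<and> S x \<le> T} = 1 - exp (- (\<Sum>k = 3..T. lam k))"
  proof (cases "3 \<le> T")
    case True
    thus ?thesis using S by (simp add: has_shortest_law_def)
  next
    case False
    hence empty: "{x \<in> space R. 3 \<le> S x \<and> S x \<le> T} = {}" by auto
    show ?thesis unfolding empty using False by simp
  qed
  ultimately show ?thesis using z by (simp add: T_def)
qed

lemma has_longest_law_cdf:
  assumes L: "has_longest_law R L lam" and t: "0 \<le> t"
  shows "measure R {x \<in> space R. real (L x) \<le> t} = exp (- (\<Sum>\<^sub>\<infinity>k\<in>{nat \<lfloor>t\<rfloor> + 1..} \<inter> {3..}. lam k))"
proof -
  define T where "T = nat \<lfloor>t\<rfloor>"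
  have v: "L x = 0 \<or> 3 \<le> L x" if "x \<in> space R" for x using L that by (simp add: has_longest_law_def)
  have eq: "{x \<in> space R. real (L x) \<le> t} = {x \<in> space R. L x \<le> T}"
    unfolding nat_le_real_iff[OF t] T_def ..
  show ?thesis
  proof (cases "3 \<le> T")
    case True
    moreover from this have "{T + 1..} \<inter> {3..} = {T + 1..}" by auto
    ultimately show ?thesis using L unfolding eq T_def[symmetric] by (simp add: has_longest_law_def)
  next
    case False
    hence "{T + 1..} \<inter> {3..} = {3::nat..}" by auto
    moreover have "{x \<in> space R. L x \<le> T} = {x \<in> space R. L x = 0}" using v False by force
    ultimately show ?thesis using L unfolding eq T_def[symmetric] by (simp add: has_longest_law_def)
  qed
qed

lemma poisson_mean_zero: "poisson_mean l (\<lambda>j. of_bool (j \<in> {0})) = exp (- l)"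
  using poisson_mean_point[of l 0] by simp

section \<open>Distances between the random graph and the limit laws\<close>

context weight_law
begin

lemma finite_all_edges_subset: "G \<subseteq> all_edges {1..n::nat} \<Longrightarrow> finite G"
  using finite_subset finite_all_edges[of "{1..n}"] by blast

lemma AE_RG: "AE G in RG model n. G \<subseteq> all_edges {1..n}"
proof -
  interpret P: prob_space "RG model n" by (rule prob_space_RG)
  have "measure (RG model n) {G. True} \<le> measure (RG model n) {G. G \<subseteq> all_edges {1..n}}" by (rule RG_mono) auto
  hence "measure (RG model n) {G. G \<subseteq> all_edges {1..n}} = 1"
    using P.prob_space by (intro antisym P.prob_le_1) (simp add: space_RG)
  thus ?thesis using P.prob_eq_1[of "{G. G \<subseteq> all_edges {1..n}}"] sets_RG[of model n] by simp
qed

lemma d_TV_RG_le: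
  assumes A: "A \<subseteq> {3..}" and \<eta>: "poisson_point_process Q \<eta> \<Lambda>" and l: "emeasure \<Lambda> A = ennreal l" "0 \<le> l"
    and le: "\<And>B. \<bar>measure (RG model n) {G. cycle_count G A \<in> B} - poisson_mean l (\<lambda>j. of_bool (j \<in> B))\<bar> \<le> c"
  shows "d_TV (RG model n) (\<lambda>E. emeasure (cycle_process E) A) Q (\<lambda>\<omega>. emeasure (\<eta> \<omega>) A) \<le> c"
  unfolding d_TV_def
proof (rule cSUP_least)
  fix B :: "nat set"
  have "measure (RG model n) {x \<in> space (RG model n). emeasure (cycle_process x) A \<in> of_nat ` B} =
      measure (RG model n) {G. emeasure (cycle_process G) A \<in> of_nat ` B}" by (simp add: space_RG)
  also have "\<dots> = measure (RG model n) {G. cycle_count G A \<in> B}"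
    by (rule RG_cong) (auto simp: emeasure_cycle_process[OF finite_all_edges_subset A])
  finally show "\<bar>measure (RG model n) {x \<in> space (RG model n). emeasure (cycle_process x) A \<in> of_nat ` B} -
      measure Q {y \<in> space Q. emeasure (\<eta> y) A \<in> of_nat ` B}\<bar> \<le> c"
    using le[of B] poisson_point_process_mean[OF \<eta> A l] by simp
qed simp

text \<open>The distribution function at \<open>t \<ge> 0\<close> combines the void probabilities of
  \<open>{3..}\<close> and \<open>{3..T}\<close>, each with error \<open>c\<close>; hence the factor
  2.\<close>

lemma d_Kol_shortest_le:
  assumes S: "has_shortest_law R S (\<lambda>k. r ^ k / (2 * real k))" and r: "0 \<le> r" "r < 1" and c: "0 \<le> c"
    and le: "\<And>A. A \<subseteq> {3..} \<Longrightarrow> \<bar>measure (RG model n) {G. cycle_count G A = 0} - exp (- total_rate r A)\<bar> \<le> c"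
  shows "d_Kol (RG model n) (\<lambda>E. real (shortest_cycle E)) R (\<lambda>x. real (S x)) \<le> 2 * c"
  unfolding d_Kol_def
proof (rule cSUP_least)
  fix t :: real
  interpret P: prob_space "RG model n" by (rule prob_space_RG)
  show "\<bar>measure (RG model n) {x \<in> space (RG model n). real (shortest_cycle x) \<le> t} -
      measure R {y \<in> space R. real (S y) \<le> t}\<bar> \<le> 2 * c"
  proof (cases "0 \<le> t")
    case False
    hence neg: "real k \<le> t \<longleftrightarrow> k \<in> {}" for k by simp
    show ?thesis unfolding neg using c by simp
  next
    case True
    define T where "T = nat \<lfloor>t\<rfloor>"
    let ?Z = "{G. cycle_count G {3..} = 0}" and ?T = "{G. cycle_count G {3..T} = 0}"
    have "measure (RG model n) {x \<in> space (RG model n). real (shortest_cycle x) \<le> t} =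
        measure (RG model n) {G. shortest_cycle G \<le> T}"
      by (simp add: space_RG nat_le_real_iff[OF True] T_def)
    \<comment> \<open>\<open>finite G\<close> is added because \<open>card\<close> of an infinite
      set is 0; on infinite edge sets the two alternatives could overlap.\<close>
    also have "\<dots> = measure (RG model n) {G. cycle_count G {3..} = 0 \<or> finite G \<and> 0 < cycle_count G {3..T}}"
      by (rule RG_cong) (use finite_all_edges_subset[of _ n] in \<open>simp add: shortest_cycle_le_iff\<close>)
    also have "\<dots> = measure (RG model n) (?Z \<union> {G. finite G \<and> 0 < cycle_count G {3..T}})"
      by (rule arg_cong[of _ _ "measure (RG model n)"]) auto
    also have "\<dots> = measure (RG model n) ?Z + measure (RG model n) {G. finite G \<and> 0 < cycle_count G {3..T}}"
    proof (rule P.finite_measure_Union)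
      show "?Z \<inter> {G. finite G \<and> 0 < cycle_count G {3..T}} = {}"
      proof (rule equals0I)
        fix G assume G: "G \<in> ?Z \<inter> {G. finite G \<and> 0 < cycle_count G {3..T}}"
        have "cycle_count G {3..T} \<le> cycle_count G {3..}"
          unfolding cycle_count_def using finite_cycles[of G] G by (intro card_mono) auto
        thus False using G by simp
      qed
    qed (simp_all add: sets_RG)
    also have "measure (RG model n) {G. finite G \<and> 0 < cycle_count G {3..T}} = measure (RG model n) {G. \<not> cycle_count G {3..T} = 0}"
      by (rule RG_cong) (use finite_all_edges_subset[of _ n] in auto)
    also have "\<dots> = 1 - measure (RG model n) ?T"
    proof -
      have "space (RG model n) - ?T = {G. \<not> cycle_count G {3..T} = 0}" by (auto simp: space_RG)
      thus ?thesis using P.prob_compl[of ?T] by (simp only: sets_RG UNIV_I simp_thms)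
    qed
    finally have 1: "measure (RG model n) {x \<in> space (RG model n). real (shortest_cycle x) \<le> t} =
        measure (RG model n) ?Z + (1 - measure (RG model n) ?T)" .
    have fs: "(\<Sum>k = 3..T. r ^ k / (2 * real k)) = total_rate r {3..T}"
      by (simp add: total_rate_finite cycle_rate_sum_def)
    have "{3..T} \<subseteq> {3..}" by auto
    thus ?thesis using le[of "{3..}"] le[of "{3..T}"]
      unfolding 1 has_shortest_law_cdf[OF S True] infsum_cycle_rate[OF r] T_def[symmetric] fs by simp
  qed
qed simp

lemma d_Kol_longest_le:
  assumes S: "has_longest_law R S (\<lambda>k. r ^ k / (2 * real k))" and r: "0 \<le> r" "r < 1" and c: "0 \<le> c"
    and le: "\<And>A. A \<subseteq> {3..} \<Longrightarrow> \<bar>measure (RG model n) {G. cycle_count G A = 0} - exp (- total_rate r A)\<bar> \<le> c"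
  shows "d_Kol (RG model n) (\<lambda>E. real (longest_cycle E)) R (\<lambda>x. real (S x)) \<le> c"
  unfolding d_Kol_def
proof (rule cSUP_least)
  fix t :: real
  show "\<bar>measure (RG model n) {x \<in> space (RG model n). real (longest_cycle x) \<le> t} -
      measure R {y \<in> space R. real (S y) \<le> t}\<bar> \<le> c"
  proof (cases "0 \<le> t")
    case False
    hence neg: "real k \<le> t \<longleftrightarrow> k \<in> {}" for k by simp
    show ?thesis unfolding neg using c by simp
  next
    case True
    define T where "T = nat \<lfloor>t\<rfloor>"
    have "measure (RG model n) {x \<in> space (RG model n). real (longest_cycle x) \<le> t} =
        measure (RG model n) {G. longest_cycle G \<le> T}"
      by (simp add: space_RG nat_le_real_iff[OF True] T_def)
    also have "\<dots> = measure (RG model n) {G. cycle_count G ({T + 1..} \<inter> {3..}) = 0}"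
      by (rule RG_cong) (use finite_all_edges_subset[of _ n] in \<open>simp only: longest_cycle_le_iff\<close>)
    finally show ?thesis using le[of "{T + 1..} \<inter> {3..}"]
      unfolding has_longest_law_cdf[OF S True] infsum_cycle_rate[OF r] T_def[symmetric] by simp
  qed
qed simp

lemma cycle_process_converges:
  assumes i2: "integrable \<mu> (\<lambda>x. x ^ 2)"
  defines "r \<equiv> (\<integral>x. x ^ 2 \<partial>\<mu>) / (\<integral>x. x \<partial>\<mu>)"
  assumes \<eta>: "poisson_point_process Q \<eta> \<Lambda>"
    and \<Lambda>: "\<And>k. 3 \<le> k \<Longrightarrow> emeasure \<Lambda> {k} = ennreal (r ^ k / (2 * real k)) \<and> 0 \<le> r ^ k / (2 * real k)"
  shows "converges_in_distribution vague_topology (RG model) (\<lambda>n. cycle_process) Q \<eta>"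
proof (rule converges_in_distribution_vagueI)
  show "AE G in RG model n. cycle_process G \<in> counting_measures" for n
    using AE_RG[where model = model and n = n] by eventually_elim (rule cycle_process_counting(1)[OF finite_all_edges_subset])
  show "prob_space Q" "\<And>\<omega>. \<omega> \<in> space Q \<Longrightarrow> \<eta> \<omega> \<in> counting_measures"
    using \<eta> by (simp_all add: poisson_point_process_def)
  note ag = poisson_point_process_agrees[where l = "\<lambda>k. r ^ k / (2 * real k)", OF \<eta> \<Lambda>]
  show "{\<omega> \<in> space Q. agrees N a (\<eta> \<omega>)} \<in> sets Q" for N a by (rule ag(1))
  show "(\<lambda>n. measure (RG model n) {G. agrees N a (cycle_process G)}) \<longlonglongrightarrow> measure Q {\<omega> \<in> space Q. agrees N a (\<eta> \<omega>)}" for N a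
  proof -
    have "measure (RG model n) {G. agrees N a (cycle_process G)} =
        measure (RG model n) {G. \<forall>j\<in>{3..N}. cycle_count G {j} = a j}" for n
      by (rule RG_cong) (rule cycle_process_counting(2)[OF finite_all_edges_subset])
    thus ?thesis using joint_limit[OF i2 subset_refl, where model = model and N = N and a = a] ag(2)[of N a] unfolding r_def by simp
  qed
qed (rule prob_space_RG sets_RG)+

end

lemma weight_law_distr:
  assumes "prob_space M" "W \<in> borel_measurable M" "AE x in M. 0 < W x"
  shows "weight_law (distr M borel W)"
proof -
  interpret M: prob_space M by fact
  interpret D: prob_space "distr M borel W" by (rule M.prob_space_distr[OF assms(2)])
  show ?thesis
  proof
    show "AE x in distr M borel W. 0 < x" using assms by (subst AE_distr_iff) auto
  qed simp
qed

theorem mainTheorem6: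
  fixes M :: "'a measure" and W :: "'a \<Rightarrow> real"
    and model :: graph_model
    and G :: "nat \<Rightarrow> nat set set measure"
    and Q :: "'b measure" and \<eta> :: "'b \<Rightarrow> nat measure"
    and R\<^sub>S :: "'c measure" and S :: "'c \<Rightarrow> nat"
    and R\<^sub>L :: "'d measure" and L :: "'d \<Rightarrow> nat"
  assumes "prob_space M" and "W \<in> borel_measurable M" and "AE x in M. 0 < W x"
    and G: "\<And>n. G n = random_graph model (distr M borel W) n"
    and \<eta>: "poisson_point_process Q \<eta> (cycle_intensity M W)"
  shows
    "(integrable M (\<lambda>x. W x ^ 2) \<longrightarrow>
       converges_in_distribution vague_topology G (\<lambda>n. cycle_process) Q \<eta>) \<and>
     (integrable M (\<lambda>x. W x ^ 4) \<longrightarrow>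
       (\<forall>N::nat. \<exists>C>0. \<forall>A\<subseteq>{3..N}. \<forall>n\<ge>3.
          d_TV (G n) (\<lambda>E. emeasure (cycle_process E) A) Q (\<lambda>\<omega>. emeasure (\<eta> \<omega>) A) \<le> C / real n)) \<and>
     (integrable M (\<lambda>x. W x ^ 2) \<and> (\<integral>x. W x ^ 2 \<partial>M) < (\<integral>x. W x \<partial>M) \<longrightarrow>
       (\<forall>a>0. \<exists>C>0. \<forall>n\<ge>3.
          measure (G n) {E \<in> space (G n). 0 < cycle_count E {nat \<lfloor>a * ln (real n)\<rfloor> + 1..n}}
            \<le> C * real n powr
                (a * ln (2 * (\<integral>x. W x ^ 2 \<partial>M) / ((\<integral>x. W x ^ 2 \<partial>M) + (\<integral>x. W x \<partial>M)))))) \<and>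
     (integrable M (\<lambda>x. W x ^ 4) \<and> (\<integral>x. W x ^ 2 \<partial>M) < (\<integral>x. W x \<partial>M) \<longrightarrow>
       (\<exists>C>0. \<forall>n\<ge>3. \<forall>A\<subseteq>{3..}.
          d_TV (G n) (\<lambda>E. emeasure (cycle_process E) A) Q (\<lambda>\<omega>. emeasure (\<eta> \<omega>) A)
            \<le> C * ln (real n) ^ 3 / real n)) \<and>
     (integrable M (\<lambda>x. W x ^ 4) \<and> (\<integral>x. W x ^ 2 \<partial>M) < (\<integral>x. W x \<partial>M) \<longrightarrow>
       (has_shortest_law R\<^sub>S S (cycle_rate M W) \<longrightarrow>
          (\<exists>C>0. \<forall>n\<ge>3.
             d_Kol (G n) (\<lambda>E. real (shortest_cycle E)) R\<^sub>S (\<lambda>x. real (S x))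
               \<le> C * ln (real n) ^ 3 / real n)) \<and>
       (has_longest_law R\<^sub>L L (cycle_rate M W) \<longrightarrow>
          (\<exists>C>0. \<forall>n\<ge>3.
             d_Kol (G n) (\<lambda>E. real (longest_cycle E)) R\<^sub>L (\<lambda>x. real (L x))
               \<le> C * ln (real n) ^ 3 / real n)))"
proof -
  define \<mu> where "\<mu> = distr M borel W"
  interpret weight_law \<mu> unfolding \<mu>_def by (rule weight_law_distr[OF assms(1-3)])
  have GR: "G = (\<lambda>n. random_graph model \<mu> n)" using G by (simp add: \<mu>_def fun_eq_iff)
  have int: "integrable M (\<lambda>x. W x ^ k) \<longleftrightarrow> integrable \<mu> (\<lambda>x. x ^ k)" for k
    unfolding \<mu>_def using assms(2) by (subst integrable_distr_eq) auto
  have I: "(\<integral>x. W x ^ k \<partial>M) = (\<integral>x. x ^ k \<partial>\<mu>)" for k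
    unfolding \<mu>_def using assms(2) by (subst integral_distr) auto
  have I1: "(\<integral>x. W x \<partial>M) = (\<integral>x. x \<partial>\<mu>)" using I[of 1] by simp
  define r where "r = (\<integral>x. x ^ 2 \<partial>\<mu>) / (\<integral>x. x \<partial>\<mu>)"
  have rate: "cycle_rate M W = (\<lambda>k. r ^ k / (2 * real k))"
    by (simp add: cycle_rate_def fun_eq_iff I I1 r_def)
  have r0: "0 < r" if "integrable \<mu> (\<lambda>x. x ^ 2)"
    unfolding r_def using moment_pos[of 1] moment_pos[of 2] integrable_power_le[OF that, of 1] that by simp
  have r1: "r < 1" if "integrable \<mu> (\<lambda>x. x ^ 2)" "(\<integral>x. x ^ 2 \<partial>\<mu>) < (\<integral>x. x \<partial>\<mu>)"
    unfolding r_def using moment_pos[of 1] integrable_power_le[OF that(1), of 1] that by simp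
  have i24: "integrable \<mu> (\<lambda>x. x ^ 2)" if "integrable \<mu> (\<lambda>x. x ^ 4)"
    using integrable_power_le[OF that, of 2] by simp
  have \<Lambda>: "emeasure (cycle_intensity M W) A = ennreal (total_rate r A)"
    if "A \<subseteq> {3..}" "0 < r" "finite A \<or> r < 1" for A
    unfolding cycle_intensity_def rate using that by (intro emeasure_point_measure_rate) auto
  \<comment> \<open>The approximations are obtained with error \<open>C / n\<close>; as
    \<open>exp 1 \<le> 3\<close>, the factor \<open>ln (real n) ^ 3\<close> is at least 1.\<close>
  have ln3: "C / real n \<le> C * ln (real n) ^ 3 / real n" if "3 \<le> n" "0 < C" for C :: real and n :: nat
  proof -
    have "exp 1 \<le> real n" using exp_le that by linarith
    hence "1 \<le> ln (real n)" using that by (subst ln_ge_iff) auto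
    hence "1 \<le> ln (real n) ^ 3" by (rule one_le_power)
    thus ?thesis using that by (intro divide_right_mono) auto
  qed
  have p1: "converges_in_distribution vague_topology G (\<lambda>n. cycle_process) Q \<eta>"
    if i2: "integrable \<mu> (\<lambda>x. x ^ 2)"
    unfolding GR
  proof (rule cycle_process_converges[OF i2 \<eta>])
    fix k :: nat assume "3 \<le> k"
    thus "emeasure (cycle_intensity M W) {k} = ennreal (((\<integral>x. x ^ 2 \<partial>\<mu>) / (\<integral>x. x \<partial>\<mu>)) ^ k / (2 * real k)) \<and>
        0 \<le> ((\<integral>x. x ^ 2 \<partial>\<mu>) / (\<integral>x. x \<partial>\<mu>)) ^ k / (2 * real k)"
      using \<Lambda>[of "{k}"] r0[OF i2] unfolding r_def[symmetric] by (simp add: total_rate_finite cycle_rate_sum_def)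
  qed
  have p2: "\<exists>C>0. \<forall>A\<subseteq>{3..N}. \<forall>n\<ge>3.
      d_TV (G n) (\<lambda>E. emeasure (cycle_process E) A) Q (\<lambda>\<omega>. emeasure (\<eta> \<omega>) A) \<le> C / real n"
    if i4: "integrable \<mu> (\<lambda>x. x ^ 4)" for N
  proof -
    note r = r0[OF i24[OF i4]]
    obtain C where C: "0 < C" "\<And>n A B. 0 < n \<Longrightarrow> A \<subseteq> {3..N} \<Longrightarrow> \<bar>measure (RG model n) {G. cycle_count G A \<in> B} -
        poisson_mean (total_rate r A) (\<lambda>j. of_bool (j \<in> B))\<bar> \<le> C / real n"
      using poisson_approximation_bounded_length[OF i4, of N model] unfolding r_def by auto
    show ?thesis
    proof (intro exI[of _ C] conjI allI impI C(1))
      fix A and n :: nat assume A: "A \<subseteq> {3..N}" and n: "3 \<le> n"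
      have fA: "finite A" "A \<subseteq> {3..}" using A finite_subset[OF A] by auto
      show "d_TV (G n) (\<lambda>E. emeasure (cycle_process E) A) Q (\<lambda>\<omega>. emeasure (\<eta> \<omega>) A) \<le> C / real n"
        unfolding GR
        by (rule d_TV_RG_le[OF fA(2) \<eta>]) (use \<Lambda>[of A] fA r C(2) A n total_rate_nonneg in auto)
    qed
  qed
  have p45: "\<exists>C>0. \<forall>n>0. \<forall>A\<subseteq>{3..}. \<forall>B. \<bar>measure (RG model n) {G. cycle_count G A \<in> B} -
        poisson_mean (total_rate r A) (\<lambda>j. of_bool (j \<in> B))\<bar> \<le> C / real n"
    if "integrable \<mu> (\<lambda>x. x ^ 4)" "(\<integral>x. x ^ 2 \<partial>\<mu>) < (\<integral>x. x \<partial>\<mu>)"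
    unfolding r_def by (rule poisson_approximation_subcritical[OF that])
  have p4: "\<exists>C>0. \<forall>n\<ge>3. \<forall>A\<subseteq>{3..}.
      d_TV (G n) (\<lambda>E. emeasure (cycle_process E) A) Q (\<lambda>\<omega>. emeasure (\<eta> \<omega>) A) \<le> C * ln (real n) ^ 3 / real n"
    if i4: "integrable \<mu> (\<lambda>x. x ^ 4)" and sub: "(\<integral>x. x ^ 2 \<partial>\<mu>) < (\<integral>x. x \<partial>\<mu>)"
  proof -
    note r = r0[OF i24[OF i4]] r1[OF i24[OF i4] sub]
    obtain C where C: "0 < C" "\<And>n A B. 0 < n \<Longrightarrow> A \<subseteq> {3..} \<Longrightarrow> \<bar>measure (RG model n) {G. cycle_count G A \<in> B} -
        poisson_mean (total_rate r A) (\<lambda>j. of_bool (j \<in> B))\<bar> \<le> C / real n"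
      using p45[OF i4 sub] by auto
    show ?thesis
    proof (intro exI[of _ C] conjI allI impI C(1))
      fix A :: "nat set" and n :: nat assume n: "3 \<le> n" and A: "A \<subseteq> {3..}"
      have "d_TV (G n) (\<lambda>E. emeasure (cycle_process E) A) Q (\<lambda>\<omega>. emeasure (\<eta> \<omega>) A) \<le> C / real n"
        unfolding GR
        by (rule d_TV_RG_le[OF A \<eta>]) (use \<Lambda>[of A] A r C(2) n total_rate_nonneg in auto)
      thus "d_TV (G n) (\<lambda>E. emeasure (cycle_process E) A) Q (\<lambda>\<omega>. emeasure (\<eta> \<omega>) A) \<le> C * ln (real n) ^ 3 / real n"
        using ln3[OF n C(1)] by linarith
    qed
  qed
  \<comment> \<open>The case \<open>B = {0}\<close> of the approximation, where the Poisson
    probability is an exponential.\<close>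
  have void: "\<exists>C>0. \<forall>n\<ge>3. \<forall>A\<subseteq>{3..}. \<bar>measure (RG model n) {G. cycle_count G A = 0} - exp (- total_rate r A)\<bar> \<le> C / real n"
    if i4: "integrable \<mu> (\<lambda>x. x ^ 4)" and sub: "(\<integral>x. x ^ 2 \<partial>\<mu>) < (\<integral>x. x \<partial>\<mu>)"
  proof -
    obtain C where C: "0 < C" "\<And>n A B. 0 < n \<Longrightarrow> A \<subseteq> {3..} \<Longrightarrow> \<bar>measure (RG model n) {G. cycle_count G A \<in> B} -
        poisson_mean (total_rate r A) (\<lambda>j. of_bool (j \<in> B))\<bar> \<le> C / real n"
      using p45[OF i4 sub] by auto
    show ?thesis using C(1) C(2)[of _ _ "{0}"] unfolding poisson_mean_zero by (intro exI[of _ C]) auto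
  qed
  have p5a: "\<exists>C>0. \<forall>n\<ge>3. d_Kol (G n) (\<lambda>E. real (shortest_cycle E)) R\<^sub>S (\<lambda>x. real (S x)) \<le> C * ln (real n) ^ 3 / real n"
    if i4: "integrable \<mu> (\<lambda>x. x ^ 4)" and sub: "(\<integral>x. x ^ 2 \<partial>\<mu>) < (\<integral>x. x \<partial>\<mu>)"
      and S: "has_shortest_law R\<^sub>S S (cycle_rate M W)"
  proof -
    note r = r0[OF i24[OF i4]] r1[OF i24[OF i4] sub]
    obtain C where C: "0 < C" "\<And>n A. 3 \<le> n \<Longrightarrow> A \<subseteq> {3..} \<Longrightarrow>
        \<bar>measure (RG model n) {G. cycle_count G A = 0} - exp (- total_rate r A)\<bar> \<le> C / real n"
      using void[OF i4 sub] by auto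
    show ?thesis
    proof (intro exI[of _ "2 * C"] conjI allI impI)
      fix n :: nat assume n: "3 \<le> n"
      have "d_Kol (G n) (\<lambda>E. real (shortest_cycle E)) R\<^sub>S (\<lambda>x. real (S x)) \<le> 2 * (C / real n)"
        unfolding GR by (rule d_Kol_shortest_le[OF S[unfolded rate]]) (use r C n in auto)
      thus "d_Kol (G n) (\<lambda>E. real (shortest_cycle E)) R\<^sub>S (\<lambda>x. real (S x)) \<le> 2 * C * ln (real n) ^ 3 / real n"
        using ln3[OF n, of "2 * C"] C(1) by simp
    qed (use C in simp)
  qed
  have p5b: "\<exists>C>0. \<forall>n\<ge>3. d_Kol (G n) (\<lambda>E. real (longest_cycle E)) R\<^sub>L (\<lambda>x. real (L x)) \<le> C * ln (real n) ^ 3 / real n"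
    if i4: "integrable \<mu> (\<lambda>x. x ^ 4)" and sub: "(\<integral>x. x ^ 2 \<partial>\<mu>) < (\<integral>x. x \<partial>\<mu>)"
      and L: "has_longest_law R\<^sub>L L (cycle_rate M W)"
  proof -
    note r = r0[OF i24[OF i4]] r1[OF i24[OF i4] sub]
    obtain C where C: "0 < C" "\<And>n A. 3 \<le> n \<Longrightarrow> A \<subseteq> {3..} \<Longrightarrow>
        \<bar>measure (RG model n) {G. cycle_count G A = 0} - exp (- total_rate r A)\<bar> \<le> C / real n"
      using void[OF i4 sub] by auto
    show ?thesis
    proof (intro exI[of _ C] conjI allI impI C(1))
      fix n :: nat assume n: "3 \<le> n"
      have "d_Kol (G n) (\<lambda>E. real (longest_cycle E)) R\<^sub>L (\<lambda>x. real (L x)) \<le> C / real n"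
        unfolding GR by (rule d_Kol_longest_le[OF L[unfolded rate]]) (use r C n in auto)
      thus "d_Kol (G n) (\<lambda>E. real (longest_cycle E)) R\<^sub>L (\<lambda>x. real (L x)) \<le> C * ln (real n) ^ 3 / real n"
        using ln3[OF n C(1)] by linarith
    qed
  qed
  have p3: "\<exists>C>0. \<forall>n\<ge>3. measure (G n) {E \<in> space (G n). 0 < cycle_count E {nat \<lfloor>a * ln (real n)\<rfloor> + 1..n}}
      \<le> C * real n powr (a * ln (2 * (\<integral>x. x ^ 2 \<partial>\<mu>) / ((\<integral>x. x ^ 2 \<partial>\<mu>) + (\<integral>x. x \<partial>\<mu>))))"
    if "integrable \<mu> (\<lambda>x. x ^ 2)" "(\<integral>x. x ^ 2 \<partial>\<mu>) < (\<integral>x. x \<partial>\<mu>)" "0 < a" for a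
    using long_cycle_probability[OF that, of model] unfolding GR by (simp add: space_RG)
  show ?thesis unfolding int I I1
    by (intro conjI impI allI; (elim conjE)?; (rule p1 p2 p3 p4 p5a p5b; assumption))
qed

end
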